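(* Let $\lambda/\mu$ be a skew partition and $n$ a positive integer. Put $n' = n - \tau\big(((\lambda/\mu)^{n\sharp})^{\mathsf{ba}}\big)$ and $\lambda^{\mathrm{red}}/\mu^{\mathrm{red}} = ((((\lambda/\mu)^{n\sharp})^{\mathsf{ba}})^{\mathsf{ti}})^{\mathsf{or}}$. Then the skew Schur polynomial $s_{\lambda^{\mathrm{red}}/\mu^{\mathrm{red}}}(x_1,\ldots,x_{n'})$ is basic, $n$-sharp, tight and ordinary (that is, the skew partition $\lambda^{\mathrm{red}}/\mu^{\mathrm{red}}$ is basic, $n$-sharp, tight and ordinary). Further, $s_{\lambda/\mu}(x_1,\ldots,x_n)$ is multiplicity-free if and only if $s_{\lambda^{\mathrm{red}}/\mu^{\mathrm{red}}}(x_1,\ldots,x_{n'})$ is multiplicity-free.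
   Context: A partition is a (possibly empty) finite weakly decreasing sequence of positive integers; $\ell(\lambda)$ is its number of entries, and entries beyond $\ell(\lambda)$ are taken to be $0$. A skew partition $\lambda/\mu$ is a pair of partitions with $\mu\subseteq\lambda$; its diagram is the set of boxes $(r,c)$ (row $r$ from the top, column $c$ from the left) with $\mu_r<c\le\lambda_r$. Rows are indexed by $1,\dots,\ell(\lambda)$ and columns by $1,\dots,\lambda_1$. The skew Schur polynomial $s_{\lambda/\mu}(x_1,\dots,x_n)$ is the sum of $x_1^{\eta_1(T)}\cdots x_n^{\eta_n(T)}$ over semistandard tableaux $T$ of shape $\lambda/\mu$ (rows weakly increasing left to right, columns strictly increasing top to bottom) with entries in $\{1,\dots,n\}$, where $\eta_i(T)$ is the number of entries equal to $i$. One has $s_{\lambda/\mu}(x_1,\dots,x_n)=\sum_{\nu:\ \ell(\nu)\le n}c^\lambda_{\mu,\nu}s_\nu(x_1,\dots,x_n)$ with Littlewood–Richardson coefficients $c^\lambda_{\mu,\nu}$; $s_{\lambda/\mu}(x_1,\dots,x_n)$ is multiplicity-free if $c^\lambda_{\mu,\nu}\in\{0,1\}$ for all partitions $\nu$ with $\ell(\nu)\le n$. We also write a partition as $(\lambda_1^{l_1},\dots,\lambda_p^{l_p})$ with $\lambda_1>\dots>\lambda_p>0$ its distinct parts and $l_i>0$ their multiplicities; then $\mathsf{np}(\lambda)=p$. It is a rectangle if $p=1$. Basic: $\lambda/\mu$ is basic if its diagram has no empty rows or columns. The basic demolition $(\lambda/\mu)^{\mathsf{ba}}$ is obtained by deleting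 all empty rows and columns. $n$-sharp: let $\mathsf{CS}_k(\lambda/\mu)$ be the number of boxes of $\lambda/\mu$ in column $k$. $\lambda/\mu$ is $n$-sharp if $\mathsf{CS}_k(\lambda/\mu)<n$ for all $k$. The $n$-sharp demolition $(\lambda/\mu)^{n\sharp}$ is $\emptyset/\emptyset$ if some $\mathsf{CS}_k(\lambda/\mu)>n$; otherwise it is the skew partition left after deleting every column $k$ with $\mathsf{CS}_k(\lambda/\mu)=n$ (deleting column $k$ means deleting the $k$-th column from both diagrams $\lambda$ and $\mu$). Tight: for $\lambda=(\lambda_1^{l_1},\dots,\lambda_p^{l_p})$, set $\tau(\lambda/\mu)=\sigma(\lambda/\mu)=0$ if $\mu=\emptyset$ or $\lambda$ is a rectangle; otherwise $\tau(\lambda/\mu)=l_1-\min(l_1,\ell(\mu))$ and $\sigma(\lambda/\mu)=\lambda_p-\min(\mu_1,\lambda_p)$. A basic $\lambda/\mu$ is tight if $\tau=\sigma=0$. The tight demolition is $$(\lambda/\mu)^{\mathsf{ti}}=\big(((\lambda_1-\sigma)^{l_1-\tau},(\lambda_2-\sigma)^{l_2},\dots,(\lambda_p-\sigma)^{l_p})/\mu\big)^{\mathsf{ba}},\quad \tau=\tau(\lambda/\mu),\ \sigma=\sigma(\lambda/\mu).$$ Ordinary: for $\lambda\subseteq(a^b)$ the $(a^b)$-complement is $\lambda^{\vee(a^b)}=(a-\lambda_b,a-\lambda_{b-1},\dots,a-\lambda_1)$ (ordinary row lengths, trailing zeros removed). A basic $\lambda/\mu$ is ordinary if $\mathsf{np}(\lambda)-1\le\mathsf{np}(\mu)$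 or $\mu=\emptyset$. The ordinary reduction $(\lambda/\mu)^{\mathsf{or}}$ is $\mu^{\vee(\lambda_1^{\ell(\lambda)})}/\lambda^{\vee(\lambda_1^{\ell(\lambda)})}$ if $\mathsf{np}(\lambda)-1>\mathsf{np}(\mu)$ and $\mu\ne\emptyset$, and is $\lambda/\mu$ otherwise. *)

theory Defs
  imports "HOL-Library.Poly_Mapping" "HOL-Library.FuncSet"
begin

section \<open>Partitions and skew partitions\<close>

definition is_partition :: "nat list \<Rightarrow> bool" where
  "is_partition lam \<longleftrightarrow> sorted_wrt (\<ge>) lam \<and> 0 \<notin> set lam"

text \<open>Rows and columns are numbered from 1; row lengths outside the list are 0.\<close>

definition part :: "nat list \<Rightarrow> nat \<Rightarrow> nat" where
  "part lam r = (if 1 \<le> r \<and> r \<le> length lam then lam ! (r - 1) else 0)"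

text \<open>The pair \<open>(lam, mu)\<close> stands for \<open>lam/mu\<close>.\<close>

type_synonym skew = "nat list \<times> nat list"

fun skew_partition :: "skew \<Rightarrow> bool" where
  "skew_partition (lam, mu) \<longleftrightarrow>
     is_partition lam \<and> is_partition mu \<and> (\<forall>r. part mu r \<le> part lam r)"

fun diagram :: "skew \<Rightarrow> (nat \<times> nat) set" where
  "diagram (lam, mu) = {(r, c). part mu r < c \<and> c \<le> part lam r}"

fun rows :: "skew \<Rightarrow> nat set" where
  "rows (lam, mu) = {1..length lam}"

fun cols :: "skew \<Rightarrow> nat set" where
  "cols (lam, mu) = {1..part lam 1}"

text \<open>The number of distinct parts.\<close>

definition np :: "nat list \<Rightarrow> nat" where
  "np lam = card (set lam)"

definition rectangle :: "nat list \<Rightarrow> bool" where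
  "rectangle lam \<longleftrightarrow> np lam = 1"


section \<open>Skew Schur polynomials\<close>

text \<open>A tableau is a function on the diagram; as a total function it is
  \<^const>\<open>undefined\<close> elsewhere, so that every tableau is counted once.\<close>

definition ssyt :: "nat \<Rightarrow> skew \<Rightarrow> (nat \<times> nat \<Rightarrow> nat) set" where
  "ssyt n S = {T \<in> diagram S \<rightarrow>\<^sub>E {1..n}.
     (\<forall>r c c'. (r, c) \<in> diagram S \<and> (r, c') \<in> diagram S \<and> c < c' \<longrightarrow> T (r, c) \<le> T (r, c')) \<and>
     (\<forall>r r' c. (r, c) \<in> diagram S \<and> (r', c) \<in> diagram S \<and> r < r' \<longrightarrow> T (r, c) < T (r', c))}"

definition content :: "skew \<Rightarrow> (nat \<times> nat \<Rightarrow> nat) \<Rightarrow> nat \<Rightarrow> nat" where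
  "content S T i = card {b \<in> diagram S. T b = i}"

text \<open>Integer polynomials in the variables \<open>x\<^sub>0, x\<^sub>1, \<dots>\<close>: finitely supported
  functions from exponent vectors to coefficients.\<close>

type_synonym int_mpoly = "(nat \<Rightarrow>\<^sub>0 nat) \<Rightarrow>\<^sub>0 int"

definition X :: "nat \<Rightarrow> int_mpoly" where
  "X i = Poly_Mapping.single (Poly_Mapping.single i 1) 1"

definition skew_schur :: "nat \<Rightarrow> skew \<Rightarrow> int_mpoly" where
  "skew_schur n S = (\<Sum>T \<in> ssyt n S. \<Prod>i \<in> {1..n}. X i ^ content S T i)"

definition schur :: "nat \<Rightarrow> nat list \<Rightarrow> int_mpoly" where
  "schur n nu = skew_schur n (nu, [])"

text \<open>The Littlewood-Richardson coefficients of a skew partition \<open>S\<close> are the coefficients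
  of the expansion of the skew Schur polynomials in Schur polynomials, with one family
  \<open>c\<close> for all numbers of variables \<open>n\<close> simultaneously. Since Schur polynomials of
  partitions with at most \<open>n\<close> parts are linearly independent, the expansions
  determine \<open>c\<close>. For fixed \<open>n\<close>, only the \<open>c nu\<close> with \<open>length nu \<le> n\<close> are
  involved.\<close>

definition schur_expansion :: "skew \<Rightarrow> (nat list \<Rightarrow> int) \<Rightarrow> bool" where
  "schur_expansion S c \<longleftrightarrow>
     finite {nu. c nu \<noteq> 0} \<and> (\<forall>nu. c nu \<noteq> 0 \<longrightarrow> is_partition nu) \<and>
     (\<forall>n. skew_schur n S = (\<Sum>nu | c nu \<noteq> 0 \<and> length nu \<le> n. of_int (c nu) * schur n nu))"

definition lr_coeff :: "skew \<Rightarrow> nat list \<Rightarrow> int" where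
  "lr_coeff S = (THE c. schur_expansion S c)"

definition multiplicity_free :: "nat \<Rightarrow> skew \<Rightarrow> bool" where
  "multiplicity_free n S \<longleftrightarrow>
     (\<forall>nu. is_partition nu \<and> length nu \<le> n \<longrightarrow> lr_coeff S nu \<in> {0, 1})"


section \<open>Basic, sharp, tight and ordinary skew partitions\<close>

definition delete_rows :: "nat set \<Rightarrow> nat list \<Rightarrow> nat list" where
  "delete_rows R lam = nths lam {i. Suc i \<notin> R}"

definition delete_cols :: "nat set \<Rightarrow> nat list \<Rightarrow> nat list" where
  "delete_cols K lam = filter (\<lambda>x. x > 0) (map (\<lambda>x. card ({1..x} - K)) lam)"

definition empty_rows :: "skew \<Rightarrow> nat set" where
  "empty_rows S = {r \<in> rows S. \<forall>c. (r, c) \<notin> diagram S}"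

definition empty_cols :: "skew \<Rightarrow> nat set" where
  "empty_cols S = {c \<in> cols S. \<forall>r. (r, c) \<notin> diagram S}"

definition basic :: "skew \<Rightarrow> bool" where
  "basic S \<longleftrightarrow> empty_rows S = {} \<and> empty_cols S = {}"

fun basic_demolition :: "skew \<Rightarrow> skew" where
  "basic_demolition (lam, mu) =
     (let R = empty_rows (lam, mu); K = empty_cols (lam, mu)
      in (delete_cols K (delete_rows R lam), delete_cols K (delete_rows R mu)))"

definition CS :: "nat \<Rightarrow> skew \<Rightarrow> nat" where
  "CS k S = card {r. (r, k) \<in> diagram S}"

definition sharp :: "nat \<Rightarrow> skew \<Rightarrow> bool" where
  "sharp n S \<longleftrightarrow> (\<forall>k \<in> cols S. CS k S < n)"

fun sharp_demolition :: "nat \<Rightarrow> skew \<Rightarrow> skew" where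
  "sharp_demolition n (lam, mu) =
     (if \<exists>k \<in> cols (lam, mu). CS k (lam, mu) > n then ([], [])
      else let K = {k \<in> cols (lam, mu). CS k (lam, mu) = n}
           in (delete_cols K lam, delete_cols K mu))"

text \<open>For a nonempty partition \<open>lam\<close>, the multiplicity of its largest part is
  \<open>count_list lam (hd lam)\<close>, and its smallest part is \<open>last lam\<close>.\<close>

fun tau :: "skew \<Rightarrow> nat" where
  "tau (lam, mu) =
     (if mu = [] \<or> rectangle lam then 0
      else count_list lam (hd lam) - min (count_list lam (hd lam)) (length mu))"

fun sigma :: "skew \<Rightarrow> nat" where
  "sigma (lam, mu) =
     (if mu = [] \<or> rectangle lam then 0
      else last lam - min (hd mu) (last lam))"

definition tight :: "skew \<Rightarrow> bool" where
  "tight S \<longleftrightarrow> basic S \<and> tau S = 0 \<and> sigma S = 0"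

text \<open>As \<open>tau\<close> is at most the multiplicity of the largest part, dropping the first
  \<open>tau\<close> rows lowers this multiplicity by \<open>tau\<close>. No part becomes 0, as \<open>sigma\<close> is
  less than the smallest part.\<close>

fun tight_demolition :: "skew \<Rightarrow> skew" where
  "tight_demolition (lam, mu) =
     basic_demolition (map (\<lambda>x. x - sigma (lam, mu)) (drop (tau (lam, mu)) lam), mu)"

definition complement :: "nat \<Rightarrow> nat \<Rightarrow> nat list \<Rightarrow> nat list" where
  "complement a b lam = filter (\<lambda>x. x > 0) (map (\<lambda>i. a - part lam i) (rev [1..<Suc b]))"

fun ordinary :: "skew \<Rightarrow> bool" where
  "ordinary (lam, mu) \<longleftrightarrow> basic (lam, mu) \<and> (np lam - 1 \<le> np mu \<or> mu = [])"

fun ordinary_reduction :: "skew \<Rightarrow> skew" where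
  "ordinary_reduction (lam, mu) =
     (if np lam - 1 > np mu \<and> mu \<noteq> []
      then (complement (part lam 1) (length lam) mu, complement (part lam 1) (length lam) lam)
      else (lam, mu))"

end

theory Submission
  imports Defs "HOL-Library.Multiset" "HOL-Library.Infinite_Set"
begin

text \<open>Unitriangularity of the Kostka numbers determines the coefficients of the Schur expansion.
  Deleting empty rows and columns, or rotating the diagram by 180 degrees, does not change the skew
  Schur polynomial. A column of height \<open>n\<close> is filled with \<open>1, \<dots>, n\<close>, so its deletion divides by
  \<open>x\<^sub>1 \<cdots> x\<^sub>n\<close>. If the diagram has a row that meets all its columns, then every \<open>\<nu>\<close> in the expansion has
  first part \<open>\<lambda>\<^sub>1\<close>, and the coefficient of the highest power of one variable shows that removing this part
  from each \<open>\<nu>\<close> gives the expansion for \<open>\<lambda>\<close> without its first row. Dually, a column that meets all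
  \<open>b\<close> rows forces \<open>\<nu>\<close> to have length \<open>b\<close>, and the adjoint of multiplication by \<open>e\<^sub>b\<close> removes the first
  column of \<open>\<lambda>\<close> and of each \<open>\<nu>\<close>. Iterating these two steps is the tight demolition.\<close>

section \<open>Kostka numbers by chains of strips\<close>

text \<open>A symmetric function is represented by the family of its coefficients at all contents.
  The expansion coefficients are known only through linear equations, so nothing is available about
  their sign and terms of an expansion might cancel. Each bound on the partitions \<nu> that occur
  is therefore drawn from an extremal \<nu>: an operation on contents isolates the largest first row
  or the largest first column and leaves a linear relation between independent Kostka families.

  The number of variables needs care. Removing a full row takes one row from each \<nu>, so the
  bound n on the number of rows drops by 1; this is the origin of n' = n - \<open>tau\<close>.
  Removing a column that meets all b rows keeps n, but adding it back must not lead beyond n rows,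
  and sharpness supplies b \<le> n. Deleting a column with n boxes is an identity in n variables
  only, so independence is required for each fixed n among partitions with at most n parts.\<close>

text \<open>Partitions are handled as weakly decreasing functions with eventual value 0; the argument
  \<open>i\<close> is the row with number \<open>i + 1\<close>.\<close>

type_synonym shape = "nat \<Rightarrow> nat"

definition ptn :: "shape \<Rightarrow> bool" where
  "ptn f \<longleftrightarrow> antimono f \<and> (\<exists>b. f b = 0)"

definition psize :: "shape \<Rightarrow> nat" where
  "psize f = (\<Sum>i | f i \<noteq> 0. f i)"

definition hstrip :: "shape \<Rightarrow> shape \<Rightarrow> bool" where
  "hstrip f g \<longleftrightarrow> (\<forall>i. g i \<le> f i \<and> f (Suc i) \<le> g i)"

definition hstrips :: "shape \<Rightarrow> nat \<Rightarrow> shape set" where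
  "hstrips f a = {g. hstrip f g \<and> psize f = psize g + a}"

text \<open>The skew Kostka numbers: \<open>kostka f g as\<close> counts the chains of horizontal strips from \<open>f\<close>
  down to \<open>g\<close>, that is, the semistandard tableaux in which the first entry of \<open>as\<close> is the
  multiplicity of the largest value.\<close>

fun kostka :: "shape \<Rightarrow> shape \<Rightarrow> nat list \<Rightarrow> int" where
  "kostka f g [] = of_bool (f = g)"
| "kostka f g (a # as) = (\<Sum>h\<in>hstrips f a. kostka h g as)"

lemma ptnD: "ptn f \<Longrightarrow> i \<le> j \<Longrightarrow> f j \<le> f i"
  by (auto simp: ptn_def antimono_def)

lemma ptnI: "(\<And>i. f (Suc i) \<le> f i) \<Longrightarrow> f b = 0 \<Longrightarrow> ptn f"
  unfolding ptn_def antimono_iff_le_Suc by auto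

lemma ptn_bound: assumes "ptn f" obtains b where "\<And>i. i \<ge> b \<Longrightarrow> f i = 0"
  using assms ptnD[OF assms] unfolding ptn_def by (metis le_zero_eq)

lemma psize_eq: "(\<And>i. i \<ge> b \<Longrightarrow> f i = 0) \<Longrightarrow> psize f = sum f {..<b}"
  unfolding psize_def by (rule sum.mono_neutral_left) (simp, force simp: not_less[symmetric], simp)

lemma hstrip_ptn: assumes "ptn f" "hstrip f g" shows "ptn g"
proof -
  obtain b where "f b = 0" using assms(1) unfolding ptn_def by blast
  then have "g b = 0" using assms(2) unfolding hstrip_def by (metis le_zero_eq)
  moreover have "g (Suc i) \<le> g i" for i using assms(2) unfolding hstrip_def by (meson le_trans)
  ultimately show ?thesis by (metis ptnI)
qed

lemma finite_below: assumes "ptn f" shows "finite {g. \<forall>i. g i \<le> f i}"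
proof -
  obtain b where b: "\<And>i. i \<ge> b \<Longrightarrow> f i = 0" using ptn_bound[OF assms] by blast
  have "{g. \<forall>i. g i \<le> f i} \<subseteq> {g. \<forall>x. (x \<in> {..<b} \<longrightarrow> g x \<in> {..f 0}) \<and> (x \<notin> {..<b} \<longrightarrow> g x = 0)}"
  proof (intro subsetI CollectI allI conjI impI)
    fix g i assume "g \<in> {g. \<forall>i. g i \<le> f i}"
    then have g: "g i \<le> f i" by blast
    show "g i \<in> {..f 0}" using g ptnD[OF assms, of 0 i] by simp
    show "g i = 0" if "i \<notin> {..<b}" using g b[of i] that by simp
  qed
  then show ?thesis
    by (rule finite_subset) (rule finite_set_of_finite_funs, auto)
qed

lemma psize_le: assumes "ptn f" "\<And>i. g i \<le> f i"
  shows "psize g \<le> psize f" "psize g = psize f \<Longrightarrow> g = f"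
proof -
  obtain b where b: "\<And>i. i \<ge> b \<Longrightarrow> f i = 0" using ptn_bound[OF assms(1)] by blast
  have b': "\<And>i. i \<ge> b \<Longrightarrow> g i = 0" using b assms(2) by (metis le_zero_eq)
  have e: "psize f = sum f {..<b}" "psize g = sum g {..<b}"
    using b b' by (auto intro!: psize_eq)
  show "psize g \<le> psize f" unfolding e using assms(2) by (auto intro: sum_mono)
  assume "psize g = psize f"
  then have "sum g {..<b} = sum f {..<b}" using e by simp
  then have "\<forall>i\<in>{..<b}. g i = f i"
    using assms(2) by (metis (no_types, lifting) finite_lessThan le_neq_implies_less sum_strict_mono_ex1 less_irrefl)
  then show "g = f" using b b' by (metis ext lessThan_iff not_less)
qed

lemma finite_hstrips: "ptn f \<Longrightarrow> finite (hstrips f a)"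
  by (rule finite_subset[OF _ finite_below[of f]]) (auto simp: hstrips_def hstrip_def)

lemma hstrips_ptn: "ptn f \<Longrightarrow> g \<in> hstrips f a \<Longrightarrow> ptn g"
  using hstrip_ptn by (auto simp: hstrips_def)

lemma hstrips_0: "ptn f \<Longrightarrow> hstrips f 0 = {f}"
  using psize_le(2)[of f] ptnD[of f i "Suc i" for i] by (auto simp: hstrips_def hstrip_def)

lemma kostka_0: "ptn f \<Longrightarrow> kostka f g (0 # as) = kostka f g as"
  by (simp add: hstrips_0)

text \<open>The partitions that lie between \<open>f\<close> and \<open>t\<close> in a chain of two horizontal strips form a
  product of intervals. Reversing each interval is the Bender-Knuth involution.\<close>

definition flip_hi :: "shape \<Rightarrow> shape \<Rightarrow> nat \<Rightarrow> nat" where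
  "flip_hi f t i = (case i of 0 \<Rightarrow> f 0 | Suc j \<Rightarrow> min (f i) (t j))"

definition flip_lo :: "shape \<Rightarrow> shape \<Rightarrow> nat \<Rightarrow> nat" where
  "flip_lo f t i = max (t i) (f (Suc i))"

lemma hstrip_hstrip_iff: "hstrip f g \<and> hstrip g t \<longleftrightarrow> (\<forall>i. flip_lo f t i \<le> g i \<and> g i \<le> flip_hi f t i)"
proof
  assume "hstrip f g \<and> hstrip g t"
  then show "\<forall>i. flip_lo f t i \<le> g i \<and> g i \<le> flip_hi f t i"
    unfolding hstrip_def flip_lo_def flip_hi_def by (auto split: nat.split)
next
  assume a: "\<forall>i. flip_lo f t i \<le> g i \<and> g i \<le> flip_hi f t i"
  have "g i \<le> f i" for i using a[rule_format, of i] by (cases i) (auto simp: flip_hi_def)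
  moreover have "g (Suc i) \<le> t i" for i using a[rule_format, of "Suc i"] by (auto simp: flip_hi_def)
  moreover have "f (Suc i) \<le> g i \<and> t i \<le> g i" for i using a[rule_format, of i] by (auto simp: flip_lo_def)
  ultimately show "hstrip f g \<and> hstrip g t" unfolding hstrip_def by auto
qed

text \<open>The lower end in row b and the upper end in row b + 1 are the maximum and the minimum of
  the same two numbers \<open>t b\<close> and \<open>f (Suc b)\<close>, so they add up to the sum of
  these. The upper end in row 0 is \<open>f 0\<close>.\<close>

lemma sum_lo_hi: "(\<Sum>i<b. flip_lo f t i + flip_hi f t i) + flip_hi f t b = (\<Sum>i<b. f i + t i) + f b"
proof (induction b)
  case 0 show ?case by (simp add: flip_hi_def)
next
  case (Suc b)
  have "flip_lo f t b + flip_hi f t (Suc b) = t b + f (Suc b)" by (auto simp: flip_lo_def flip_hi_def)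
  then show ?case using Suc by simp
qed

definition flip :: "shape \<Rightarrow> shape \<Rightarrow> shape \<Rightarrow> nat \<Rightarrow> nat" where
  "flip f t g i = flip_lo f t i + flip_hi f t i - g i"

lemma flip: assumes "ptn f" "hstrip f g" "hstrip g t"
  shows "hstrip f (flip f t g)" "hstrip (flip f t g) t" "flip f t (flip f t g) = g"
    "psize (flip f t g) + psize g = psize f + psize t"
proof -
  have b: "flip_lo f t i \<le> g i" "g i \<le> flip_hi f t i" for i using assms hstrip_hstrip_iff by blast+
  have "flip_lo f t i \<le> flip f t g i \<and> flip f t g i \<le> flip_hi f t i" for i
    using b[of i] by (auto simp: flip_def)
  then show h: "hstrip f (flip f t g)" "hstrip (flip f t g) t" using hstrip_hstrip_iff by blast+
  have "flip f t (flip f t g) i = g i" for i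
    using b[of i] by (auto simp: flip_def)
  then show "flip f t (flip f t g) = g" by blast
  obtain n where n: "\<And>i. i \<ge> n \<Longrightarrow> f i = 0" using ptn_bound[OF assms(1)] by blast
  have n1: "\<And>i. i \<ge> n \<Longrightarrow> g i = 0" using n assms(2) unfolding hstrip_def by (metis le_zero_eq)
  have n2: "\<And>i. i \<ge> n \<Longrightarrow> t i = 0" using n1 assms(3) unfolding hstrip_def by (metis le_zero_eq)
  have n3: "\<And>i. i \<ge> n \<Longrightarrow> flip f t g i = 0" using n h(1) unfolding hstrip_def by (metis le_zero_eq)
  have "psize (flip f t g) + psize g = (\<Sum>i<n. flip f t g i + g i)"
    using n1 n3 by (simp add: psize_eq[of n] sum.distrib)
  also have "\<dots> = (\<Sum>i<n. flip_lo f t i + flip_hi f t i)"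
  proof (intro sum.cong refl)
    fix i
    show "flip f t g i + g i = flip_lo f t i + flip_hi f t i" using b[of i] by (simp add: flip_def)
  qed
  also have "\<dots> = (\<Sum>i<n. f i + t i)"
  proof -
    have "flip_hi f t n = 0" using n[of n] by (auto simp: flip_hi_def split: nat.split)
    then show ?thesis using sum_lo_hi[of f t n] n[of n] by simp
  qed
  also have "\<dots> = psize f + psize t" using n n2 by (simp add: psize_eq[of n] sum.distrib)
  finally show "psize (flip f t g) + psize g = psize f + psize t" .
qed

text \<open>With the end t of the first two strips fixed, \<open>flip\<close> acts on the shape
  between them; the sizes of the shape and of its image add up to \<open>psize f + psize t\<close>,
  which exchanges the two strip sizes.\<close>

lemma kostka_swap: assumes "ptn f" shows "kostka f g (a # b # as) = kostka f g (b # a # as)"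
proof -
  have *: "kostka f g (a # b # as) = (\<Sum>(h,t)\<in>(SIGMA h:hstrips f a. hstrips h b). kostka t g as)" for a b
    using assms by (simp add: sum.Sigma finite_hstrips hstrips_ptn[OF assms])
  have **: "flip f t h \<in> hstrips f b \<and> t \<in> hstrips (flip f t h) a \<and> flip f t (flip f t h) = h"
    if "h \<in> hstrips f a" "t \<in> hstrips h b" for h t a b
  proof -
    have "hstrip f h" "hstrip h t" "psize f = psize h + a" "psize h = psize t + b"
      using that by (auto simp: hstrips_def)
    then show ?thesis using flip[OF assms, of h t] by (auto simp: hstrips_def)
  qed
  show ?thesis unfolding *
    by (rule sum.reindex_bij_witness[where i="\<lambda>(h,t). (flip f t h, t)" and j="\<lambda>(h,t). (flip f t h, t)"])
      (use ** in auto)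
qed

lemma kostka_move: "ptn f \<Longrightarrow> kostka f g (xs @ a # ys) = kostka f g (a # xs @ ys)"
proof (induction xs arbitrary: f)
  case (Cons x xs)
  have "kostka f g ((x # xs) @ a # ys) = kostka f g (x # a # xs @ ys)"
    using Cons hstrips_ptn[OF Cons.prems] by simp
  then show ?case using kostka_swap[OF Cons.prems] by simp
qed simp

text \<open>This is the symmetry of skew Schur polynomials in their variables.\<close>

lemma kostka_perm: "ptn f \<Longrightarrow> mset xs = mset ys \<Longrightarrow> kostka f g xs = kostka f g ys"
proof (induction xs arbitrary: f ys)
  case (Cons x xs)
  then obtain us ws where ys: "ys = us @ x # ws"
    by (metis list.set_intros(1) mset_eq_setD split_list)
  then have "mset xs = mset (us @ ws)" using Cons.prems by simp
  then have "kostka f g (x # xs) = kostka f g (x # us @ ws)"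
    using Cons.IH[of _ "us @ ws"] hstrips_ptn[OF Cons.prems(1)] unfolding kostka.simps by (intro sum.cong) auto
  then show ?case using kostka_move[OF Cons.prems(1)] ys by simp
qed simp

lemma kostka_filter: "ptn f \<Longrightarrow> kostka f g (filter (\<lambda>x. x \<noteq> 0) xs) = kostka f g xs"
proof (induction xs arbitrary: f)
  case (Cons x xs)
  then show ?case using kostka_0[of f g] hstrips_ptn[OF Cons.prems] by (cases "x = 0") simp_all
qed simp

lemma kostka_cong: "ptn f \<Longrightarrow> mset (filter (\<lambda>x. x \<noteq> 0) xs) = mset (filter (\<lambda>x. x \<noteq> 0) ys)
    \<Longrightarrow> kostka f g xs = kostka f g ys"
  by (metis kostka_filter kostka_perm)

text \<open>A horizontal strip takes at most one box from each column, so a column with more than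
  \<open>length as\<close> boxes admits no chain. The second conjunct records this.\<close>

lemma kostka_nonzero: "ptn f \<Longrightarrow> kostka f g as \<noteq> 0 \<Longrightarrow>
    (\<forall>i. g i \<le> f i) \<and> (\<forall>i. f (i + length as) \<le> g i) \<and> psize f = psize g + sum_list as"
proof (induction as arbitrary: f)
  case Nil
  then show ?case by (auto split: if_splits)
next
  case (Cons a as)
  then obtain h where h: "h \<in> hstrips f a" "kostka h g as \<noteq> 0"
    by (metis kostka.simps(2) sum.neutral)
  then have "(\<forall>i. g i \<le> h i) \<and> (\<forall>i. h (i + length as) \<le> g i) \<and> psize h = psize g + sum_list as"
    using Cons hstrips_ptn by blast
  then show ?case using h(1) unfolding hstrips_def hstrip_def by simp (meson le_trans)
qed

section \<open>Vertical strips and the adjoint of multiplication by elementary symmetric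
  functions\<close>

text \<open>The interlacing in \<open>hstrip\<close> makes g weakly decreasing by itself; the bound
  of one box per row does not, so \<open>ptn g\<close> is demanded.\<close>

definition vstrip :: "shape \<Rightarrow> shape \<Rightarrow> bool" where
  "vstrip f g \<longleftrightarrow> ptn g \<and> (\<forall>i. g i \<le> f i \<and> f i \<le> Suc (g i))"

definition vstrips :: "shape \<Rightarrow> nat \<Rightarrow> shape set" where
  "vstrips f k = {g. vstrip f g \<and> psize f = psize g + k}"

lemma finite_vstrips: "ptn f \<Longrightarrow> finite (vstrips f a)"
  by (rule finite_subset[OF _ finite_below[of f]]) (auto simp: vstrips_def vstrip_def)

lemma vstrips_ptn: "g \<in> vstrips f a \<Longrightarrow> ptn g"
  by (auto simp: vstrips_def vstrip_def)

lemma vstrips_0: "ptn f \<Longrightarrow> vstrips f 0 = {f}"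
  using psize_le(2)[of f] by (auto simp: vstrips_def vstrip_def dest: ptnD)

text \<open>The operator adjoint to multiplication by \<open>e\<^sub>k\<close>, written through those adjoint to the \<open>h\<^sub>j\<close>
  (prefixing \<open>j\<close> to the content), so that it is visibly linear on families of Kostka numbers.\<close>

fun eop :: "nat \<Rightarrow> (nat list \<Rightarrow> int) \<Rightarrow> nat list \<Rightarrow> int" where
  "eop 0 F as = F as"
| "eop (Suc k) F as = (\<Sum>j\<le>k. (- 1) ^ j * eop (k - j) F (Suc j # as))"

lemma eop_sum: "eop k (\<lambda>as. \<Sum>x\<in>B. c x * F x as) as = (\<Sum>x\<in>B. c x * eop k (F x) as)"
proof (induction k "\<lambda>as. \<Sum>x\<in>B. c x * F x as" as rule: eop.induct)
  case (2 k as)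
  have "eop (Suc k) (\<lambda>as. \<Sum>x\<in>B. c x * F x as) as
    = (\<Sum>j\<le>k. \<Sum>x\<in>B. c x * ((- 1) ^ j * eop (k - j) (F x) (Suc j # as)))"
    using 2 by (simp add: sum_distrib_left algebra_simps)
  also have "\<dots> = (\<Sum>x\<in>B. c x * eop (Suc k) (F x) as)"
    by (subst sum.swap) (simp add: sum_distrib_left)
  finally show ?case .
qed simp

text \<open>The sign-reversing involution behind \<open>\<Sum> (-1)^j e\<^sub>k\<^sub>-\<^sub>j h\<^sub>j = 0\<close>: the last box of the first
  row in which \<open>f\<close> and \<open>t\<close> differ moves from one strip to the other.\<close>

definition toggle :: "shape \<Rightarrow> shape \<Rightarrow> shape \<Rightarrow> shape" where
  "toggle f t g = (let r = (LEAST i. t i \<noteq> f i) in g (r := if g r = f r then f r - 1 else f r))"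

lemma toggle: assumes "ptn f" "vstrip f g" "hstrip g t" "f \<noteq> t"
  shows "vstrip f (toggle f t g)" "hstrip (toggle f t g) t" "toggle f t (toggle f t g) = g"
    "psize (toggle f t g) = Suc (psize g) \<or> Suc (psize (toggle f t g)) = psize g"
proof -
  define r where "r = (LEAST i. t i \<noteq> f i)"
  have tg: "t i \<le> g i" "g (Suc i) \<le> t i" "g i \<le> f i" "f i \<le> Suc (g i)" for i
    using assms unfolding vstrip_def hstrip_def by auto
  have ex: "\<exists>i. t i \<noteq> f i" using assms(4) by auto
  have r: "t r < f r" using LeastI_ex[OF ex] tg(1)[of r] tg(3)[of r] unfolding r_def by simp
  have lt: "t i = f i" if "i < r" for i using not_less_Least that unfolding r_def by blast
  have T: "toggle f t g = g (r := if g r = f r then f r - 1 else f r)" for g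
    unfolding toggle_def r_def[symmetric] Let_def ..
  have gr: "g r = f r \<or> g r = f r - 1" using tg[of r] by linarith
  show h: "hstrip (toggle f t g) t" unfolding hstrip_def
  proof
    fix i
    \<comment> \<open>Raising row r to \<open>f r\<close> could break the interlacing only against
      row r - 1, where t still agrees with f.\<close>
    have "f (Suc i) \<le> t i" if "Suc i = r" using lt[of i] that ptnD[OF assms(1), of i "Suc i"] by simp
    then show "t i \<le> toggle f t g i \<and> toggle f t g (Suc i) \<le> t i"
      using tg[of i] r unfolding T by (auto split: if_splits)
  qed
  have le: "toggle f t g i \<le> f i \<and> f i \<le> Suc (toggle f t g i)" for i
    using tg(3)[of i] tg(4)[of i] r unfolding T by auto
  obtain b where "f b = 0" using assms(1) unfolding ptn_def by blast
  then have "ptn (toggle f t g)" using h le[of b]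
    by (intro ptnI[of _ b]) (auto simp: hstrip_def intro: le_trans)
  then show "vstrip f (toggle f t g)" using le unfolding vstrip_def by blast
  show "toggle f t (toggle f t g) = g" using gr r unfolding T by auto
  obtain n where n: "\<And>i. i \<ge> n \<Longrightarrow> f i = 0" using ptn_bound[OF assms(1)] by blast
  have rn: "r < n" using r n[of r] by (cases "r < n") auto
  have p: "psize h = sum h ({..<n} - {r}) + h r" if "\<And>i. h i \<le> f i" for h
  proof -
    have "psize h = sum h {..<n}" using n that by (intro psize_eq) (metis le_zero_eq)
    then show ?thesis using rn by (simp add: sum.remove[of _ r] add.commute)
  qed
  have "sum (toggle f t g) ({..<n} - {r}) = sum g ({..<n} - {r})"
    unfolding T by (intro sum.cong) auto
  moreover have "toggle f t g r = Suc (g r) \<or> Suc (toggle f t g r) = g r"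
    using gr r unfolding T by auto
  ultimately show "psize (toggle f t g) = Suc (psize g) \<or> Suc (psize (toggle f t g)) = psize g"
    using p[of g] p[of "toggle f t g"] tg(3) le by auto
qed

lemma sum_vstrip_hstrip: assumes "ptn f" "k > 0"
  shows "(\<Sum>j\<le>k. (- 1) ^ j * (\<Sum>h\<in>vstrips f (k - j). \<Sum>t\<in>hstrips h j. G t)) = (0::int)"
proof -
  define P where "P = {(h,t). vstrip f h \<and> hstrip h t \<and> psize f = psize t + k}"
  \<comment> \<open>The strip size j is recovered from the pair as \<open>psize h - psize t\<close>.
    The double sum thus becomes one sum over P, on which \<open>toggle\<close> reverses the
    sign.\<close>
  define w where "w = (\<lambda>(h,t). (- 1) ^ (psize h - psize t) * (G t :: int))"
  have finP: "finite P"
  proof (rule finite_subset)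
    show "P \<subseteq> {g. \<forall>i. g i \<le> f i} \<times> {g. \<forall>i. g i \<le> f i}"
      unfolding P_def vstrip_def hstrip_def by (auto intro: le_trans)
  qed (use finite_below[OF assms(1)] in auto)
  have "(\<Sum>j\<le>k. (- 1) ^ j * (\<Sum>h\<in>vstrips f (k - j). \<Sum>t\<in>hstrips h j. G t))
    = (\<Sum>j\<le>k. \<Sum>p\<in>(SIGMA h:vstrips f (k-j). hstrips h j). w p)"
  proof (intro sum.cong refl)
    fix j assume "j \<in> {..k}"
    have "(- 1) ^ j * (\<Sum>h\<in>vstrips f (k - j). \<Sum>t\<in>hstrips h j. G t) = (\<Sum>h\<in>vstrips f (k - j). \<Sum>t\<in>hstrips h j. w (h,t))"
      unfolding sum_distrib_left by (intro sum.cong refl) (auto simp: w_def hstrips_def)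
    then show "(- 1) ^ j * (\<Sum>h\<in>vstrips f (k - j). \<Sum>t\<in>hstrips h j. G t) = (\<Sum>p\<in>(SIGMA h:vstrips f (k-j). hstrips h j). w p)"
      using assms by (simp add: sum.Sigma finite_vstrips finite_hstrips vstrips_ptn)
  qed
  also have "\<dots> = sum w (\<Union>j\<in>{..k}. SIGMA h:vstrips f (k-j). hstrips h j)"
    using assms by (intro sum.UNION_disjoint[symmetric])
      (auto intro!: finite_SigmaI finite_vstrips finite_hstrips vstrips_ptn, auto simp: hstrips_def)
  also have "(\<Union>j\<in>{..k}. SIGMA h:vstrips f (k-j). hstrips h j) = P"
  proof
    show "P \<subseteq> (\<Union>j\<in>{..k}. SIGMA h:vstrips f (k-j). hstrips h j)"
    proof
      fix p assume "p \<in> P"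
      then obtain h t where p: "p = (h,t)" "vstrip f h" "hstrip h t" "psize f = psize t + k" unfolding P_def by auto
      have "psize t \<le> psize h" using psize_le(1)[of h t] p unfolding vstrip_def hstrip_def by blast
      moreover have "psize h \<le> psize f" using psize_le(1)[of f h] assms p unfolding vstrip_def hstrip_def by blast
      ultimately show "p \<in> (\<Union>j\<in>{..k}. SIGMA h:vstrips f (k-j). hstrips h j)"
        using p by (intro UN_I[of "psize h - psize t"]) (auto simp: vstrips_def hstrips_def)
    qed
  qed (auto simp: P_def vstrips_def hstrips_def)
  also have "sum w P = 0"
  proof -
    let ?s = "\<lambda>(h,t). (toggle f t h, t)"
    have "sum w P = sum (\<lambda>p. - w p) P"
    proof (rule sum.reindex_bij_witness[where i="?s" and j="?s"])
      fix p assume "p \<in> P"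
      then obtain h t where p: "p = (h,t)" "vstrip f h" "hstrip h t" "psize f = psize t + k" unfolding P_def by auto
      \<comment> \<open>This is where k > 0 enters: a row in which f and t differ is needed for the
        toggle.\<close>
      then have "f \<noteq> t" using assms(2) by auto
      note tog = toggle[OF assms(1) p(2,3) this]
      show "?s (?s p) = p" "?s (?s p) = p" using p tog by auto
      show "?s p \<in> P" "?s p \<in> P" using p tog unfolding P_def by auto
      have "psize t \<le> psize h" using psize_le(1)[of h t] p unfolding vstrip_def hstrip_def by blast
      moreover have "psize t \<le> psize (toggle f t h)"
        using psize_le(1)[of "toggle f t h" t] tog(1,2) unfolding vstrip_def hstrip_def by blast
      ultimately have "psize (toggle f t h) - psize t = Suc (psize h - psize t)
        \<or> Suc (psize (toggle f t h) - psize t) = psize h - psize t"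
        using tog(4) by linarith
      then have "w (toggle f t h, t) = - w (h, t)"
        unfolding w_def by (metis (no_types, lifting) case_prod_conv mult_minus1 mult_minus_left power_Suc minus_minus)
      then show "- w (?s p) = w p" using p by simp
    qed
    then show ?thesis by (simp add: sum_negf)
  qed
  finally show ?thesis .
qed

text \<open>In the vanishing alternating sum of \<open>sum_vstrip_hstrip\<close> the term j = 0 is
  the right-hand side. The other terms are, by induction, those of the recursion for
  \<open>eop\<close> with opposite sign.\<close>

lemma eop_kostka: "ptn f \<Longrightarrow> eop k (kostka f g) as = (\<Sum>h\<in>vstrips f k. kostka h g as)"
proof (induction k arbitrary: as rule: less_induct)
  case (less k)
  show ?case
  proof (cases k)
    case 0
    then show ?thesis using less by (simp add: vstrips_0)
  next
    case (Suc l)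
    let ?s = "\<lambda>j. (- 1) ^ j * (\<Sum>h\<in>vstrips f (k - j). \<Sum>t\<in>hstrips h j. kostka t g as)"
    have "eop k (kostka f g) as = (\<Sum>j\<le>l. (- 1) ^ j * eop (l - j) (kostka f g) (Suc j # as))"
      using Suc by simp
    also have "\<dots> = (\<Sum>j\<le>l. - ?s (Suc j))"
    proof (intro sum.cong refl)
      fix j assume "j \<in> {..l}"
      have "eop (l - j) (kostka f g) (Suc j # as) = (\<Sum>h\<in>vstrips f (l - j). kostka h g (Suc j # as))"
        using less Suc by simp
      then show "(- 1) ^ j * eop (l - j) (kostka f g) (Suc j # as) = - ?s (Suc j)"
        using Suc by simp
    qed
    also have "\<dots> = ?s 0 - (\<Sum>j\<le>k. ?s j)"
      unfolding Suc sum.atMost_Suc_shift by (simp add: sum_negf)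
    also have "(\<Sum>j\<le>k. ?s j) = 0" using sum_vstrip_hstrip[OF less.prems, of k] Suc by simp
    finally show ?thesis using vstrips_ptn by (simp add: hstrips_0)
  qed
qed

section \<open>Littlewood-Richardson coefficients\<close>

abbreviation emp :: "nat \<Rightarrow> nat" where "emp \<equiv> (\<lambda>_. 0)"

definition shift :: "shape \<Rightarrow> nat \<Rightarrow> nat" where
  "shift f = (\<lambda>i. f (Suc i))"

abbreviation cons :: "nat \<Rightarrow> shape \<Rightarrow> nat \<Rightarrow> nat" where
  "cons a f \<equiv> case_nat a f"

lemma shift_cons [simp]: "shift (cons a f) = f"
  by (simp add: shift_def)

lemma cons_shift: "f 0 = a \<Longrightarrow> cons a (shift f) = f"
  by (auto simp: shift_def split: nat.split)

lemma ptn_emp: "ptn emp"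
  by (rule ptnI) auto

lemma ptn_map: assumes "ptn f" "\<And>x y. x \<le> y \<Longrightarrow> h x \<le> h y" "h 0 = 0" shows "ptn (\<lambda>i. h (f i))"
proof -
  obtain b where "f b = 0" using assms(1) unfolding ptn_def by blast
  then show ?thesis using assms(2) ptnD[OF assms(1)] assms(3) by (intro ptnI[of _ b]) auto
qed

lemma ptn_shift: "ptn f \<Longrightarrow> ptn (shift f)"
  by (rule hstrip_ptn[of f]) (auto simp: hstrip_def shift_def ptnD)

lemma ptn_cons: "ptn (cons a f) \<longleftrightarrow> ptn f \<and> f 0 \<le> a"
proof
  assume p: "ptn (cons a f)"
  show "ptn f \<and> f 0 \<le> a"
    using ptn_shift[OF p] ptnD[OF p, of 0 1] by simp
next
  assume "ptn f \<and> f 0 \<le> a"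
  then obtain b where b: "f b = 0" "ptn f" "f 0 \<le> a" unfolding ptn_def by blast
  show "ptn (cons a f)"
    by (rule ptnI[of _ "Suc b"]) (use b ptnD[of f] in \<open>auto split: nat.split\<close>)
qed

lemma psize_shift: assumes "ptn f" shows "psize f = f 0 + psize (shift f)"
proof -
  obtain b where b: "\<And>i. i \<ge> b \<Longrightarrow> f i = 0" using ptn_bound[OF assms] by blast
  have "psize f = sum f {..<Suc b}" "psize (shift f) = sum (shift f) {..<b}"
    using b by (auto intro!: psize_eq simp: shift_def)
  then show ?thesis by (simp add: sum.lessThan_Suc_shift shift_def del: sum.lessThan_Suc)
qed

lemma hstrips_le: assumes "ptn f" "h \<in> hstrips f a" shows "a \<le> f 0"
proof -
  have "psize (shift f) \<le> psize h"
    using psize_le(1)[OF hstrips_ptn[OF assms], of "shift f"] assms by (auto simp: hstrips_def hstrip_def shift_def)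
  then show ?thesis using assms psize_shift[OF assms(1)] by (auto simp: hstrips_def)
qed

text \<open>Interlacing puts \<open>shift f\<close> inside whatever a strip leaves, and equal size
  forces equality. Taking the coefficient of the highest power of one variable thus means removing
  the first row.\<close>

lemma hstrips_head: assumes "ptn f" shows "hstrips f (f 0) = {shift f}"
proof -
  have "h = shift f" if "h \<in> hstrips f (f 0)" for h
    using psize_le(2)[OF hstrips_ptn[OF assms that], of "shift f"] that psize_shift[OF assms]
    by (auto simp: hstrips_def hstrip_def shift_def)
  then show ?thesis using psize_shift[OF assms] ptnD[OF assms]
    by (auto simp: hstrips_def hstrip_def shift_def)
qed

lemma kostka_big: "ptn f \<Longrightarrow> a > f 0 \<Longrightarrow> kostka f g (a # as) = 0"
  using hstrips_le[of f _ a] by (auto intro!: sum.neutral)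

lemma kostka_head: "ptn f \<Longrightarrow> kostka f g (f 0 # as) = kostka (shift f) g as"
  by (simp add: hstrips_head)

lemma ptn_le_psize: assumes "ptn f" shows "f i \<le> psize f" "f i > 0 \<Longrightarrow> i < psize f"
proof -
  obtain b where b: "\<And>i. i \<ge> b \<Longrightarrow> f i = 0" using ptn_bound[OF assms] by blast
  have e: "psize f = sum f {..<b}" using b by (rule psize_eq)
  show "f i \<le> psize f"
    unfolding e by (cases "i < b") (use b in \<open>auto intro: member_le_sum\<close>)
  assume i: "f i > 0"
  then have "i < b" using b[of i] by (cases "i < b") auto
  have "Suc i = (\<Sum>j\<le>i. 1)" by simp
  also have "\<dots> \<le> (\<Sum>j\<le>i. f j)"
    using i ptnD[OF assms] by (intro sum_mono) (metis One_nat_def Suc_leI atMost_iff less_le_trans)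
  also have "\<dots> \<le> sum f {..<b}" using \<open>i < b\<close> by (intro sum_mono2) auto
  finally show "i < psize f" using e by simp
qed

definition lst :: "nat \<Rightarrow> shape \<Rightarrow> nat list" where
  "lst n f = map f [0..<n]"

lemma lst_simps [simp]: "lst 0 f = []" "lst (Suc n) f = f 0 # lst n (shift f)"
  unfolding lst_def shift_def by (simp_all add: upt_conv_Cons map_Suc_upt[symmetric] del: upt_Suc)

section \<open>Unitriangularity and linear independence of Kostka numbers\<close>

definition lexgt :: "shape \<Rightarrow> shape \<Rightarrow> bool" where
  "lexgt f g \<longleftrightarrow> (\<exists>i. (\<forall>j<i. f j = g j) \<and> g i < f i)"

lemma lexgt_asymp: "asymp_on A lexgt"
  unfolding asymp_on_def lexgt_def by (metis less_asym nat_neq_iff)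

lemma lexgt_transp: "transp_on A lexgt"
proof (rule transp_onI)
  fix f g h assume "lexgt f g" "lexgt g h"
  then obtain i j where "\<forall>k<i. f k = g k" "g i < f i" "\<forall>k<j. g k = h k" "h j < g j"
    unfolding lexgt_def by blast
  then have "(\<forall>k<min i j. f k = h k) \<and> h (min i j) < f (min i j)"
    by (cases i j rule: linorder_cases) (auto simp: min_def)
  then show "lexgt f h" unfolding lexgt_def by blast
qed

text \<open>The first strip has \<open>f 0\<close> boxes. It does not fit if \<open>f 0\<close>
  exceeds \<open>k 0\<close>; if the two are equal, it leaves \<open>shift k\<close> and the
  comparison moves to the next row; otherwise k already wins in row 0.\<close>

lemma kostka_lst: "ptn k \<Longrightarrow> ptn f \<Longrightarrow> f n = 0 \<Longrightarrow> kostka k emp (lst n f) \<noteq> 0 \<Longrightarrow> k = f \<or> lexgt k f"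
proof (induction n arbitrary: k f)
  case 0
  then have "k = emp" by (auto split: if_splits)
  moreover have "f = emp" using ptnD[OF 0(2), of 0] 0(3) by auto
  ultimately show ?case by simp
next
  case (Suc n)
  have nz: "kostka k emp (f 0 # lst n (shift f)) \<noteq> 0" using Suc.prems by (simp del: kostka.simps)
  then have le: "f 0 \<le> k 0" using kostka_big[OF Suc.prems(1)] by (meson not_le)
  show ?case
  proof (cases "f 0 = k 0")
    case True
    then have "kostka (shift k) emp (lst n (shift f)) \<noteq> 0"
      using nz kostka_head[OF Suc.prems(1)] by simp
    moreover have "shift f n = 0" using Suc.prems by (simp add: shift_def)
    ultimately have "shift k = shift f \<or> lexgt (shift k) (shift f)"
      using Suc.IH ptn_shift Suc.prems by blast
    then show ?thesis
    proof
      assume "shift k = shift f"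
      then show ?thesis using True cons_shift by metis
    next
      assume "lexgt (shift k) (shift f)"
      then obtain i where "\<forall>j<i. k (Suc j) = f (Suc j)" "f (Suc i) < k (Suc i)"
        unfolding lexgt_def shift_def by blast
      then have "\<forall>j<Suc i. k j = f j" using True by (metis less_Suc_eq_0_disj)
      then show ?thesis using \<open>f (Suc i) < k (Suc i)\<close> unfolding lexgt_def by blast
    qed
  next
    case False
    then have "lexgt k f" unfolding lexgt_def using le by (intro exI[of _ 0]) auto
    then show ?thesis by blast
  qed
qed

lemma kostka_lst_self: "ptn f \<Longrightarrow> f n = 0 \<Longrightarrow> kostka f emp (lst n f) = 1"
proof (induction n arbitrary: f)
  case 0
  then have "f = emp" using ptnD[of f 0] by fastforce
  then show ?case by simp
next
  case (Suc n)
  have "kostka f emp (lst (Suc n) f) = kostka (shift f) emp (lst n (shift f))"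
    using kostka_head[OF Suc.prems(1)] by (simp del: kostka.simps)
  also have "\<dots> = 1" using Suc by (intro Suc.IH ptn_shift) (auto simp: shift_def)
  finally show ?case .
qed

text \<open>Evaluation at the content given by the lexicographically largest m with
  \<open>c m\<close> nonzero leaves only \<open>c m\<close>. Contents of length n are enough, so
  this is the independence of Schur polynomials in n variables.\<close>

lemma kostka_indep:
  assumes "finite A" "\<And>v. v \<in> A \<Longrightarrow> ptn v \<and> v n = 0"
    and z: "\<And>as. length as = n \<Longrightarrow> (\<Sum>v\<in>A. c v * kostka v emp as) = 0" and "v \<in> A"
  shows "c v = 0"
proof (rule ccontr)
  assume "c v \<noteq> 0"
  define B where "B = {v\<in>A. c v \<noteq> 0}"
  have "finite B" "B \<noteq> {}" using assms \<open>c v \<noteq> 0\<close> unfolding B_def by auto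
  \<comment> \<open>A minimal element for \<open>lexgt\<close> is a lexicographically largest
    shape.\<close>
  then obtain m where m: "m \<in> B" "\<And>x. x \<in> B \<Longrightarrow> x \<noteq> m \<Longrightarrow> \<not> lexgt x m"
    using Finite_Set.bex_min_element[OF _ lexgt_asymp lexgt_transp, of B] by blast
  have mA: "m \<in> A" "c m \<noteq> 0" using m unfolding B_def by auto
  have "(\<Sum>v\<in>A. c v * kostka v emp (lst n m)) = (\<Sum>v\<in>{m}. c v * kostka v emp (lst n m))"
    using assms mA m(2) by (intro sum.mono_neutral_right)
      (auto simp: B_def dest!: kostka_lst[rotated 3])
  also have "\<dots> = c m" using kostka_lst_self assms mA by simp
  finally show False using z[of "lst n m"] mA by (simp add: lst_def)
qed

text \<open>For a maximal m the entries \<open>M m b\<close> with b other than m vanish, so the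
  equations for the other b do not involve the unknown at m. They are solved first, and the equation
  at m then fixes its coefficient.\<close>

lemma unitriangular_solve:
  assumes "finite A" "asymp_on A R" "transp_on A R"
    and "\<And>a. a \<in> A \<Longrightarrow> M a a = (1::int)"
    and "\<And>a b. a \<in> A \<Longrightarrow> b \<in> A \<Longrightarrow> M a b \<noteq> 0 \<Longrightarrow> a = b \<or> R a b"
  shows "\<exists>c. \<forall>b\<in>A. (\<Sum>a\<in>A. c a * M a b) = F b"
  using assms
proof (induction A rule: finite_psubset_induct)
  case (psubset A)
  show ?case
  proof (cases "A = {}")
    case False
    then obtain m where m: "m \<in> A" "\<And>x. x \<in> A \<Longrightarrow> x \<noteq> m \<Longrightarrow> \<not> R m x"
      using Finite_Set.bex_max_element[OF psubset(1) psubset(3,4)] by blast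
    have "\<exists>c. \<forall>b\<in>A - {m}. (\<Sum>a\<in>A - {m}. c a * M a b) = F b"
    proof (rule psubset.IH)
      show "A - {m} \<subset> A" using m by blast
      show "asymp_on (A - {m}) R" by (rule asymp_on_subset[OF psubset(3)]) blast
      show "transp_on (A - {m}) R" by (rule transp_on_subset[OF psubset(4)]) blast
    qed (use psubset(5,6) in auto)
    then obtain c where c: "\<forall>b\<in>A - {m}. (\<Sum>a\<in>A - {m}. c a * M a b) = F b" by blast
    define d where "d = c(m := F m - (\<Sum>a\<in>A - {m}. c a * M a m))"
    have "(\<Sum>a\<in>A. d a * M a b) = d m * M m b + (\<Sum>a\<in>A - {m}. c a * M a b)" for b
      using m psubset(1) by (simp add: sum.remove[of A m] d_def)
    moreover have "M m b = 0" if "b \<in> A - {m}" for b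
      using psubset(6)[of m b] m that by blast
    ultimately have "(\<Sum>a\<in>A. d a * M a b) = F b" if "b \<in> A" for b
      using c psubset(5) m that by (cases "b = m") (auto simp: d_def)
    then show ?thesis by blast
  qed simp
qed

lemma finite_ptn_psize: "finite {v. ptn v \<and> psize v = N}"
proof (rule finite_subset)
  show "{v. ptn v \<and> psize v = N} \<subseteq> {v. \<forall>x. (x \<in> {..<N} \<longrightarrow> v x \<in> {..N}) \<and> (x \<notin> {..<N} \<longrightarrow> v x = 0)}"
    using ptn_le_psize by force
qed (rule finite_set_of_finite_funs, auto)

text \<open>With \<open>kostka_cong\<close> this reduces every content to a partition. Its nonzero
  entries add up to N, so there are at most N of them and N places suffice.\<close>

lemma sort_ptn:
  assumes "sum_list as = N"
  shows "\<exists>v. ptn v \<and> psize v = N \<and> mset (filter (\<lambda>x. x \<noteq> 0) (lst N v)) = mset (filter (\<lambda>x. x \<noteq> 0) as)"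
proof -
  define xs where "xs = rev (sort (filter (\<lambda>x. x \<noteq> 0) as))"
  define v where "v = (\<lambda>i. if i < length xs then xs ! i else 0)"
  have ms: "mset xs = mset (filter (\<lambda>x. x \<noteq> 0) as)" unfolding xs_def by simp
  have pos: "\<forall>x\<in>set xs. x \<noteq> 0" using mset_eq_setD[OF ms] by auto
  have sl: "sum_list xs = N"
  proof -
    have "sum_list (filter (\<lambda>x. x \<noteq> 0) as) = sum_list as" by (induction as) auto
    then show ?thesis using assms ms by (metis sum_mset_sum_list)
  qed
  have sorted: "sorted_wrt (\<ge>) xs" unfolding xs_def by (simp add: sorted_wrt_rev)
  have len: "length xs \<le> N"
  proof -
    have "(\<Sum>x\<leftarrow>xs. 1) \<le> sum_list (map id xs)" using pos by (intro sum_list_mono) (simp add: Suc_leI)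
    then show ?thesis using sl by (simp add: sum_list_triv)
  qed
  have p: "ptn v"
  proof (rule ptnI[of _ "length xs"])
    show "v (Suc i) \<le> v i" for i
      using sorted unfolding v_def by (auto simp: sorted_wrt_iff_nth_less)
  qed (simp add: v_def)
  moreover have "psize v = N"
  proof -
    have "psize v = sum v {..<length xs}" by (rule psize_eq) (simp add: v_def)
    also have "\<dots> = sum_list xs" unfolding v_def sum_list_sum_nth by (simp add: lessThan_atLeast0)
    finally show ?thesis using sl by simp
  qed
  moreover have "lst N v = xs @ replicate (N - length xs) 0"
    using len by (intro nth_equalityI) (auto simp: lst_def v_def nth_append)
  then have "filter (\<lambda>x. x \<noteq> 0) (lst N v) = xs" using pos by simp
  ultimately show ?thesis using ms by auto
qed

section \<open>Existence and uniqueness of the expansion\<close>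

text \<open>A content of length n is a monomial in n variables, so contents of all lengths express
  the expansions for all n at once.\<close>

definition is_lr :: "shape \<Rightarrow> shape \<Rightarrow> (shape \<Rightarrow> int) \<Rightarrow> bool" where
  "is_lr f g c \<longleftrightarrow> finite {v. c v \<noteq> 0} \<and> (\<forall>v. c v \<noteq> 0 \<longrightarrow> ptn v) \<and>
    (\<forall>as. kostka f g as = (\<Sum>v | c v \<noteq> 0. c v * kostka v emp as))"

text \<open>The unitriangular system over the partitions of N settles the sorted contents of sum N.
  Symmetry in the entries extends this to every content of sum N, and for other sums both sides
  vanish.\<close>

lemma is_lr_exists: assumes "ptn f" shows "\<exists>c. is_lr f g c"
proof (cases "psize g \<le> psize f")
  case False
  then have "kostka f g as = 0" for as using kostka_nonzero[OF assms, of g as] by linarith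
  then show ?thesis unfolding is_lr_def by (intro exI[of _ "\<lambda>_. 0"]) simp
next
  case True
  define N where "N = psize f - psize g"
  define A where "A = {v. ptn v \<and> psize v = N}"
  have fin: "finite A" unfolding A_def by (rule finite_ptn_psize)
  have vN: "ptn v" "v N = 0" if "v \<in> A" for v
    using that ptn_le_psize(2)[of v N] unfolding A_def by auto
  obtain c where c: "\<forall>b\<in>A. (\<Sum>a\<in>A. c a * kostka a emp (lst N b)) = kostka f g (lst N b)"
    using unitriangular_solve[OF fin lexgt_asymp lexgt_transp, of "\<lambda>a b. kostka a emp (lst N b)" "\<lambda>b. kostka f g (lst N b)",
        OF kostka_lst_self[of _ N] kostka_lst[of _ _ N]] vN by presburger
  define d where "d = (\<lambda>v. if v \<in> A then c v else 0)"
  have eq: "kostka f g as = (\<Sum>v\<in>A. d v * kostka v emp as)" for as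
  proof (cases "sum_list as = N")
    case True
    then obtain b where b: "ptn b" "psize b = N"
        "mset (filter (\<lambda>x. x \<noteq> 0) (lst N b)) = mset (filter (\<lambda>x. x \<noteq> 0) as)"
      using sort_ptn by blast
    have "kostka f g as = kostka f g (lst N b)" using kostka_cong[OF assms b(3)] by simp
    also have "\<dots> = (\<Sum>a\<in>A. c a * kostka a emp (lst N b))" using c b unfolding A_def by simp
    also have "\<dots> = (\<Sum>a\<in>A. d a * kostka a emp as)"
      using kostka_cong[OF _ b(3)] vN by (intro sum.cong) (auto simp: d_def)
    finally show ?thesis .
  next
    case False
    have "psize emp = 0" unfolding psize_def by simp
    then have "kostka v emp as = 0" if "v \<in> A" for v
      using kostka_nonzero[of v emp as] that False unfolding A_def by auto
    moreover have "kostka f g as = 0"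
      using kostka_nonzero[OF assms, of g as] True False unfolding N_def by linarith
    ultimately show ?thesis by simp
  qed
  have "finite {v. d v \<noteq> 0}" by (rule finite_subset[OF _ fin]) (auto simp: d_def)
  moreover have "kostka f g as = (\<Sum>v | d v \<noteq> 0. d v * kostka v emp as)" for as
    unfolding eq using fin by (intro sum.mono_neutral_right) (auto simp: d_def)
  ultimately have "is_lr f g d"
    unfolding is_lr_def using vN by (auto simp: d_def split: if_splits)
  then show ?thesis by blast
qed

lemma ptn_common_bound: assumes "finite A" "\<And>v. v \<in> A \<Longrightarrow> ptn v"
  shows "\<exists>n. \<forall>v\<in>A. v n = 0"
proof (intro exI ballI)
  fix v assume "v \<in> A"
  then have "psize v \<le> Max (psize ` A)" using assms by simp
  then show "v (Max (psize ` A)) = 0" using ptn_le_psize(2)[OF assms(2)[OF \<open>v \<in> A\<close>]]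
    by (metis gr0I leD)
qed

text \<open>The number k is the largest number of rows in A. The member u of full length survives
  the removal of a first column with k boxes, which makes it the witness in the extremal
  arguments.\<close>

lemma ptn_longest:
  assumes "finite A" "\<And>v. v \<in> A \<Longrightarrow> ptn v" "A \<noteq> {}"
  shows "\<exists>k. (\<forall>v\<in>A. v k = 0) \<and> (\<exists>u\<in>A. \<forall>i<k. u i > 0)"
proof -
  define k where "k = (LEAST n. \<forall>v\<in>A. v n = 0)"
  have k: "\<forall>v\<in>A. v k = 0" unfolding k_def by (rule LeastI_ex[OF ptn_common_bound[OF assms(1,2)]])
  have "\<exists>u\<in>A. \<forall>i<k. u i > 0"
  proof (cases k)
    case (Suc m)
    then have "\<not> (\<forall>v\<in>A. v m = 0)" using not_less_Least[of m "\<lambda>n. \<forall>v\<in>A. v n = 0"] unfolding k_def by auto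
    then obtain u where u: "u \<in> A" "u m > 0" by auto
    have "u i > 0" if "i < k" for i using ptnD[OF assms(2)[OF u(1)], of i m] u(2) Suc that by simp
    then show ?thesis using u(1) by blast
  qed (use assms(3) in auto)
  then show ?thesis using k by blast
qed

lemma kostka_indep_all:
  assumes "finite A" "\<And>v. v \<in> A \<Longrightarrow> ptn v"
    and "\<And>as. (\<Sum>v\<in>A. c v * kostka v emp as) = 0" and "v \<in> A"
  shows "c v = 0"
proof -
  obtain n where "\<forall>v\<in>A. v n = 0" using ptn_common_bound[OF assms(1,2)] by blast
  then show ?thesis using kostka_indep[OF assms(1), of n c v] assms by blast
qed

text \<open>Shapes with more than n rows vanish at contents of length n, so n variables determine
  exactly the coefficients of shapes with at most n rows. This form serves identities that hold only
  in n variables.\<close>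

lemma kostka_indep_diff:
  assumes "finite {v. c v \<noteq> 0}" "finite {v. d v \<noteq> 0}"
    and p: "\<And>v. c v \<noteq> 0 \<Longrightarrow> ptn v" "\<And>v. d v \<noteq> 0 \<Longrightarrow> ptn v"
    and n: "\<And>as. length as = n \<Longrightarrow> (\<Sum>v | c v \<noteq> 0. c v * kostka v emp as) = (\<Sum>v | d v \<noteq> 0. d v * kostka v emp as)"
    and v: "v n = 0"
  shows "c v = d v"
proof -
  define A where "A = {v. c v \<noteq> 0} \<union> {v. d v \<noteq> 0}"
  define B where "B = {v\<in>A. v n = 0}"
  have A: "finite A" "\<And>v. v \<in> A \<Longrightarrow> ptn v" using assms unfolding A_def by auto
  have "(\<Sum>v\<in>B. (c v - d v) * kostka v emp as) = 0" if as: "length as = n" for as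
  proof -
    have "(\<Sum>v\<in>B. (c v - d v) * kostka v emp as) = (\<Sum>v\<in>A. (c v - d v) * kostka v emp as)"
    proof (intro sum.mono_neutral_left ballI)
      fix v assume v: "v \<in> A - B"
      then have "kostka v emp as = 0"
        using kostka_nonzero[of v emp as] A(2)[of v] as unfolding B_def by (metis (mono_tags, lifting) DiffD1 DiffD2 add_0 le_zero_eq mem_Collect_eq)
      then show "(c v - d v) * kostka v emp as = 0" by simp
    qed (use A in \<open>auto simp: B_def\<close>)
    also have "\<dots> = (\<Sum>v\<in>A. c v * kostka v emp as) - (\<Sum>v\<in>A. d v * kostka v emp as)"
      by (simp add: left_diff_distrib sum_subtractf)
    also have "(\<Sum>v\<in>A. c v * kostka v emp as) = (\<Sum>v | c v \<noteq> 0. c v * kostka v emp as)"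
      using A by (intro sum.mono_neutral_right) (auto simp: A_def)
    also have "(\<Sum>v\<in>A. d v * kostka v emp as) = (\<Sum>v | d v \<noteq> 0. d v * kostka v emp as)"
      using A by (intro sum.mono_neutral_right) (auto simp: A_def)
    finally show ?thesis using n[OF as] by simp
  qed
  moreover have "finite B" "\<And>v. v \<in> B \<Longrightarrow> ptn v \<and> v n = 0" using A unfolding B_def by auto
  ultimately have "c v - d v = 0" if "v \<in> B"
    using kostka_indep[of B n "\<lambda>v. c v - d v" v] that by blast
  then show ?thesis using v unfolding B_def A_def by (cases "v \<in> B") (auto simp: B_def A_def)
qed

lemma is_lr_unique: assumes "is_lr f g c" "is_lr f g d" shows "c = d"
proof
  fix v
  consider "c v = 0" "d v = 0" | "ptn v" using assms unfolding is_lr_def by blast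
  then show "c v = d v"
  proof cases
    case 2
    then obtain n where "v n = 0" unfolding ptn_def by blast
    then show ?thesis using assms unfolding is_lr_def by (intro kostka_indep_diff[of c d n]) auto
  qed simp
qed

definition lr_num :: "shape \<Rightarrow> shape \<Rightarrow> shape \<Rightarrow> int" where
  "lr_num f g = (THE c. is_lr f g c)"

lemma lr_num_eqI: "is_lr f g c \<Longrightarrow> lr_num f g = c"
  unfolding lr_num_def by (rule the_equality) (auto dest: is_lr_unique)

lemma is_lr_lr_num: "ptn f \<Longrightarrow> is_lr f g (lr_num f g)"
  using is_lr_exists lr_num_eqI by metis

lemma lr_num_cong: assumes "\<And>as. kostka f g as = kostka f' g' as" shows "lr_num f g = lr_num f' g'"
  unfolding lr_num_def is_lr_def using assms by simp

lemma lr_numD: assumes "ptn f"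
  shows "finite {v. lr_num f g v \<noteq> 0}" "lr_num f g v \<noteq> 0 \<Longrightarrow> ptn v"
    "kostka f g as = (\<Sum>v | lr_num f g v \<noteq> 0. lr_num f g v * kostka v emp as)"
  using is_lr_lr_num[OF assms, of g] unfolding is_lr_def by blast+

section \<open>Full rows and full columns\<close>

lemma ptn_pos: "ptn f \<Longrightarrow> f (k - 1) > 0 \<Longrightarrow> i < k \<Longrightarrow> f i > 0"
  using ptnD[of f i "k - 1"] by (cases k) auto

definition dec :: "shape \<Rightarrow> nat \<Rightarrow> nat" where
  "dec f = (\<lambda>i. f i - 1)"

definition inc :: "nat \<Rightarrow> shape \<Rightarrow> nat \<Rightarrow> nat" where
  "inc k f = (\<lambda>i. if i < k then Suc (f i) else f i)"

text \<open>A strip of k boxes does not fit into a shape with first row below k, and from a shape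
  with first row k it leaves the remaining rows.\<close>

lemma sum_head:
  assumes "finite A" "\<And>v. v \<in> A \<Longrightarrow> ptn v \<and> v 0 \<le> k"
  shows "(\<Sum>v\<in>A. c v * kostka v emp (k # as)) = (\<Sum>w\<in>shift ` {v\<in>A. v 0 = k}. c (cons k w) * kostka w emp as)"
proof -
  have "(\<Sum>v\<in>A. c v * kostka v emp (k # as)) = (\<Sum>v\<in>{v\<in>A. v 0 = k}. c v * kostka v emp (k # as))"
    using assms kostka_big by (intro sum.mono_neutral_right) (auto simp del: kostka.simps simp: order.strict_iff_order)
  also have "\<dots> = (\<Sum>v\<in>{v\<in>A. v 0 = k}. c (cons k (shift v)) * kostka (shift v) emp as)"
    using assms kostka_head by (intro sum.cong) (auto simp del: kostka.simps simp: cons_shift)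
  also have "\<dots> = (\<Sum>w\<in>shift ` {v\<in>A. v 0 = k}. c (cons k w) * kostka w emp as)"
    by (subst sum.reindex) (auto intro!: inj_on_inverseI[of _ "cons k"] simp: cons_shift)
  finally show ?thesis .
qed

text \<open>Cancellation has to be excluded. Let k be the largest first part that occurs, and
  suppose that it exceeds \<open>f 0\<close>. At contents starting with k the skew side is 0, while
  the other side is a combination of the independent families of the shapes \<open>shift v\<close>
  with \<open>v 0 = k\<close>.\<close>

lemma lr_num_head_le: assumes f: "ptn f" and "lr_num f g v \<noteq> 0" shows "v 0 \<le> f 0"
proof (rule ccontr)
  assume "\<not> v 0 \<le> f 0"
  define A where "A = {v. lr_num f g v \<noteq> 0}"
  define k where "k = Max ((\<lambda>v. v 0) ` A)"
  have A: "finite A" "\<And>v. v \<in> A \<Longrightarrow> ptn v" "v \<in> A" using lr_numD[OF f] assms(2) unfolding A_def by blast+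
  have le: "u 0 \<le> k" if "u \<in> A" for u using A(1) that unfolding k_def by simp
  have "k \<in> (\<lambda>v. v 0) ` A" using A unfolding k_def by (intro Max_in) auto
  then obtain u where u: "u \<in> A" "u 0 = k" by blast
  have "f 0 < k" using le[OF A(3)] \<open>\<not> v 0 \<le> f 0\<close> by linarith
  have "(\<lambda>w. lr_num f g (cons k w)) (shift u) = 0"
  proof (rule kostka_indep_all[where c="\<lambda>w. lr_num f g (cons k w)"])
    show "finite (shift ` {v\<in>A. v 0 = k})" using A by simp
    show "ptn w" if "w \<in> shift ` {v\<in>A. v 0 = k}" for w using that A ptn_shift by blast
    show "shift u \<in> shift ` {v\<in>A. v 0 = k}" using u by blast
    show "(\<Sum>w\<in>shift ` {v\<in>A. v 0 = k}. lr_num f g (cons k w) * kostka w emp as) = 0" for as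
      using sum_head[of A k "lr_num f g" as] lr_numD(3)[OF f, of g "k # as"] kostka_big[OF f \<open>f 0 < k\<close>] A le
      unfolding A_def by (simp del: kostka.simps)
  qed
  then show False using u unfolding A_def by (simp add: cons_shift)
qed

text \<open>Both sides of the expansion of f/g are evaluated at contents that start with
  \<open>f 0\<close>. Only v with first part \<open>f 0\<close> are seen there, as larger ones do
  not occur by \<open>lr_num_head_le\<close>.\<close>

lemma lr_num_shift: assumes f: "ptn f" shows "lr_num (shift f) g = (\<lambda>w. lr_num f g (cons (f 0) w))"
proof (rule lr_num_eqI)
  define A where "A = {v. lr_num f g v \<noteq> 0}"
  have A: "finite A" "\<And>v. v \<in> A \<Longrightarrow> ptn v \<and> v 0 \<le> f 0"
    using lr_numD[OF f] lr_num_head_le[OF f] unfolding A_def by blast+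
  have s: "{w. lr_num f g (cons (f 0) w) \<noteq> 0} = shift ` {v\<in>A. v 0 = f 0}"
  proof safe
    fix w assume "lr_num f g (cons (f 0) w) \<noteq> 0"
    then show "w \<in> shift ` {v \<in> A. v 0 = f 0}"
      unfolding A_def by (intro image_eqI[of _ _ "cons (f 0) w"]) auto
  qed (auto simp: A_def cons_shift)
  have "kostka (shift f) g as = (\<Sum>w | lr_num f g (cons (f 0) w) \<noteq> 0. lr_num f g (cons (f 0) w) * kostka w emp as)" for as
    using sum_head[of A "f 0" "lr_num f g" as] A lr_numD(3)[OF f, of g "f 0 # as"] kostka_head[OF f, of g as]
    unfolding s by (simp add: A_def)
  moreover have "ptn w" if "lr_num f g (cons (f 0) w) \<noteq> 0" for w
    using lr_numD(2)[OF f that] ptn_cons by blast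
  ultimately show "is_lr (shift f) g (\<lambda>w. lr_num f g (cons (f 0) w))"
    unfolding is_lr_def using A s by simp
qed

lemma ptn_dec: "ptn f \<Longrightarrow> ptn (dec f)"
  unfolding dec_def by (rule ptn_map) auto

lemma dec_inc: "f k = 0 \<Longrightarrow> ptn f \<Longrightarrow> dec (inc k f) = f"
  using ptnD[of f k] by (auto simp: dec_def inc_def fun_eq_iff not_less)

lemma inc_dec: assumes "ptn f" "f k = 0" "\<And>i. i < k \<Longrightarrow> f i > 0" shows "inc k (dec f) = f"
proof
  fix i show "inc k (dec f) i = f i"
    using assms(3)[of i] ptnD[OF assms(1), of k i] assms(2) by (auto simp: dec_def inc_def)
qed

lemma psize_dec: assumes "ptn f" "f k = 0" shows "psize f = psize (dec f) + card {i. i < k \<and> f i > 0}"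
proof -
  have z: "f i = 0" if "i \<ge> k" for i using ptnD[OF assms(1) that] assms(2) by simp
  have "psize f = sum f {..<k}" using z by (rule psize_eq)
  also have "\<dots> = (\<Sum>i<k. dec f i + of_bool (f i > 0))" by (intro sum.cong) (auto simp: dec_def)
  also have "\<dots> = sum (dec f) {..<k} + (\<Sum>i<k. of_bool (f i > 0))" by (simp add: sum.distrib)
  also have "sum (dec f) {..<k} = psize (dec f)" using z by (intro psize_eq[symmetric]) (simp add: dec_def)
  also have "(\<Sum>i<k. of_bool (f i > 0)) = card ({..<k} \<inter> {i. f i > 0})" by simp
  also have "{..<k} \<inter> {i. f i > 0} = {i. i < k \<and> f i > 0}" by auto
  finally show ?thesis .
qed

text \<open>At most one box leaves each nonempty row, so \<open>dec f\<close> lies inside h, and it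
  equals h when every nonempty row loses a box.\<close>

lemma vstrips_card: assumes "ptn f" "f k = 0" "h \<in> vstrips f m"
  shows "m \<le> card {i. i < k \<and> f i > 0}" "m = card {i. i < k \<and> f i > 0} \<Longrightarrow> h = dec f"
proof -
  have h: "ptn h" "\<And>i. dec f i \<le> h i" "psize f = psize h + m"
    using assms(3) by (auto simp: vstrips_def vstrip_def dec_def diff_le_mono le_diff_conv)
  show "m \<le> card {i. i < k \<and> f i > 0}"
    using psize_le(1)[OF h(1,2)] psize_dec[OF assms(1,2)] h(3) by linarith
  show "h = dec f" if "m = card {i. i < k \<and> f i > 0}"
    using psize_le(2)[OF h(1,2)] psize_dec[OF assms(1,2)] h(3) that by auto
qed

lemma dec_in_vstrips: assumes "ptn f" "f k = 0" shows "dec f \<in> vstrips f (card {i. i < k \<and> f i > 0})"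
  using psize_dec[OF assms] ptn_dec[OF assms(1)] by (auto simp: vstrips_def vstrip_def dec_def)

lemma vstrips_empty: assumes "ptn f" "f k = 0" "m > k" shows "vstrips f m = {}"
proof -
  have "card {i. i < k \<and> f i > 0} \<le> card {..<k}" by (rule card_mono) auto
  then show ?thesis using vstrips_card(1)[OF assms(1,2), of _ m] assms(3) by (metis card_lessThan ex_in_conv not_le order_trans)
qed

lemma vstrips_rows: assumes "ptn f" "f k = 0" shows "vstrips f k = (if \<forall>i<k. f i > 0 then {dec f} else {})"
proof (cases "\<forall>i<k. f i > 0")
  case True
  then have "{i. i < k \<and> f i > 0} = {..<k}" by auto
  then have "card {i. i < k \<and> f i > 0} = k" by simp
  then have "dec f \<in> vstrips f k" "\<And>h. h \<in> vstrips f k \<Longrightarrow> h = dec f"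
    using vstrips_card(2)[OF assms, of _ k] dec_in_vstrips[OF assms] by metis+
  then have "vstrips f k = {dec f}" by blast
  then show ?thesis using True by simp
next
  case False
  then obtain j where "j < k" "f j = 0" by auto
  then have "{i. i < k \<and> f i > 0} \<subseteq> {..<k} - {j}" by auto
  then have "card {i. i < k \<and> f i > 0} \<le> card ({..<k} - {j})" by (intro card_mono) auto
  also have "\<dots> < k" using \<open>j < k\<close> by simp
  finally have "card {i. i < k \<and> f i > 0} < k" .
  then have "h \<notin> vstrips f k" for h using vstrips_card(1)[OF assms, of h k] by auto
  then have "vstrips f k = {}" by blast
  then show ?thesis using False by simp
qed

text \<open>Dual to \<open>sum_head\<close>: for shapes with at most k rows, a vertical strip of
  size k must take the whole first column, which then has height k.\<close>

lemma sum_rows: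
  assumes "finite A" "\<And>v. v \<in> A \<Longrightarrow> ptn v \<and> v k = 0"
  shows "(\<Sum>v\<in>A. c v * eop k (kostka v emp) as) =
    (\<Sum>w\<in>dec ` {v\<in>A. \<forall>i<k. v i > 0}. c (inc k w) * kostka w emp as)"
proof -
  let ?B = "{v\<in>A. \<forall>i<k. v i > 0}"
  have "(\<Sum>v\<in>A. c v * eop k (kostka v emp) as) = (\<Sum>v\<in>?B. c v * eop k (kostka v emp) as)"
    using assms by (intro sum.mono_neutral_right) (auto simp: eop_kostka vstrips_rows)
  also have "\<dots> = (\<Sum>v\<in>?B. c (inc k (dec v)) * kostka (dec v) emp as)"
    using assms by (intro sum.cong) (auto simp: eop_kostka vstrips_rows inc_dec)
  also have "\<dots> = (\<Sum>w\<in>dec ` ?B. c (inc k w) * kostka w emp as)"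
    by (subst sum.reindex) (use assms in \<open>auto intro!: inj_on_inverseI[of _ "inc k"] simp: inc_dec\<close>)
  finally show ?thesis .
qed

lemma eop_lr_num: assumes "ptn f"
  shows "eop k (kostka f g) as = (\<Sum>v | lr_num f g v \<noteq> 0. lr_num f g v * eop k (kostka v emp) as)"
proof -
  have *: "kostka f g = (\<lambda>as. \<Sum>v | lr_num f g v \<noteq> 0. lr_num f g v * kostka v emp as)"
    using lr_numD(3)[OF assms] by blast
  show ?thesis by (subst *, subst eop_sum) simp
qed

text \<open>For the largest length \<open>k\<close> that occurs, the operator \<open>eop k\<close> removes the first column of the
  partitions of length \<open>k\<close> and kills the others, while it kills a skew shape with fewer rows.\<close>

lemma lr_num_rows: assumes f: "ptn f" and b: "f b = 0" and "lr_num f g v \<noteq> 0" shows "v b = 0"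
proof (rule ccontr)
  assume "v b \<noteq> 0"
  define A where "A = {v. lr_num f g v \<noteq> 0}"
  have A: "finite A" "\<And>v. v \<in> A \<Longrightarrow> ptn v" "v \<in> A" using lr_numD[OF f] assms(3) unfolding A_def by blast+
  obtain k u where k: "\<And>v. v \<in> A \<Longrightarrow> v k = 0" and u: "u \<in> A" and pos: "\<forall>i<k. u i > 0"
    using ptn_longest[OF A(1,2)] A(3) by blast
  have "b < k"
    using k[OF A(3)] ptnD[OF A(2)[OF A(3)], of k b] \<open>v b \<noteq> 0\<close> by (cases "b < k") auto
  have "(\<lambda>w. lr_num f g (inc k w)) (dec u) = 0"
  proof (rule kostka_indep_all[where c="\<lambda>w. lr_num f g (inc k w)"])
    show "finite (dec ` {v\<in>A. \<forall>i<k. v i > 0})" using A by simp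
    show "ptn w" if "w \<in> dec ` {v\<in>A. \<forall>i<k. v i > 0}" for w using that A ptn_dec by blast
    show "dec u \<in> dec ` {v\<in>A. \<forall>i<k. v i > 0}" using u pos by blast
    show "(\<Sum>w\<in>dec ` {v\<in>A. \<forall>i<k. v i > 0}. lr_num f g (inc k w) * kostka w emp as) = 0" for as
      using sum_rows[of A k "lr_num f g" as] eop_lr_num[OF f, of k g as] eop_kostka[OF f] vstrips_empty[OF f b \<open>b < k\<close>] A k
      unfolding A_def by simp
  qed
  then show False using u inc_dec[OF A(2)[OF u] k[OF u]] pos unfolding A_def by simp
qed

text \<open>Dual to \<open>lr_num_shift\<close>: \<open>eop b\<close> is applied to both sides of
  the expansion. As f has exactly b rows, its only vertical strip of size b leaves
  \<open>dec f\<close>.\<close>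

lemma lr_num_dec: assumes f: "ptn f" and b: "f b = 0" and pos: "\<And>i. i < b \<Longrightarrow> f i > 0"
  shows "lr_num (dec f) g = (\<lambda>w. lr_num f g (inc b w))"
proof (rule lr_num_eqI)
  define A where "A = {v. lr_num f g v \<noteq> 0}"
  have A: "finite A" "\<And>v. v \<in> A \<Longrightarrow> ptn v \<and> v b = 0"
    using lr_numD[OF f] lr_num_rows[OF f b] unfolding A_def by blast+
  have p: "ptn w \<and> w b = 0" if "lr_num f g (inc b w) \<noteq> 0" for w
  proof -
    have i: "ptn (inc b w)" "inc b w b = 0" using A(2) that unfolding A_def by blast+
    \<comment> \<open>At the border i = b - 1 the monotonicity of \<open>inc b w\<close> would allow
      w to rise by 1; there the vanishing of \<open>inc b w\<close> in row b gives
      \<open>w b = 0\<close>.\<close>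
    have "w (Suc i) \<le> w i" for i
      using ptnD[OF i(1), of i "Suc i"] ptnD[OF i(1), of b "Suc i"] i(2) by (auto simp: inc_def split: if_splits)
    then show ?thesis using ptnI[of w b] i(2) by (auto simp: inc_def)
  qed
  have s: "{w. lr_num f g (inc b w) \<noteq> 0} = dec ` {v\<in>A. \<forall>i<b. v i > 0}"
  proof safe
    fix w assume "lr_num f g (inc b w) \<noteq> 0"
    then show "w \<in> dec ` {v\<in>A. \<forall>i<b. v i > 0}"
      using p[of w] dec_inc unfolding A_def by (intro image_eqI[of _ _ "inc b w"]) (auto simp: inc_def)
  next
    fix v assume "v \<in> A" "\<forall>i<b. 0 < v i" "lr_num f g (inc b (dec v)) = 0"
    then show False using inc_dec[of v b] A(2) unfolding A_def by auto
  qed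
  have "kostka (dec f) g as = (\<Sum>w | lr_num f g (inc b w) \<noteq> 0. lr_num f g (inc b w) * kostka w emp as)" for as
  proof -
    have "kostka (dec f) g as = eop b (kostka f g) as" using pos by (simp add: eop_kostka[OF f] vstrips_rows[OF f b])
    also have "\<dots> = (\<Sum>w\<in>dec ` {v\<in>A. \<forall>i<b. v i > 0}. lr_num f g (inc b w) * kostka w emp as)"
      unfolding eop_lr_num[OF f] A_def[symmetric] by (rule sum_rows[OF A])
    finally show ?thesis unfolding s .
  qed
  then show "is_lr (dec f) g (\<lambda>w. lr_num f g (inc b w))"
    unfolding is_lr_def using A p s by simp
qed

text \<open>For a partition g, rows i to i + n share the column \<open>f (i + n)\<close>, which n
  strips cannot exhaust. So the polynomial in n variables is 0, and independence in n variables
  removes every v with at most n rows.\<close>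

lemma lr_num_column: assumes f: "ptn f" and n: "g i < f (i + n)" and nz: "lr_num f g v \<noteq> 0" shows "v n > 0"
proof (rule ccontr)
  assume "\<not> v n > 0"
  have "kostka f g as = 0" if "length as = n" for as
    using kostka_nonzero[OF f, of g as] n that by (metis not_le)
  then have "lr_num f g v = (\<lambda>_. 0) v"
    using lr_numD(3)[OF f, of g] \<open>\<not> v n > 0\<close>
    by (intro kostka_indep_diff[where n=n and d="\<lambda>_. 0", OF lr_numD(1)[OF f, of g] _ lr_numD(2)[OF f]]) simp_all
  then show False using nz by simp
qed

text \<open>\<open>killed m F\<close>: no \<open>m\<close> successive vertical strips exhaust \<open>F\<close>. This detects rows longer than \<open>m\<close>
  and replaces the symmetry of the coefficients under transposition.\<close>

fun killed :: "nat \<Rightarrow> (nat list \<Rightarrow> int) \<Rightarrow> bool" where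
  "killed 0 F = (F [] = 0)"
| "killed (Suc m) F = (\<forall>k. killed m (eop k F))"

lemma killed_sum: "(\<And>x. x \<in> B \<Longrightarrow> killed m (F x)) \<Longrightarrow> killed m (\<lambda>as. \<Sum>x\<in>B. F x as)"
proof (induction m arbitrary: F)
  case 0
  then show ?case by simp
next
  case (Suc m)
  have "eop k (\<lambda>as. \<Sum>x\<in>B. F x as) = (\<lambda>as. \<Sum>x\<in>B. eop k (F x) as)" for k
    using eop_sum[of k "\<lambda>_. 1" F B] by auto
  moreover have "killed m (\<lambda>as. \<Sum>x\<in>B. eop k (F x) as)" for k
    using Suc.prems by (intro Suc.IH) auto
  ultimately show ?case by simp
qed

text \<open>Each vertical strip takes at most one box from row i, so m of them cannot bring it down
  to \<open>g i\<close>.\<close>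

lemma killed_kostka: "ptn f \<Longrightarrow> g i + m < f i \<Longrightarrow> killed m (kostka f g)"
proof (induction m arbitrary: f)
  case (Suc m)
  have "killed m (\<lambda>as. \<Sum>h\<in>vstrips f k. kostka h g as)" for k
  proof (rule killed_sum)
    fix h assume "h \<in> vstrips f k"
    then have "ptn h" "f i \<le> Suc (h i)" by (auto simp: vstrips_def vstrip_def)
    then show "killed m (kostka h g)" using Suc by (intro Suc.IH) auto
  qed
  moreover have "eop k (kostka f g) = (\<lambda>as. \<Sum>h\<in>vstrips f k. kostka h g as)" for k
    using eop_kostka[OF Suc.prems(1)] by blast
  ultimately show ?case by simp
qed auto

text \<open>Among the v with nonzero coefficient and first part at most m + 1, let u have the
  largest number k of rows. Under \<open>eop k\<close> it becomes \<open>dec u\<close>, with first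
  part at most m, whose coefficient is 0 by induction. Any other shape that leads to
  \<open>dec u\<close> would again have first part at most m + 1, hence at most k rows, hence be u
  itself; so that coefficient is \<open>c u\<close>.\<close>

lemma killed_zero:
  "killed m F \<Longrightarrow> finite A \<Longrightarrow> (\<And>v. v \<in> A \<Longrightarrow> ptn v) \<Longrightarrow>
   (\<And>as. F as = (\<Sum>v\<in>A. c v * kostka v emp as)) \<Longrightarrow> v \<in> A \<Longrightarrow> v 0 \<le> m \<Longrightarrow> c v = 0"
proof (induction m arbitrary: F A c v)
  case 0
  have "v = emp" using ptnD[OF 0(3)[OF 0(5)], of 0] 0(6) by auto
  have "F [] = (\<Sum>v\<in>{v}. c v * kostka v emp [])"
    unfolding 0(4) using 0(2,5) \<open>v = emp\<close> by (intro sum.mono_neutral_right) auto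
  then show ?case using 0(1) \<open>v = emp\<close> by simp
next
  case (Suc m)
  show ?case
  proof (rule ccontr)
    assume "c v \<noteq> 0"
    define Z where "Z = {v\<in>A. c v \<noteq> 0 \<and> v 0 \<le> Suc m}"
    have Z: "finite Z" "\<And>v. v \<in> Z \<Longrightarrow> ptn v" "v \<in> Z" using Suc.prems \<open>c v \<noteq> 0\<close> unfolding Z_def by auto
    obtain k u where k: "\<And>v. v \<in> Z \<Longrightarrow> v k = 0" and u: "u \<in> Z" "\<forall>i<k. u i > 0"
      using ptn_longest[OF Z(1,2)] Z(3) by blast
    define B where "B = (\<Union>v\<in>A. vstrips v k)"
    define d where "d = (\<lambda>w. \<Sum>v | v \<in> A \<and> w \<in> vstrips v k. c v)"
    have finB: "finite B" unfolding B_def using Suc.prems finite_vstrips by blast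
    have uA: "u \<in> A" "c u \<noteq> 0" "ptn u" "u 0 \<le> Suc m" using u Z unfolding Z_def by auto
    have VSu: "vstrips u k = {dec u}" using vstrips_rows[OF uA(3) k[OF u(1)]] u by simp
    have "d (dec u) = 0"
    proof (rule Suc.IH[where c=d and A=B and F="eop k F"])
      show "killed m (eop k F)" using Suc.prems(1) by simp
      show "finite B" by (rule finB)
      show "ptn v" if "v \<in> B" for v using that vstrips_ptn unfolding B_def by blast
      show "dec u \<in> B" using uA VSu unfolding B_def by blast
      show "dec u 0 \<le> m" using uA by (simp add: dec_def)
      fix as
      have *: "F = (\<lambda>as. \<Sum>v\<in>A. c v * kostka v emp as)" using Suc.prems(4) by blast
      have "eop k F as = (\<Sum>v\<in>A. c v * eop k (kostka v emp) as)" by (subst *, subst eop_sum) simp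
      also have "\<dots> = (\<Sum>v\<in>A. \<Sum>w\<in>vstrips v k. c v * kostka w emp as)"
        using Suc.prems(3) by (simp add: eop_kostka sum_distrib_left)
      also have "\<dots> = (\<Sum>v\<in>A. \<Sum>w | w \<in> B \<and> w \<in> vstrips v k. c v * kostka w emp as)"
        by (intro sum.cong) (auto simp: B_def)
      also have "\<dots> = (\<Sum>w\<in>B. \<Sum>v | v \<in> A \<and> w \<in> vstrips v k. c v * kostka w emp as)"
        by (rule sum.swap_restrict[OF Suc.prems(2) finB])
      finally show "eop k F as = (\<Sum>w\<in>B. d w * kostka w emp as)"
        by (simp add: d_def sum_distrib_right)
    qed
    moreover have "d (dec u) = (\<Sum>v\<in>{u}. c v)"
      unfolding d_def
    proof (rule sum.mono_neutral_right)
      show "\<forall>v\<in>{v \<in> A. dec u \<in> vstrips v k} - {u}. c v = 0"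
      proof (rule ballI, rule ccontr)
        fix v assume v: "v \<in> {v \<in> A. dec u \<in> vstrips v k} - {u}" "c v \<noteq> 0"
        then have "v 0 \<le> Suc (dec u 0)" by (auto simp: vstrips_def vstrip_def)
        \<comment> \<open>For k > 0 the first row of u is nonempty, so \<open>Suc (dec u 0)\<close>
          is \<open>u 0\<close>. For k = 0 the strip is empty and v is \<open>dec u\<close>.\<close>
        have "v 0 \<le> Suc m"
        proof (cases "k = 0")
          case True
          then show ?thesis using v vstrips_0[OF Suc.prems(3)] k[OF u(1)] by (auto simp: dec_def)
        next
          case False
          then show ?thesis using \<open>v 0 \<le> Suc (dec u 0)\<close> uA u(2) by (auto simp: dec_def)
        qed
        then have "v \<in> Z" using v unfolding Z_def by blast
        then have "\<forall>i<k. v i > 0" "dec u = dec v" using v vstrips_rows[OF Z(2) k, OF \<open>v \<in> Z\<close> \<open>v \<in> Z\<close>] by (auto split: if_splits)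
        then have "u = v" using inc_dec[of u k] inc_dec[of v k] Z(2) k u \<open>v \<in> Z\<close> by metis
        then show False using v by blast
      qed
    qed (use Suc.prems(2) uA VSu in auto)
    ultimately show False using uA by simp
  qed
qed

lemma lr_num_row: assumes f: "ptn f" and "lr_num f g v \<noteq> 0" shows "f i - g i \<le> v 0"
proof (rule ccontr)
  assume "\<not> f i - g i \<le> v 0"
  then have "killed (v 0) (kostka f g)" by (intro killed_kostka[OF f, of _ i]) simp
  then have "lr_num f g v = 0"
    using killed_zero[OF _ lr_numD(1,2)[OF f, of g] lr_numD(3)[OF f, of g]] assms(2) by blast
  then show False using assms(2) by simp
qed

section \<open>Multiplicity-freeness under removal of a full row or column\<close>

definition mfree :: "nat \<Rightarrow> shape \<Rightarrow> shape \<Rightarrow> bool" where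
  "mfree n f g \<longleftrightarrow> (\<forall>v. ptn v \<and> v n = 0 \<longrightarrow> lr_num f g v \<in> {0, 1})"

text \<open>Row i meets all columns, so \<open>lr_num_row\<close> and \<open>lr_num_head_le\<close>
  force \<open>v 0 = f 0\<close> for every v that occurs. Row 0 of f is the one that is dropped,
  since \<open>lr_num_shift\<close> concerns the first row; each v loses one row and n drops by
  1.\<close>

lemma mfree_shift:
  assumes f: "ptn f" and "g i = 0" "f i = f 0" and n: "n > 0"
  shows "mfree n f g \<longleftrightarrow> mfree (n - 1) (shift f) g"
proof
  assume m: "mfree n f g"
  show "mfree (n - 1) (shift f) g" unfolding mfree_def lr_num_shift[OF f]
  proof (intro allI impI)
    fix w assume w: "ptn w \<and> w (n - 1) = 0"
    have "lr_num f g (cons (f 0) w) \<in> {0,1}" if "lr_num f g (cons (f 0) w) \<noteq> 0"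
    proof -
      have "cons (f 0) w n = 0" using w n by (cases n) auto
      then show ?thesis using m lr_numD(2)[OF f that] unfolding mfree_def by blast
    qed
    then show "lr_num f g (cons (f 0) w) \<in> {0,1}" by blast
  qed
next
  assume m: "mfree (n - 1) (shift f) g"
  show "mfree n f g" unfolding mfree_def
  proof (intro allI impI, rule ccontr)
    fix v assume v: "ptn v \<and> v n = 0" "lr_num f g v \<notin> {0, 1}"
    then have nz: "lr_num f g v \<noteq> 0" by simp
    show False
    proof -
      have "v 0 = f 0" using lr_num_head_le[OF f nz] lr_num_row[OF f nz, of i] assms by simp
      then have "lr_num f g v = lr_num (shift f) g (shift v)" unfolding lr_num_shift[OF f] by (simp add: cons_shift)
      then show False using m v n ptn_shift[of v] unfolding mfree_def by (auto simp: shift_def)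
    qed
  qed
qed

text \<open>Column \<open>g 0 + 1\<close> meets all b rows, so every v that occurs has exactly b
  rows. The bound b \<le> n ensures that \<open>inc b\<close> keeps shapes within n rows.\<close>

lemma mfree_dec:
  assumes f: "ptn f" and b: "f b = 0" "b > 0" and col: "g 0 < f (b - 1)" and n: "b \<le> n"
  shows "mfree n f g \<longleftrightarrow> mfree n (dec f) g"
proof -
  have pos: "f i > 0" if "i < b" for i by (rule ptn_pos[OF f _ that]) (use col in simp)
  have D: "lr_num (dec f) g = (\<lambda>w. lr_num f g (inc b w))" by (rule lr_num_dec[OF f b(1) pos])
  show ?thesis
  proof
    assume m: "mfree n f g"
    show "mfree n (dec f) g" unfolding mfree_def D
    proof (intro allI impI)
      fix w assume w: "ptn w \<and> w n = 0"
      have "lr_num f g (inc b w) \<in> {0,1}" if "lr_num f g (inc b w) \<noteq> 0"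
        using m lr_numD(2)[OF f that] w n unfolding mfree_def by (auto simp: inc_def)
      then show "lr_num f g (inc b w) \<in> {0,1}" by blast
    qed
  next
    assume m: "mfree n (dec f) g"
    show "mfree n f g" unfolding mfree_def
    proof (intro allI impI, rule ccontr)
      fix v assume v: "ptn v \<and> v n = 0" "lr_num f g v \<notin> {0, 1}"
      then have nz: "lr_num f g v \<noteq> 0" by simp
      show False
      proof -
        have vb: "v b = 0" by (rule lr_num_rows[OF f b(1) nz])
        have "v (b - 1) > 0" using lr_num_column[OF f _ nz, of 0 "b - 1"] col by simp
        then have "v i > 0" if "i < b" for i using ptn_pos[of v b i] v(1) that by blast
        then have "lr_num f g v = lr_num (dec f) g (dec v)"
          unfolding D using inc_dec[of v b] v(1) vb by simp
        then show False using m v ptn_dec[of v] unfolding mfree_def by (auto simp: dec_def)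
      qed
    qed
  qed
qed

text \<open>Every v that occurs has more than n rows, so all the coefficients in question are
  0.\<close>

lemma mfree_tall: "ptn f \<Longrightarrow> g i < f (i + n) \<Longrightarrow> mfree n f g"
  using lr_num_column[of f g i n] unfolding mfree_def by fastforce

section \<open>Deletion of rows and columns, and rotation\<close>

lemma ptn_conj: assumes "ptn f" "c > 0" shows "\<exists>p. \<forall>i. c \<le> f i \<longleftrightarrow> i < p"
proof -
  obtain b where "f b = 0" using assms(1) unfolding ptn_def by blast
  then have ex: "\<exists>i. f i < c" using assms(2) by (metis)
  have "c \<le> f i \<longleftrightarrow> i < (LEAST i. f i < c)" for i
    using LeastI_ex[OF ex] not_less_Least[of i "\<lambda>i. f i < c"] ptnD[OF assms(1), of "LEAST i. f i < c" i]
    by (meson not_le order.strict_trans1)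
  then show ?thesis by blast
qed

section \<open>Deletion of columns\<close>

definition dcol :: "nat \<Rightarrow> shape \<Rightarrow> nat \<Rightarrow> nat" where
  "dcol c f = (\<lambda>i. if c \<le> f i then f i - 1 else f i)"

lemma ptn_dcol: "ptn f \<Longrightarrow> c > 0 \<Longrightarrow> ptn (dcol c f)"
  unfolding dcol_def by (rule ptn_map) auto

lemma psize_dcol: assumes "ptn f" "c > 0" "\<And>i. c \<le> f i \<longleftrightarrow> i < m"
  shows "psize f = psize (dcol c f) + m"
proof -
  obtain b where b: "\<And>i. i \<ge> b \<Longrightarrow> f i = 0" using ptn_bound[OF assms(1)] by blast
  have "m \<le> b" using assms(2) assms(3)[of b] b[of b] by (simp add: not_less)
  have "psize f = sum f {..<b}" using b by (rule psize_eq)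
  also have "\<dots> = (\<Sum>i<b. dcol c f i + of_bool (i < m))"
  proof (intro sum.cong refl)
    fix i show "f i = dcol c f i + of_bool (i < m)"
      using assms(2) assms(3)[of i] by (cases "i < m") (simp_all add: dcol_def)
  qed
  also have "\<dots> = sum (dcol c f) {..<b} + (\<Sum>i<b. of_bool (i < m))" by (simp add: sum.distrib)
  also have "sum (dcol c f) {..<b} = psize (dcol c f)" using b by (intro psize_eq[symmetric]) (simp add: dcol_def)
  also have "(\<Sum>i<b. of_bool (i < m)) = card ({..<b} \<inter> {i. i < m})" by simp
  also have "{..<b} \<inter> {i. i < m} = {..<m}" using \<open>m \<le> b\<close> by auto
  finally show ?thesis by simp
qed

text \<open>With \<open>d = 0\<close> this deletes an empty column; with \<open>d = 1\<close> a column of full height, from which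
  each of the strips takes exactly one box.\<close>

lemma kostka_dcol:
  assumes "ptn f" "ptn g" "c > 0" "d \<le> 1" "\<And>i. c \<le> g i \<longleftrightarrow> i < p" "\<And>i. c \<le> f i \<longleftrightarrow> i < p + d * length as"
  shows "kostka f g as = (if \<forall>a\<in>set as. d \<le> a then kostka (dcol c f) (dcol c g) (map (\<lambda>a. a - d) as) else 0)"
    (is "_ = ?R f as")
  using assms(1,6)
proof (induction as arbitrary: f)
  case Nil
  have "f i = g i \<longleftrightarrow> dcol c f i = dcol c g i" for i
    using assms(3) assms(5)[of i] Nil(2)[of i] by (auto simp: dcol_def)
  then have "f = g \<longleftrightarrow> dcol c f = dcol c g" by (simp add: fun_eq_iff)
  then show ?case by simp
next
  case (Cons a as)
  note pf = Cons.prems(1)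
  \<comment> \<open>The height of column c in the shape left by the first strip: the later strips
    still have to take d boxes each from it, down to p.\<close>
  define q where "q = p + d * length as"
  have fq: "c \<le> f i \<longleftrightarrow> i < q + d" for i using Cons.prems(2)[of i] unfolding q_def by (simp add: ac_simps)
  define H where "H = {h\<in>hstrips f a. \<forall>i. c \<le> h i \<longleftrightarrow> i < q}"
  \<comment> \<open>These are the shapes into which a column c of height q can be inserted: rows
    below index q reach at least to c - 1, the others stop before c.\<close>
  define H' where "H' = {h\<in>hstrips (dcol c f) (a - d). (\<forall>i<q. c \<le> Suc (h i)) \<and> (\<forall>i\<ge>q. h i < c)}"
  have d: "d = 0 \<or> d = 1" using assms(4) by auto
  have pd: "ptn (dcol c f)" by (rule ptn_dcol[OF pf assms(3)])
  \<comment> \<open>For d = 1, the first strip takes at most one box of column c, so at least q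
    remain; the later strips take at most one each, so at most q remain. For d = 0, f and g have the
    same height in column c.\<close>
  have inH: "h \<in> H" if h: "h \<in> hstrips f a" and nz: "kostka h g as \<noteq> 0" for h
  proof -
    have n: "g i \<le> h i" "h (i + length as) \<le> g i" "h i \<le> f i" "f (Suc i) \<le> h i" for i
      using kostka_nonzero[OF hstrips_ptn[OF pf h] nz] h by (auto simp: hstrips_def hstrip_def)
    have "c \<le> h i \<longleftrightarrow> i < q" for i
    proof (cases "i < q")
      case True
      then show ?thesis using n(1,4)[of i] assms(5)[of i] fq[of "Suc i"] d unfolding q_def by auto
    next
      case False
      then show ?thesis using n(3)[of i] n(2)[of p] assms(5)[of p] fq[of i] d unfolding q_def
        by (cases "i = q") (auto simp: q_def)
    qed
    then show ?thesis using h unfolding H_def by blast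
  qed
  have inH': "h \<in> H'" if h: "h \<in> hstrips (dcol c f) (a - d)" and nz: "kostka h (dcol c g) bs \<noteq> 0"
    and len: "length bs = length as" for h bs
  proof -
    have n: "dcol c g i \<le> h i" "h (i + length as) \<le> dcol c g i" "h i \<le> dcol c f i" "dcol c f (Suc i) \<le> h i" for i
      using kostka_nonzero[OF hstrips_ptn[OF pd h] nz] h len by (auto simp: hstrips_def hstrip_def)
    have "c \<le> Suc (h i)" if "i < q" for i
      using that n(1,4)[of i] assms(5)[of i] fq[of "Suc i"] d unfolding q_def dcol_def by auto
    moreover have "h i < c" if "i \<ge> q" for i
      using that n(3)[of i] n(2)[of p] assms(5)[of p] fq[of i] d unfolding q_def
      by (cases "i = q") (auto simp: q_def dcol_def not_le)
    ultimately show ?thesis using h unfolding H'_def by blast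
  qed
  have "kostka f g (a # as) = (\<Sum>h\<in>H. kostka h g as)"
    unfolding kostka.simps using finite_hstrips[OF pf] inH by (intro sum.mono_neutral_right) (auto simp: H_def)
  also have "\<dots> = (\<Sum>h\<in>H. ?R h as)"
  proof (rule sum.cong[OF refl])
    fix h assume "h \<in> H"
    then show "kostka h g as = ?R h as"
      using hstrips_ptn[OF pf] by (intro Cons.IH) (auto simp: H_def q_def)
  qed
  also have "\<dots> = ?R f (a # as)"
  proof (cases "\<forall>a\<in>set (a # as). d \<le> a")
    case False
    have "H = {}" if "\<not> d \<le> a"
    proof -
      \<comment> \<open>An empty strip leaves f itself, whose column c has height q + 1.\<close>
      have "d = 1" "a = 0" using that d by auto
      then show ?thesis using hstrips_0[OF pf] fq[of q] unfolding H_def by auto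
    qed
    then have "H = {} \<or> \<not> (\<forall>a\<in>set as. d \<le> a)" using False by auto
    then show ?thesis using False by (auto intro!: sum.neutral)
  next
    case True
    then have da: "d \<le> a" by simp
    let ?bs = "map (\<lambda>a. a - d) as"
    have "(\<Sum>h\<in>H. kostka (dcol c h) (dcol c g) ?bs) = (\<Sum>h\<in>H'. kostka h (dcol c g) ?bs)"
    proof (rule sum.reindex_bij_witness[where j="dcol c" and i="\<lambda>h i. if i < q then Suc (h i) else h i"])
      fix h assume h: "h \<in> H"
      have hq: "c \<le> h i \<longleftrightarrow> i < q" and hf: "h i \<le> f i" "f (Suc i) \<le> h i" for i
        using h unfolding H_def hstrips_def hstrip_def by auto
      have "hstrip (dcol c f) (dcol c h)"
        unfolding hstrip_def
      proof (intro allI conjI)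
        fix i
        show "dcol c h i \<le> dcol c f i" using hf(1)[of i] by (auto simp: dcol_def)
        show "dcol c f (Suc i) \<le> dcol c h i"
          using hf(2)[of i] hq[of i] fq[of "Suc i"] d by (auto simp: dcol_def)
      qed
      moreover have "psize f = psize (dcol c f) + (q + d)" "psize h = psize (dcol c h) + q"
        using psize_dcol[OF pf assms(3) fq] psize_dcol[OF hstrips_ptn[OF pf] assms(3) hq] h unfolding H_def by blast+
      moreover have "psize f = psize h + a" using h unfolding H_def hstrips_def by blast
      ultimately have "dcol c h \<in> hstrips (dcol c f) (a - d)" using da unfolding hstrips_def by simp
      moreover have "c \<le> Suc (dcol c h i)" if "i < q" for i using hq[of i] that by (simp add: dcol_def)
      moreover have "dcol c h i < c" if "i \<ge> q" for i using hq[of i] that by (simp add: dcol_def)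
      ultimately show "dcol c h \<in> H'" unfolding H'_def by blast
      show "(\<lambda>i. if i < q then Suc (dcol c h i) else dcol c h i) = h"
      proof
        fix i show "(if i < q then Suc (dcol c h i) else dcol c h i) = h i"
          using assms(3) hq[of i] by (cases "i < q") (simp_all add: dcol_def)
      qed
    next
      fix h assume h: "h \<in> H'"
      define k where "k = (\<lambda>i. if i < q then Suc (h i) else h i)"
      have hf: "h i \<le> dcol c f i" "dcol c f (Suc i) \<le> h i" and hq: "i < q \<Longrightarrow> c \<le> Suc (h i)" "i \<ge> q \<Longrightarrow> h i < c" for i
        using h unfolding H'_def hstrips_def hstrip_def by auto
      have kq: "c \<le> k i \<longleftrightarrow> i < q" for i using hq[of i] by (auto simp: k_def)
      show dk: "dcol c k = h"
      proof
        fix i show "dcol c k i = h i" using hq[of i] by (cases "i < q") (simp_all add: dcol_def k_def)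
      qed
      have hstrip: "hstrip f k" unfolding hstrip_def
      proof (intro allI conjI)
        fix i
        show "k i \<le> f i" using hf(1)[of i] fq[of i] assms(3) by (auto simp: dcol_def k_def split: if_splits)
        show "f (Suc i) \<le> k i" using hf(2)[of i] fq[of "Suc i"] d by (auto simp: dcol_def k_def split: if_splits)
      qed
      have "psize f = psize (dcol c f) + (q + d)" "psize k = psize h + q"
        using psize_dcol[OF pf assms(3) fq] psize_dcol[OF hstrip_ptn[OF pf hstrip] assms(3) kq] dk by auto
      then show "k \<in> H" using kq hstrip h da unfolding H_def H'_def hstrips_def by auto
    qed simp
    also have "\<dots> = (\<Sum>h\<in>hstrips (dcol c f) (a - d). kostka h (dcol c g) ?bs)"
      using finite_hstrips[OF pd] inH' by (intro sum.mono_neutral_left) (auto simp: H'_def)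
    finally show ?thesis using True by simp
  qed
  finally show ?case .
qed

definition dcols :: "nat set \<Rightarrow> shape \<Rightarrow> nat \<Rightarrow> nat" where
  "dcols C f = (\<lambda>i. card ({1..f i} - C))"

lemma dcols_insert: assumes "\<forall>a\<in>A. a < b" "b > 0" "0 \<notin> A" shows "dcols (insert b A) f = dcols A (dcol b f)"
proof
  fix i show "dcols (insert b A) f i = dcols A (dcol b f) i"
  proof (cases "b \<le> f i")
    case True
    have fin: "finite A" using assms(1) by (meson bounded_nat_set_is_finite)
    have "card ({1..f i} - insert b A) = f i - card (insert b A)"
    proof -
      have "insert b A \<subseteq> {1..f i}"
      proof
        fix x assume "x \<in> insert b A"
        then show "x \<in> {1..f i}" using True assms by (cases "x = 0") force+
      qed
      then show ?thesis using card_Diff_subset[of "insert b A" "{1..f i}"] fin by simp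
    qed
    moreover have "card ({1..f i - 1} - A) = f i - 1 - card A"
    proof -
      have "A \<subseteq> {1..f i - 1}"
      proof
        fix x assume "x \<in> A"
        then show "x \<in> {1..f i - 1}" using True assms by (cases "x = 0") force+
      qed
      then show ?thesis using card_Diff_subset[of A "{1..f i - 1}"] fin by simp
    qed
    moreover have "card (insert b A) = Suc (card A)" using assms fin by auto
    ultimately show ?thesis using True by (simp add: dcols_def dcol_def)
  next
    case False
    then have "{1..f i} - insert b A = {1..f i} - A" by auto
    then show ?thesis using False by (simp add: dcols_def dcol_def)
  qed
qed

text \<open>The largest column is deleted first, so the smaller ones keep their numbers and
  heights.\<close>

lemma kostka_dcols:
  assumes "finite C" "ptn f" "ptn g" "d \<le> 1"
    and "\<And>c. c \<in> C \<Longrightarrow> c > 0 \<and> (\<exists>p. (\<forall>i. c \<le> g i \<longleftrightarrow> i < p) \<and> (\<forall>i. c \<le> f i \<longleftrightarrow> i < p + d * length as))"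
  shows "kostka f g as = (if \<forall>a\<in>set as. d * card C \<le> a
    then kostka (dcols C f) (dcols C g) (map (\<lambda>a. a - d * card C) as) else 0)"
  using assms
proof (induction C arbitrary: f g as rule: finite_linorder_max_induct)
  case empty
  then show ?case by (simp add: dcols_def)
next
  case (insert b A)
  obtain p where p: "b > 0" "\<forall>i. b \<le> g i \<longleftrightarrow> i < p" "\<forall>i. b \<le> f i \<longleftrightarrow> i < p + d * length as"
    using insert.prems(4)[of b] by auto
  have A0: "0 \<notin> A" using insert.prems(4)[of 0] by auto
  have cA: "card (Set.insert b A) = Suc (card A)" using insert.hyps by auto
  have d: "d = 0 \<or> d = 1" using insert.prems(3) by auto
  let ?as = "map (\<lambda>a. a - d) as"
  have le: "c \<le> dcol b h i \<longleftrightarrow> c \<le> h i" if "c \<in> A" for c h i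
    using insert.hyps(2) that by (auto simp: dcol_def)
  have IH: "kostka (dcol b f) (dcol b g) ?as = (if \<forall>a\<in>set ?as. d * card A \<le> a
    then kostka (dcols A (dcol b f)) (dcols A (dcol b g)) (map (\<lambda>a. a - d * card A) ?as) else 0)"
  proof (rule insert.IH)
    show "ptn (dcol b f)" "ptn (dcol b g)" using ptn_dcol p insert.prems by auto
    show "c > 0 \<and> (\<exists>p. (\<forall>i. c \<le> dcol b g i \<longleftrightarrow> i < p) \<and> (\<forall>i. c \<le> dcol b f i \<longleftrightarrow> i < p + d * length ?as))"
      if "c \<in> A" for c
      using insert.prems(4)[of c] that by (simp add: le)
  qed (use insert.prems in auto)
  have "kostka f g as = (if \<forall>a\<in>set as. d \<le> a then kostka (dcol b f) (dcol b g) ?as else 0)"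
    using p insert.prems by (intro kostka_dcol[where p=p]) auto
  moreover have "(\<forall>a\<in>set as. d \<le> a) \<and> (\<forall>a\<in>set ?as. d * card A \<le> a) \<longleftrightarrow> (\<forall>a\<in>set as. d * card (Set.insert b A) \<le> a)"
    using d unfolding cA by auto fastforce+
  moreover have "map (\<lambda>a. a - d * card A) ?as = map (\<lambda>a. a - d * card (Set.insert b A)) as"
    using d unfolding cA by (auto simp del: map_map simp: map_map)
  moreover have "dcols A (dcol b h) = dcols (Set.insert b A) h" for h
    using dcols_insert[of A b] insert.hyps p A0 by simp
  ultimately show ?case unfolding IH by presburger
qed

lemma ptn_dcols: "ptn f \<Longrightarrow> ptn (dcols C f)"
  unfolding dcols_def by (rule ptn_map) (auto intro: card_mono)

lemma column_height:
  assumes "ptn f" "ptn g" "\<And>i. g i \<le> f i" "c > 0"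
  shows "\<exists>p. (\<forall>i. c \<le> g i \<longleftrightarrow> i < p) \<and> (\<forall>i. c \<le> f i \<longleftrightarrow> i < p + card {i. g i < c \<and> c \<le> f i})"
proof -
  obtain p where p: "\<forall>i. c \<le> g i \<longleftrightarrow> i < p" using ptn_conj[OF assms(2,4)] by blast
  obtain q where q: "\<forall>i. c \<le> f i \<longleftrightarrow> i < q" using ptn_conj[OF assms(1,4)] by blast
  have "p \<le> q" using p q assms(3) by (metis le_trans less_irrefl not_le)
  moreover have "{i. g i < c \<and> c \<le> f i} = {p..<q}" using p q by (auto simp flip: not_le)
  ultimately show ?thesis using p q by (intro exI[of _ p]) simp
qed

lemma kostka_empty_columns:
  assumes "finite C" "ptn f" "ptn g" "\<And>i. g i \<le> f i"
    and "\<And>c. c \<in> C \<Longrightarrow> c > 0 \<and> (\<forall>i. \<not> (g i < c \<and> c \<le> f i))"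
  shows "kostka f g as = kostka (dcols C f) (dcols C g) as"
proof -
  have "c > 0 \<and> (\<exists>p. (\<forall>i. c \<le> g i \<longleftrightarrow> i < p) \<and> (\<forall>i. c \<le> f i \<longleftrightarrow> i < p + 0 * length as))" if "c \<in> C" for c
  proof -
    have "{i. g i < c \<and> c \<le> f i} = {}" using assms(5)[OF that] by blast
    then show ?thesis using column_height[OF assms(2-4), of c] assms(5)[OF that] by simp
  qed
  then have "kostka f g as = (if \<forall>a\<in>set as. 0 * card C \<le> a
    then kostka (dcols C f) (dcols C g) (map (\<lambda>a. a - 0 * card C) as) else 0)"
    by (intro kostka_dcols[OF assms(1-3)]) simp_all
  then show ?thesis by simp
qed

text \<open>In n variables the k full columns amount to the factor (x_1 ... x_n)^k. On the side of
  straight shapes this factor adds k to each of the first n rows, so the expansions correspond term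
  by term.\<close>

lemma mfree_full_columns:
  assumes C: "finite C" "ptn f" "ptn g" "\<And>i. g i \<le> f i"
    and full: "\<And>c. c \<in> C \<Longrightarrow> c > 0 \<and> card {i. g i < c \<and> c \<le> f i} = n"
  shows "mfree n f g \<longleftrightarrow> mfree n (dcols C f) (dcols C g)"
proof -
  define k where "k = card C"
  define f' where "f' = dcols C f"
  define g' where "g' = dcols C g"
  define up :: "shape \<Rightarrow> nat \<Rightarrow> nat" where "up = (\<lambda>v i. if i < n then v i + k else v i)"
  define dn :: "shape \<Rightarrow> nat \<Rightarrow> nat" where "dn = (\<lambda>v i. v i - k)"
  have f': "ptn f'" unfolding f'_def by (rule ptn_dcols[OF C(2)])
  have K: "kostka f g as = (if \<forall>a\<in>set as. k \<le> a then kostka f' g' (map (\<lambda>a. a - k) as) else 0)"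
    if "length as = n" for as
  proof -
    have "c > 0 \<and> (\<exists>p. (\<forall>i. c \<le> g i \<longleftrightarrow> i < p) \<and> (\<forall>i. c \<le> f i \<longleftrightarrow> i < p + 1 * length as))" if "c \<in> C" for c
      using column_height[OF C(2-4), of c] full[OF that] \<open>length as = n\<close> by simp
    then have "kostka f g as = (if \<forall>a\<in>set as. 1 * card C \<le> a
      then kostka (dcols C f) (dcols C g) (map (\<lambda>a. a - 1 * card C) as) else 0)"
      by (intro kostka_dcols[OF C(1-3)]) simp_all
    then show ?thesis unfolding k_def f'_def g'_def by simp
  qed
  have up: "ptn (up v)" "up v n = 0" "dn (up v) = v" if "ptn v" "v n = 0" for v
  proof -
    have z: "v i = 0" if "i \<ge> n" for i using ptnD[OF \<open>ptn v\<close> that] \<open>v n = 0\<close> by simp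
    show "up v n = 0" using that by (simp add: up_def)
    then show "ptn (up v)" using ptnD[OF that(1), of i "Suc i" for i] z
      by (intro ptnI[of _ n]) (auto simp: up_def intro: le_trans)
    show "dn (up v) = v" using z by (auto simp: dn_def up_def)
  qed
  \<comment> \<open>The shape \<open>up v\<close> is v with k columns of height n put in front, so
    \<open>kostka_dcols\<close> applies to columns 1 to k.\<close>
  have Ku: "kostka (up v) emp as = (if \<forall>a\<in>set as. k \<le> a then kostka v emp (map (\<lambda>a. a - k) as) else 0)"
    if "length as = n" "ptn v" "v n = 0" for v as
  proof -
    have z: "v i = 0" if "i \<ge> n" for i using ptnD[OF \<open>ptn v\<close> that] \<open>v n = 0\<close> by simp
    have "dcols {1..k} (up v) = v"
    proof
      fix i
      have "{1..v i + k} - {1..k} = {k<..v i + k}" by auto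
      then show "dcols {1..k} (up v) i = v i" using z[of i] by (auto simp: dcols_def up_def)
    qed
    moreover have "dcols {1..k} emp = emp" by (simp add: dcols_def)
    moreover have "c > 0 \<and> (\<exists>p. (\<forall>i. c \<le> emp i \<longleftrightarrow> i < p) \<and> (\<forall>i. c \<le> up v i \<longleftrightarrow> i < p + 1 * length as))"
      if "c \<in> {1..k}" for c
      using that \<open>length as = n\<close> z by (auto simp: up_def intro!: exI[of _ 0])
    ultimately show ?thesis using kostka_dcols[of "{1..k}" "up v" emp 1 as] up[OF that(2,3)] ptn_emp by simp
  qed
  define c' where "c' = lr_num f' g'"
  \<comment> \<open>The coefficients predicted for f/g: those of the reduced diagram, moved along
    \<open>up\<close>, and 0 for shapes not in its image. They are matched with
    \<open>lr_num f g\<close> by independence in n variables.\<close>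
  define d where "d = (\<lambda>u. if ptn u \<and> u n = 0 \<and> (\<forall>i<n. k \<le> u i) then c' (dn u) else 0)"
  have ud: "up (dn u) = u" "ptn (dn u)" "dn u n = 0" if "ptn u" "u n = 0" "\<forall>i<n. k \<le> u i" for u
  proof -
    have z: "u i = 0" if "i \<ge> n" for i using ptnD[OF \<open>ptn u\<close> that] \<open>u n = 0\<close> by simp
    show "up (dn u) = u" using that z by (auto simp: up_def dn_def fun_eq_iff)
    show "dn u n = 0" using that by (simp add: dn_def)
    then show "ptn (dn u)" using ptnD[OF that(1), of i "Suc i" for i]
      by (intro ptnI[of _ n]) (auto simp: dn_def diff_le_mono)
  qed
  have d_up: "d (up v) = c' v" if "ptn v" "v n = 0" for v
    using up[OF that] by (simp add: d_def) (simp add: up_def)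
  have supp: "{u. d u \<noteq> 0} = up ` {v. c' v \<noteq> 0 \<and> v n = 0}"
  proof (intro equalityI subsetI)
    fix u assume "u \<in> {u. d u \<noteq> 0}"
    then have "ptn u" "u n = 0" "\<forall>i<n. k \<le> u i" "c' (dn u) \<noteq> 0" by (auto simp: d_def split: if_splits)
    then show "u \<in> up ` {v. c' v \<noteq> 0 \<and> v n = 0}" using ud[of u] by (intro image_eqI[of _ _ "dn u"]) auto
  next
    fix u assume "u \<in> up ` {v. c' v \<noteq> 0 \<and> v n = 0}"
    then obtain v where "u = up v" "c' v \<noteq> 0" "v n = 0" by blast
    then show "u \<in> {u. d u \<noteq> 0}" using d_up[of v] lr_numD(2)[OF f'] unfolding c'_def by auto
  qed
  have fin: "finite {v. c' v \<noteq> 0}" and cp: "c' v \<noteq> 0 \<Longrightarrow> ptn v" for v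
    using lr_numD[OF f'] unfolding c'_def by blast+
  have main: "lr_num f g u = d u" if "u n = 0" for u
  proof (rule kostka_indep_diff[where n=n and c="lr_num f g" and d=d])
    show "finite {v. lr_num f g v \<noteq> 0}" by (rule lr_numD(1)[OF C(2)])
    show "\<And>v. lr_num f g v \<noteq> 0 \<Longrightarrow> ptn v" by (rule lr_numD(2)[OF C(2)])
    show "finite {u. d u \<noteq> 0}" unfolding supp using fin by simp
    show "\<And>u. d u \<noteq> 0 \<Longrightarrow> ptn u" by (auto simp: d_def split: if_splits)
    show "u n = 0" by (rule that)
    fix as :: "nat list" assume as: "length as = n"
    let ?K = "\<lambda>f g. if \<forall>a\<in>set as. k \<le> a then kostka f g (map (\<lambda>a. a - k) as) else 0"
    have inj: "inj_on up {v. c' v \<noteq> 0 \<and> v n = 0}"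
      by (rule inj_on_inverseI[of _ dn]) (use up(3) cp in auto)
    have "(\<Sum>u | d u \<noteq> 0. d u * kostka u emp as) = (\<Sum>v | c' v \<noteq> 0 \<and> v n = 0. d (up v) * kostka (up v) emp as)"
      unfolding supp by (simp add: sum.reindex[OF inj])
    also have "\<dots> = (\<Sum>v | c' v \<noteq> 0 \<and> v n = 0. c' v * ?K v emp)"
      using d_up cp Ku[OF as] by (intro sum.cong) auto
    also have "\<dots> = (\<Sum>v | c' v \<noteq> 0. c' v * ?K v emp)"
    proof (intro sum.mono_neutral_left ballI)
      fix v assume v: "v \<in> {v. c' v \<noteq> 0} - {v. c' v \<noteq> 0 \<and> v n = 0}"
      then have "kostka v emp (map (\<lambda>a. a - k) as) = 0"
        using kostka_nonzero[of v emp "map (\<lambda>a. a - k) as"] cp[of v] as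
        by (metis (mono_tags, lifting) DiffD1 DiffD2 add_0 length_map le_zero_eq mem_Collect_eq)
      then show "c' v * ?K v emp = 0" by simp
    qed (use fin in auto)
    also have "\<dots> = ?K f' g'"
      using lr_numD(3)[OF f', of g'] unfolding c'_def by (cases "\<forall>a\<in>set as. k \<le> a") (auto intro!: sum.neutral)
    also have "\<dots> = kostka f g as" using K[OF as] by simp
    finally show "(\<Sum>v | lr_num f g v \<noteq> 0. lr_num f g v * kostka v emp as) = (\<Sum>u | d u \<noteq> 0. d u * kostka u emp as)"
      using lr_numD(3)[OF C(2), of g] by simp
  qed
  show ?thesis unfolding f'_def[symmetric] g'_def[symmetric]
  proof
    assume m: "mfree n f g"
    show "mfree n f' g'" unfolding mfree_def
    proof (intro allI impI)
      fix v assume v: "ptn v \<and> v n = 0"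
      then have "lr_num f' g' v = lr_num f g (up v)" using main[of "up v"] d_up[of v] up[of v] unfolding c'_def by simp
      then show "lr_num f' g' v \<in> {0, 1}" using m up[of v] v unfolding mfree_def by auto
    qed
  next
    assume m: "mfree n f' g'"
    show "mfree n f g" unfolding mfree_def
    proof (intro allI impI)
      fix u assume u: "ptn u \<and> u n = 0"
      then show "lr_num f g u \<in> {0, 1}" using m ud[of u] main[of u] unfolding mfree_def d_def c'_def by auto
    qed
  qed
qed

section \<open>Deletion of empty rows\<close>

lemma ptn_finite: "ptn f \<Longrightarrow> finite {i. f i \<noteq> 0}"
  by (rule finite_subset[of _ "{..<psize f}"]) (auto dest: ptn_le_psize(2))

lemma psize_comp: assumes "ptn f" "strict_mono e"
  shows "psize f = psize (f \<circ> e) + (\<Sum>i | i \<notin> range e \<and> f i \<noteq> 0. f i)"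
proof -
  have inj: "inj_on e X" for X using assms(2) by (simp add: strict_mono_on_imp_inj_on inj_on_subset[OF _ subset_UNIV])
  have s: "{i. f i \<noteq> 0} = e ` {j. f (e j) \<noteq> 0} \<union> {i. i \<notin> range e \<and> f i \<noteq> 0}" by auto
  have fin: "finite (e ` {j. f (e j) \<noteq> 0})" "finite {i. i \<notin> range e \<and> f i \<noteq> 0}"
    by (rule finite_subset[OF _ ptn_finite[OF assms(1)]], auto)+
  have "psize f = sum f (e ` {j. f (e j) \<noteq> 0}) + (\<Sum>i | i \<notin> range e \<and> f i \<noteq> 0. f i)"
    unfolding psize_def by (subst s, rule sum.union_disjoint[OF fin]) auto
  then show ?thesis by (simp add: sum.reindex[OF inj] psize_def)
qed

lemma psize_comp_diff:
  assumes "ptn f" "ptn h" "strict_mono e" "\<And>i. i \<notin> range e \<Longrightarrow> h i = f i"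
  shows "psize f + psize (h \<circ> e) = psize h + psize (f \<circ> e)"
proof -
  have "(\<Sum>i | i \<notin> range e \<and> h i \<noteq> 0. h i) = (\<Sum>i | i \<notin> range e \<and> f i \<noteq> 0. f i)"
    using assms(4) by (intro sum.cong) auto
  then show ?thesis using psize_comp[OF assms(1,3)] psize_comp[OF assms(2,3)] by simp
qed

lemma ptn_comp: assumes "ptn f" "strict_mono (e :: nat \<Rightarrow> nat)" shows "ptn (f \<circ> e)"
proof -
  obtain b where "f b = 0" using assms unfolding ptn_def by blast
  moreover have "b \<le> e b" using assms(2) by (rule strict_mono_imp_increasing)
  ultimately have "f (e b) = 0" using ptnD[OF assms(1), of b "e b"] by simp
  moreover have "f (e (Suc i)) \<le> f (e i)" for i
    using ptnD[OF assms(1)] strict_mono_mono[OF assms(2)] by (simp add: monoD)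
  ultimately show ?thesis using ptnI[of "f \<circ> e"] by simp
qed

text \<open>The map e enumerates the kept rows. In a skipped row f and g agree, which pins every
  shape between them, so a chain is determined by its kept rows.\<close>

lemma kostka_comp:
  assumes "ptn f" "ptn g" and e: "strict_mono (e :: nat \<Rightarrow> nat)" and "\<And>i. i \<notin> range e \<Longrightarrow> f i = g i"
  shows "kostka f g as = kostka (f \<circ> e) (g \<circ> e) as"
  using assms(1,4)
proof (induction as arbitrary: f)
  case Nil
  have "f = g \<longleftrightarrow> f \<circ> e = g \<circ> e" using Nil(2) by (auto simp: fun_eq_iff) (metis rangeE)
  then show ?case by (simp only: kostka.simps)
next
  case (Cons a as)
  note pf = Cons.prems(1)
  have eS: "Suc (e j) \<le> e (Suc j)" for j using strict_monoD[OF e, of j "Suc j"] by simp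
  define H where "H = {h\<in>hstrips f a. \<forall>i. g i \<le> h i}"
  define H' where "H' = {h\<in>hstrips (f \<circ> e) a. \<forall>i. (g \<circ> e) i \<le> h i}"
  have off: "h i = f i" if "h \<in> H" "i \<notin> range e" for h i
  proof (rule antisym)
    show "h i \<le> f i" using that unfolding H_def hstrips_def hstrip_def by blast
    show "f i \<le> h i" using Cons.prems(2)[OF that(2)] that(1) unfolding H_def by simp
  qed
  have inj: "inj e" using e by (rule strict_mono_imp_inj_on)
  have "kostka f g (a # as) = (\<Sum>h\<in>H. kostka h g as)"
    unfolding kostka.simps using finite_hstrips[OF pf] kostka_nonzero[OF hstrips_ptn[OF pf], of _ a g as]
    by (intro sum.mono_neutral_right) (auto simp: H_def)
  also have "\<dots> = (\<Sum>h\<in>H. kostka (h \<circ> e) (g \<circ> e) as)"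
  proof (rule sum.cong[OF refl])
    fix h assume "h \<in> H"
    then show "kostka h g as = kostka (h \<circ> e) (g \<circ> e) as"
      using hstrips_ptn[OF pf] off Cons.prems(2) by (intro Cons.IH) (auto simp: H_def)
  qed
  also have "\<dots> = (\<Sum>h\<in>H'. kostka h (g \<circ> e) as)"
  proof (rule sum.reindex_bij_witness[where j="\<lambda>h. h \<circ> e" and i="\<lambda>h i. if i \<in> range e then h (inv e i) else f i"])
    fix h assume h: "h \<in> H"
    show "(\<lambda>i. if i \<in> range e then (h \<circ> e) (inv e i) else f i) = h"
      using off[OF h] inj by (auto simp: fun_eq_iff f_inv_into_f)
    have "psize f + psize (h \<circ> e) = psize h + psize (f \<circ> e)"
      using h hstrips_ptn[OF pf] off[OF h] unfolding H_def by (intro psize_comp_diff[OF pf _ e]) blast+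
    moreover have "hstrip (f \<circ> e) (h \<circ> e)" unfolding hstrip_def
    proof (intro allI conjI)
      fix i
      have "f (e (Suc i)) \<le> f (Suc (e i))" by (rule ptnD[OF pf eS])
      then show "(f \<circ> e) (Suc i) \<le> (h \<circ> e) i" "(h \<circ> e) i \<le> (f \<circ> e) i"
        using h unfolding H_def hstrips_def hstrip_def by (auto intro: le_trans)
    qed
    ultimately show "h \<circ> e \<in> H'" using h unfolding H_def H'_def hstrips_def by auto
  next
    fix h assume h: "h \<in> H'"
    define k where "k = (\<lambda>i. if i \<in> range e then h (inv e i) else f i)"
    have ke: "k (e j) = h j" for j using inj by (simp add: k_def)
    then show "k \<circ> e = h" by auto
    have hh: "h j \<le> f (e j)" "f (e (Suc j)) \<le> h j" "g (e j) \<le> h j" for j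
      using h unfolding H'_def hstrips_def hstrip_def by auto
    have kf: "k i \<le> f i" "g i \<le> k i" for i
    proof -
      have "k i \<le> f i \<and> g i \<le> k i"
      proof (cases "i \<in> range e")
        case True
        then obtain j where "i = e j" by blast
        then show ?thesis using ke hh by simp
      qed (use Cons.prems(2)[of i] in \<open>simp add: k_def\<close>)
      then show "k i \<le> f i" "g i \<le> k i" by auto
    qed
    \<comment> \<open>If row i + 1 is skipped, f there equals g, which is at most \<open>g i\<close>
      and hence at most \<open>k i\<close>. If rows i and i + 1 are both kept, they are successive
      values of e and the interlacing of h applies. If only row i + 1 is kept, \<open>k i\<close> is
      \<open>f i\<close>.\<close>
    have "f (Suc i) \<le> k i" for i
    proof (cases "Suc i \<in> range e")
      case False
      then have "f (Suc i) = g (Suc i)" using Cons.prems(2) by blast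
      also have "\<dots> \<le> g i" using ptnD[OF assms(2)] by simp
      finally show ?thesis using kf(2)[of i] by simp
    next
      case T: True
      show ?thesis
      proof (cases "i \<in> range e")
        case True
        then obtain j where j: "i = e j" by blast
        obtain l where l: "Suc i = e l" using T by blast
        have "j < l" using j l strict_mono_less[OF e, of j l] by simp
        then have "e (Suc j) \<le> e l" using strict_mono_mono[OF e] by (simp add: monoD Suc_leI)
        then have "Suc i = e (Suc j)" using eS[of j] j l by simp
        then show ?thesis using hh(2)[of j] ke[of j] j by simp
      next
        case False
        then show ?thesis using ptnD[OF pf, of i "Suc i"] by (simp add: k_def)
      qed
    qed
    then have hstrip: "hstrip f k" using kf unfolding hstrip_def by blast
    have "psize f + psize (k \<circ> e) = psize k + psize (f \<circ> e)"
      by (rule psize_comp_diff[OF pf hstrip_ptn[OF pf hstrip] e]) (simp add: k_def)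
    then show "k \<in> H" using hstrip kf h \<open>k \<circ> e = h\<close> unfolding H_def H'_def hstrips_def by auto
  qed simp
  also have "\<dots> = (\<Sum>h\<in>hstrips (f \<circ> e) a. kostka h (g \<circ> e) as)"
    using finite_hstrips[OF ptn_comp[OF pf e]] kostka_nonzero[OF hstrips_ptn[OF ptn_comp[OF pf e]], of _ a "g \<circ> e" as]
    by (intro sum.mono_neutral_left) (auto simp: H'_def)
  finally show ?case by (simp only: kostka.simps)
qed

section \<open>Rotation by 180 degrees\<close>

text \<open>The shapes that can precede g in a chain from f. Rotation reverses chains, so the
  recursion must also be available at the end of the smallest entries.\<close>

definition between :: "shape \<Rightarrow> shape \<Rightarrow> nat \<Rightarrow> shape set" where
  "between f g a = {h. hstrip h g \<and> psize h = psize g + a \<and> (\<forall>i. h i \<le> f i)}"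

lemma finite_between: "ptn f \<Longrightarrow> finite (between f g a)"
  by (rule finite_subset[OF _ finite_below[of f]]) (auto simp: between_def)

lemma kostka_snoc: "ptn f \<Longrightarrow> kostka f g (as @ [a]) = (\<Sum>h\<in>between f g a. kostka f h as)"
proof (induction as arbitrary: f)
  case Nil
  have "kostka f g [a] = of_bool (g \<in> hstrips f a)" using finite_hstrips[OF Nil] by simp
  moreover have "(\<Sum>h\<in>between f g a. kostka f h []) = of_bool (f \<in> between f g a)"
    using finite_between[OF Nil] by simp
  ultimately show ?case by (simp add: hstrips_def between_def)
next
  case (Cons x as)
  let ?S = "\<lambda>f. between f g a"
  have "kostka f g ((x # as) @ [a]) = (\<Sum>t\<in>hstrips f x. \<Sum>h\<in>?S t. kostka t h as)"
    using Cons hstrips_ptn[OF Cons.prems] by simp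
  also have "\<dots> = (\<Sum>t\<in>hstrips f x. \<Sum>h\<in>?S f. kostka t h as)"
  proof (rule sum.cong[OF refl])
    fix t assume t: "t \<in> hstrips f x"
    show "(\<Sum>h\<in>?S t. kostka t h as) = (\<Sum>h\<in>?S f. kostka t h as)"
    proof (rule sum.mono_neutral_left)
      show "finite (?S f)" by (rule finite_between[OF Cons.prems])
      show "?S t \<subseteq> ?S f" using t unfolding hstrips_def hstrip_def between_def by (auto intro: le_trans)
      show "\<forall>h\<in>?S f - ?S t. kostka t h as = 0"
        using kostka_nonzero[OF hstrips_ptn[OF Cons.prems t]] unfolding between_def by blast
    qed
  qed
  also have "\<dots> = (\<Sum>h\<in>?S f. kostka f h (x # as))" by (subst sum.swap) simp
  finally show ?case .
qed

text \<open>The complement in the rectangle with b rows of length a. The rotated diagram of f/g is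
  \<open>rot a b g\<close> over \<open>rot a b f\<close>: outer and inner shape change
  places.\<close>

definition rot :: "nat \<Rightarrow> nat \<Rightarrow> shape \<Rightarrow> nat \<Rightarrow> nat" where
  "rot a b f = (\<lambda>i. if i < b then a - f (b - 1 - i) else 0)"

lemma rot_rot: "(\<And>i. f i \<le> a) \<Longrightarrow> (\<And>i. i \<ge> b \<Longrightarrow> f i = 0) \<Longrightarrow> rot a b (rot a b f) = f"
  by (auto simp: rot_def fun_eq_iff)

lemma ptn_rot: assumes "ptn f" shows "ptn (rot a b f)"
proof (rule ptnI[of _ b])
  show "rot a b f (Suc i) \<le> rot a b f i" for i
    using ptnD[OF assms, of "b - 1 - Suc i" "b - 1 - i"] by (auto simp: rot_def intro!: diff_le_mono2)
qed (simp add: rot_def)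

lemma psize_rot: assumes "\<And>i. f i \<le> a" "\<And>i. i \<ge> b \<Longrightarrow> f i = 0" shows "psize (rot a b f) + psize f = a * b"
proof -
  have "psize (rot a b f) = (\<Sum>i<b. a - f (b - 1 - i))"
    by (subst psize_eq[of b]) (auto simp: rot_def)
  also have "\<dots> = (\<Sum>i<b. a - f i)" by (rule sum.reindex_bij_witness[where i="\<lambda>i. b - 1 - i" and j="\<lambda>i. b - 1 - i"]) auto
  finally have "psize (rot a b f) + psize f = (\<Sum>i<b. (a - f i) + f i)"
    using psize_eq[of b f] assms(2) by (simp add: sum.distrib)
  also have "\<dots> = a * b" using assms(1) by simp
  finally show ?thesis .
qed

lemma hstrip_rot: assumes "hstrip f h" "\<And>i. f i \<le> a" "\<And>i. i \<ge> b \<Longrightarrow> f i = 0" shows "hstrip (rot a b h) (rot a b f)"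
  unfolding hstrip_def
proof (intro allI conjI)
  fix i
  show "rot a b f i \<le> rot a b h i" using assms(1) by (auto simp: rot_def hstrip_def diff_le_mono2)
  show "rot a b h (Suc i) \<le> rot a b f i"
  proof (cases "Suc i < b")
    case True
    then have "Suc (b - 1 - Suc i) = b - 1 - i" by simp
    then have "f (b - 1 - i) \<le> h (b - 1 - Suc i)" using assms(1) unfolding hstrip_def by metis
    then show ?thesis using True by (simp add: rot_def diff_le_mono2)
  qed (simp add: rot_def)
qed

text \<open>Complementation reverses inclusion and interlacing, so the chain is read backwards;
  \<open>kostka_snoc\<close> peels the rotated chain at its other end.\<close>

lemma kostka_rot:
  assumes "ptn f" "\<And>i. f i \<le> a" "\<And>i. i \<ge> b \<Longrightarrow> f i = 0"
    and g: "ptn g" "\<And>i. g i \<le> a" "\<And>i. i \<ge> b \<Longrightarrow> g i = 0"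
  shows "kostka (rot a b g) (rot a b f) (rev as) = kostka f g as"
  using assms(1-3)
proof (induction as arbitrary: f)
  case Nil
  then have "rot a b g = rot a b f \<longleftrightarrow> f = g" using rot_rot[of g a b] rot_rot[of f a b] g by metis
  then show ?case by simp
next
  case (Cons x as)
  note pf = Cons.prems(1)
  define H where "H = {h\<in>hstrips f x. \<forall>i. g i \<le> h i}"
  let ?S = "between (rot a b g) (rot a b f) x"
  have bd: "h i \<le> a" "i \<ge> b \<Longrightarrow> h i = 0" if "\<And>i. h i \<le> f i" for h i
    using that[of i] Cons.prems(2,3)[of i] by auto
  have "kostka (rot a b g) (rot a b f) (rev (x # as)) = (\<Sum>h\<in>?S. kostka (rot a b g) h (rev as))"
    using kostka_snoc[OF ptn_rot[OF g(1)]] by simp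
  also have "\<dots> = (\<Sum>h\<in>H. kostka (rot a b g) (rot a b h) (rev as))"
  proof (rule sum.reindex_bij_witness[where i="rot a b" and j="rot a b"])
    fix h assume "h \<in> ?S"
    then have h: "hstrip h (rot a b f)" "psize h = psize (rot a b f) + x" "\<And>i. h i \<le> rot a b g i"
      unfolding between_def by auto
    have b: "h i \<le> a" "i \<ge> b \<Longrightarrow> h i = 0" for i
    proof -
      have "h i \<le> rot a b g i" by (rule h(3))
      also have "\<dots> \<le> a" by (simp add: rot_def)
      finally show "h i \<le> a" .
      show "h i = 0" if "i \<ge> b" using h(3)[of i] that by (simp add: rot_def)
    qed
    show rr: "rot a b (rot a b h) = h" using b by (rule rot_rot)
    then show "kostka (rot a b g) (rot a b (rot a b h)) (rev as) = kostka (rot a b g) h (rev as)" by simp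
    have "hstrip (rot a b (rot a b f)) (rot a b h)" by (rule hstrip_rot[OF h(1) b])
    then have 1: "hstrip f (rot a b h)" using rot_rot[of f a b] Cons.prems by simp
    have 2: "g i \<le> rot a b h i" for i
    proof (cases "i < b")
      case True
      then show ?thesis using h(3)[of "b - 1 - i"] g(2)[of i] by (auto simp: rot_def)
    qed (use g in \<open>simp add: rot_def\<close>)
    have "psize (rot a b h) + psize h = a * b" by (rule psize_rot[OF b])
    moreover have "psize (rot a b f) + psize f = a * b" by (rule psize_rot[OF Cons.prems(2,3)])
    ultimately show "rot a b h \<in> H" using 1 2 h unfolding H_def hstrips_def by auto
  next
    fix h assume h: "h \<in> H"
    have hf: "h i \<le> f i" for i using h unfolding H_def hstrips_def hstrip_def by blast
    show "rot a b (rot a b h) = h" using bd[OF hf] by (rule rot_rot)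
    have "hstrip (rot a b h) (rot a b f)" using hstrip_rot[of f h a b] h Cons.prems unfolding H_def hstrips_def by blast
    moreover have "psize (rot a b h) + psize h = a * b" by (rule psize_rot[OF bd[OF hf]])
    moreover have "psize (rot a b f) + psize f = a * b" by (rule psize_rot[OF Cons.prems(2,3)])
    moreover have "rot a b h i \<le> rot a b g i" for i using h unfolding H_def by (simp add: rot_def diff_le_mono2)
    ultimately show "rot a b h \<in> ?S" using h unfolding H_def hstrips_def between_def by auto
  qed
  also have "\<dots> = (\<Sum>h\<in>H. kostka h g as)"
  proof (rule sum.cong[OF refl])
    fix h assume h: "h \<in> H"
    have hf: "h i \<le> f i" for i using h unfolding H_def hstrips_def hstrip_def by blast
    show "kostka (rot a b g) (rot a b h) (rev as) = kostka h g as"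
    proof (rule Cons.IH)
      show "ptn h" using h hstrips_ptn[OF pf] unfolding H_def by blast
    qed (use bd[of h, OF hf] in auto)
  qed
  also have "\<dots> = kostka f g (x # as)"
    unfolding kostka.simps using finite_hstrips[OF pf] kostka_nonzero[OF hstrips_ptn[OF pf], of _ x g as]
    by (intro sum.mono_neutral_left) (auto simp: H_def)
  finally show ?case .
qed

lemma lr_num_rot:
  assumes "ptn f" "\<And>i. f i \<le> a" "\<And>i. i \<ge> b \<Longrightarrow> f i = 0"
    and g: "ptn g" "\<And>i. g i \<le> a" "\<And>i. i \<ge> b \<Longrightarrow> g i = 0"
  shows "lr_num (rot a b g) (rot a b f) = lr_num f g"
proof (rule lr_num_cong)
  fix as
  have "kostka (rot a b g) (rot a b f) as = kostka f g (rev as)" using kostka_rot[OF assms, where as="rev as"] by simp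
  also have "\<dots> = kostka f g as" by (rule kostka_perm[OF assms(1)]) simp
  finally show "kostka (rot a b g) (rot a b f) as = kostka f g as" .
qed

section \<open>Tableaux as chains of strips\<close>

definition boxes :: "shape \<Rightarrow> shape \<Rightarrow> (nat \<times> nat) set" where
  "boxes f g = {(r, c). r > 0 \<and> g (r - 1) < c \<and> c \<le> f (r - 1)}"

definition tabs :: "nat \<Rightarrow> (nat \<times> nat) set \<Rightarrow> (nat \<times> nat \<Rightarrow> nat) set" where
  "tabs n D = {T \<in> D \<rightarrow>\<^sub>E {1..n}.
     (\<forall>r c c'. (r, c) \<in> D \<and> (r, c') \<in> D \<and> c < c' \<longrightarrow> T (r, c) \<le> T (r, c')) \<and>
     (\<forall>r r' c. (r, c) \<in> D \<and> (r', c) \<in> D \<and> r < r' \<longrightarrow> T (r, c) < T (r', c))}"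

definition ctabs :: "nat \<Rightarrow> (nat \<times> nat) set \<Rightarrow> shape \<Rightarrow> (nat \<times> nat \<Rightarrow> nat) set" where
  "ctabs n D \<alpha> = {T \<in> tabs n D. \<forall>i\<in>{1..n}. card {b\<in>D. T b = i} = \<alpha> i}"

lemma boxes_iff [simp]: "(Suc i, c) \<in> boxes f g \<longleftrightarrow> g i < c \<and> c \<le> f i" "(0, c) \<notin> boxes f g"
  by (auto simp: boxes_def)

lemma boxes_decomp: assumes "\<And>i. i \<ge> b \<Longrightarrow> f i = 0" shows "boxes f g = (\<Union>i\<in>{..<b}. {Suc i} \<times> {g i<..f i})"
proof -
  have lt: "i < b" if "c \<le> f i" "g i < c" for c i using assms[of i] that by (cases "i < b") auto
  show ?thesis
  proof (intro equalityI subsetI)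
    fix x assume x: "x \<in> boxes f g"
    then obtain i c where "x = (Suc i, c)" by (metis boxes_iff(2) not0_implies_Suc surj_pair)
    then show "x \<in> (\<Union>i\<in>{..<b}. {Suc i} \<times> {g i<..f i})" using x lt[of c i] by auto
  qed auto
qed

lemma card_boxes: assumes "ptn f" "\<And>i. g i \<le> f i"
  shows "finite (boxes f g)" "card (boxes f g) + psize g = psize f"
proof -
  obtain b where b: "\<And>i. i \<ge> b \<Longrightarrow> f i = 0" using ptn_bound[OF assms(1)] by blast
  have bg: "\<And>i. i \<ge> b \<Longrightarrow> g i = 0" using b assms(2) by (metis le_zero_eq)
  have dd: "boxes f g = (\<Union>i\<in>{..<b}. {Suc i} \<times> {g i<..f i})" by (rule boxes_decomp[OF b])
  show "finite (boxes f g)" unfolding dd by simp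
  have "card (boxes f g) = (\<Sum>i<b. card ({Suc i} \<times> {g i<..f i}))"
    unfolding dd by (intro card_UN_disjoint) auto
  also have "\<dots> = (\<Sum>i<b. f i - g i)" by (simp add: card_cartesian_product)
  finally have "card (boxes f g) + psize g = (\<Sum>i<b. (f i - g i) + g i)"
    using psize_eq[of b g] bg by (simp add: sum.distrib)
  also have "\<dots> = (\<Sum>i<b. f i)" using assms(2) by (intro sum.cong) auto
  also have "\<dots> = psize f" using psize_eq[of b f] b by simp
  finally show "card (boxes f g) + psize g = psize f" .
qed

lemma initial_segment:
  fixes a :: nat
  assumes "Y \<subseteq> {a<..b}" "\<And>c c'. c \<in> Y \<Longrightarrow> a < c' \<Longrightarrow> c' < c \<Longrightarrow> c' \<in> Y"
  shows "Y = {a<..a + card Y}"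
proof (cases "Y = {}")
  case False
  have fin: "finite Y" using assms(1) finite_subset by blast
  have m: "Max Y \<in> Y" "\<And>c. c \<in> Y \<Longrightarrow> c \<le> Max Y" using fin False by auto
  have "Y = {a<..Max Y}"
  proof (intro equalityI subsetI)
    fix c assume "c \<in> Y" then show "c \<in> {a<..Max Y}" using m assms(1) by auto
  next
    fix c assume "c \<in> {a<..Max Y}"
    then show "c \<in> Y" using m(1) assms(2)[OF m(1), of c] by (cases "c = Max Y") auto
  qed
  moreover have "a \<le> Max Y" using m(1) assms(1) by auto
  ultimately show ?thesis by (metis card_greaterThanAtMost le_add_diff_inverse)
qed simp

lemma tabsD:
  assumes "T \<in> tabs n D"
  shows "b \<in> D \<Longrightarrow> 1 \<le> T b \<and> T b \<le> n" "b \<notin> D \<Longrightarrow> T b = undefined"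
    "(r, c) \<in> D \<Longrightarrow> (r, c') \<in> D \<Longrightarrow> c < c' \<Longrightarrow> T (r, c) \<le> T (r, c')"
    "(r, c) \<in> D \<Longrightarrow> (r', c) \<in> D \<Longrightarrow> r < r' \<Longrightarrow> T (r, c) < T (r', c)"
proof -
  have "T \<in> D \<rightarrow>\<^sub>E {1..n}" using assms unfolding tabs_def by blast
  then show "b \<in> D \<Longrightarrow> 1 \<le> T b \<and> T b \<le> n" "b \<notin> D \<Longrightarrow> T b = undefined"
    by (fastforce simp: PiE_iff extensional_def)+
  show "(r, c) \<in> D \<Longrightarrow> (r, c') \<in> D \<Longrightarrow> c < c' \<Longrightarrow> T (r, c) \<le> T (r, c')"
    "(r, c) \<in> D \<Longrightarrow> (r', c) \<in> D \<Longrightarrow> r < r' \<Longrightarrow> T (r, c) < T (r', c)"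
    using assms unfolding tabs_def by blast+
qed

lemma tabsI:
  assumes "\<And>b. b \<in> D \<Longrightarrow> 1 \<le> T b \<and> T b \<le> n" "\<And>b. b \<notin> D \<Longrightarrow> T b = undefined"
    "\<And>r c c'. (r, c) \<in> D \<Longrightarrow> (r, c') \<in> D \<Longrightarrow> c < c' \<Longrightarrow> T (r, c) \<le> T (r, c')"
    "\<And>r r' c. (r, c) \<in> D \<Longrightarrow> (r', c) \<in> D \<Longrightarrow> r < r' \<Longrightarrow> T (r, c) < T (r', c)"
  shows "T \<in> tabs n D"
proof -
  have "T \<in> D \<rightarrow>\<^sub>E {1..n}" using assms(1,2) by (auto simp: PiE_iff extensional_def)
  then show ?thesis using assms(3,4) unfolding tabs_def by blast
qed

lemma finite_tabs: "finite D \<Longrightarrow> finite (tabs n D)"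
  unfolding tabs_def by (rule finite_subset[of _ "D \<rightarrow>\<^sub>E {1..n}"]) (auto intro: finite_PiE)

text \<open>The shape covered by g and the entries at most n. It is read off by counting, since in a
  weakly increasing row these entries form an initial segment.\<close>

definition layer :: "nat \<Rightarrow> shape \<Rightarrow> shape \<Rightarrow> (nat \<times> nat \<Rightarrow> nat) \<Rightarrow> nat \<Rightarrow> nat" where
  "layer n f g T = (\<lambda>i. g i + card {c. g i < c \<and> c \<le> f i \<and> T (Suc i, c) \<le> n})"

text \<open>The boxes with the largest entry n + 1 form a horizontal strip; removing them leaves a
  tableau with entries at most n, and filling a strip with n + 1 is the inverse.\<close>

lemma ctabs_Suc:
  fixes n :: nat and \<alpha> :: "nat \<Rightarrow> nat"
  assumes f: "ptn f" and g: "ptn g" and gf: "\<And>i. g i \<le> f i"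
  defines "H \<equiv> {h\<in>hstrips f (\<alpha> (Suc n)). \<forall>i. g i \<le> h i}"
  shows "bij_betw (\<lambda>T. (layer n f g T, restrict T (boxes (layer n f g T) g)))
    (ctabs (Suc n) (boxes f g) \<alpha>) (SIGMA h:H. ctabs n (boxes h g) \<alpha>)" (is "bij_betw ?F ?A ?B")
proof -
  let ?G = "\<lambda>(h, T) b. if b \<in> boxes h g then T b else if b \<in> boxes f g then Suc n else undefined"
  have key: "layer n f g T \<in> H \<and> restrict T (boxes (layer n f g T) g) \<in> ctabs n (boxes (layer n f g T) g) \<alpha>
    \<and> (\<forall>b. b \<in> boxes f g \<longrightarrow> (b \<in> boxes (layer n f g T) g \<longleftrightarrow> T b \<le> n)) \<and> boxes (layer n f g T) g \<subseteq> boxes f g"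
    if T: "T \<in> ctabs (Suc n) (boxes f g) \<alpha>" for T
  proof -
    have T1: "T \<in> tabs (Suc n) (boxes f g)" and T2: "\<And>i. 1 \<le> i \<Longrightarrow> i \<le> Suc n \<Longrightarrow> card {b\<in>boxes f g. T b = i} = \<alpha> i"
      using T unfolding ctabs_def by auto
    note TD = tabsD[OF T1]
    define h where "h = layer n f g T"
    let ?X = "\<lambda>i. {c. g i < c \<and> c \<le> f i \<and> T (Suc i, c) \<le> n}"
    have X: "?X i = {g i<..h i}" for i
      unfolding h_def layer_def
    proof (rule initial_segment[where b="f i"])
      fix c c' assume "c \<in> ?X i" "g i < c'" "c' < c"
      then show "c' \<in> ?X i"
        using TD(3)[of "Suc i" c' c] by auto
    qed auto
    have gh: "g i \<le> h i" for i unfolding h_def layer_def by simp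
    have hf: "h i \<le> f i" for i
    proof (cases "g i < h i")
      case True
      then have "h i \<in> ?X i" unfolding X by simp
      then show ?thesis by blast
    qed (use gh[of i] gf[of i] in simp)
    have mem: "(r, c) \<in> boxes h g \<longleftrightarrow> T (r, c) \<le> n" if "(r, c) \<in> boxes f g" for r c
    proof (cases r)
      case (Suc i)
      have "c \<in> ?X i \<longleftrightarrow> c \<in> {g i<..h i}" unfolding X ..
      then show ?thesis using that Suc by auto
    qed (use that in simp)
    have sub: "boxes h g \<subseteq> boxes f g" unfolding boxes_def using hf by (auto intro: le_trans)
    \<comment> \<open>Otherwise rows i and i + 1 both have a box in the last column of row i + 1.
      The upper entry exceeds n, so the lower one would exceed n + 1.\<close>
    have fh: "f (Suc i) \<le> h i" for i
    proof (rule ccontr)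
      assume a: "\<not> f (Suc i) \<le> h i"
      let ?c = "f (Suc i)"
      have b1: "(Suc i, ?c) \<in> boxes f g" using a gh[of i] ptnD[OF f, of i "Suc i"] by simp
      have b2: "(Suc (Suc i), ?c) \<in> boxes f g" using a gh[of i] ptnD[OF g, of i "Suc i"] by simp
      have "\<not> T (Suc i, ?c) \<le> n" using mem[OF b1] a by simp
      then show False using TD(4)[OF b1 b2] TD(1)[OF b2] by simp
    qed
    have hstrip: "hstrip f h" unfolding hstrip_def using hf fh by blast
    have "{b\<in>boxes f g. T b = Suc n} = boxes f h"
    proof (intro equalityI subsetI)
      fix b assume b: "b \<in> {b\<in>boxes f g. T b = Suc n}"
      then obtain i c where "b = (Suc i, c)" by (metis boxes_iff(2) mem_Collect_eq not0_implies_Suc surj_pair)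
      then show "b \<in> boxes f h" using b mem[of "Suc i" c] by auto
    next
      fix b assume b: "b \<in> boxes f h"
      then obtain i c where bi: "b = (Suc i, c)" by (metis boxes_iff(2) not0_implies_Suc surj_pair)
      then have "b \<in> boxes f g" "b \<notin> boxes h g" using b gh[of i] by auto
      then show "b \<in> {b\<in>boxes f g. T b = Suc n}" using mem[of "Suc i" c] TD(1)[of b] bi by auto
    qed
    then have "card (boxes f h) = \<alpha> (Suc n)" using T2[of "Suc n"] by simp
    then have "psize f = psize h + \<alpha> (Suc n)" using card_boxes(2)[OF f, of h] hf by simp
    then have "h \<in> H" using hstrip gh unfolding H_def hstrips_def by blast
    moreover have "restrict T (boxes h g) \<in> ctabs n (boxes h g) \<alpha>"
    proof -
      have "restrict T (boxes h g) \<in> tabs n (boxes h g)"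
      proof (rule tabsI)
        fix b assume b: "b \<in> boxes h g"
        then show "1 \<le> restrict T (boxes h g) b \<and> restrict T (boxes h g) b \<le> n"
          using TD(1)[of b] sub mem[of "fst b" "snd b"] by auto
      next
        fix r c c' assume "(r, c) \<in> boxes h g" "(r, c') \<in> boxes h g" "c < c'"
        then show "restrict T (boxes h g) (r, c) \<le> restrict T (boxes h g) (r, c')" using TD(3)[of r c c'] sub by auto
      next
        fix r r' c assume "(r, c) \<in> boxes h g" "(r', c) \<in> boxes h g" "r < r'"
        then show "restrict T (boxes h g) (r, c) < restrict T (boxes h g) (r', c)" using TD(4)[of r c r'] sub by auto
      qed simp
      moreover have "card {b \<in> boxes h g. restrict T (boxes h g) b = i} = \<alpha> i" if "i \<in> {1..n}" for i
      proof -
        have "{b \<in> boxes h g. restrict T (boxes h g) b = i} = {b \<in> boxes f g. T b = i}"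
          using sub mem that by (auto simp: subset_iff)
        then show ?thesis using T2 that by simp
      qed
      ultimately show ?thesis unfolding ctabs_def by blast
    qed
    ultimately show ?thesis using mem sub unfolding h_def by auto
  qed
  have key2: "T' \<in> ctabs (Suc n) (boxes f g) \<alpha> \<and> layer n f g T' = h \<and> restrict T' (boxes h g) = T"
    if h: "h \<in> H" and T: "T \<in> ctabs n (boxes h g) \<alpha>"
      and T': "T' = (\<lambda>b. if b \<in> boxes h g then T b else if b \<in> boxes f g then Suc n else undefined)" for h T T'
  proof -
    have T1: "T \<in> tabs n (boxes h g)" and T2: "\<And>i. 1 \<le> i \<Longrightarrow> i \<le> n \<Longrightarrow> card {b\<in>boxes h g. T b = i} = \<alpha> i"
      using T unfolding ctabs_def by auto
    note TD = tabsD[OF T1]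
    have hstrip: "hstrip f h" and gh: "\<And>i. g i \<le> h i" and ps: "psize f = psize h + \<alpha> (Suc n)"
      using h unfolding H_def hstrips_def by auto
    have ph: "ptn h" by (rule hstrip_ptn[OF f hstrip])
    have hf: "h i \<le> f i" and fh: "f (Suc i) \<le> h i" for i using hstrip unfolding hstrip_def by auto
    have sub: "boxes h g \<subseteq> boxes f g" unfolding boxes_def using hf by (auto intro: le_trans)
    have "T' \<in> tabs (Suc n) (boxes f g)"
    proof (rule tabsI)
      fix b show "b \<in> boxes f g \<Longrightarrow> 1 \<le> T' b \<and> T' b \<le> Suc n" using TD(1)[of b] unfolding T' by auto
      show "b \<notin> boxes f g \<Longrightarrow> T' b = undefined" using sub unfolding T' by auto
    next
      fix r c c' assume b: "(r, c) \<in> boxes f g" "(r, c') \<in> boxes f g" "c < c'"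
      then obtain i where r: "r = Suc i" by (cases r) auto
      show "T' (r, c) \<le> T' (r, c')"
      proof (cases "(r, c') \<in> boxes h g")
        case True
        then have "(r, c) \<in> boxes h g" using b r by auto
        then show ?thesis using TD(3)[OF _ True b(3)] True unfolding T' by simp
      next
        case False
        then show ?thesis using b TD(1)[of "(r, c)"] unfolding T' by auto
      qed
    next
      fix r r' c assume b: "(r, c) \<in> boxes f g" "(r', c) \<in> boxes f g" "r < r'"
      then obtain i j where r: "r = Suc i" "r' = Suc j" "i < j" by (cases r; cases r') auto
      \<comment> \<open>A box of f/g with another one below it lies in h by interlacing, so no two
        new entries n + 1 meet in a column.\<close>
      have "c \<le> f (Suc i)" using b(2) r ptnD[OF f, of "Suc i" j] by simp
      then have rc: "(r, c) \<in> boxes h g" using b(1) r fh[of i] by simp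
      show "T' (r, c) < T' (r', c)"
      proof (cases "(r', c) \<in> boxes h g")
        case True
        then show ?thesis using TD(4)[OF rc True b(3)] rc unfolding T' by simp
      next
        case False
        then show ?thesis using b rc TD(1)[OF rc] unfolding T' by simp
      qed
    qed
    moreover have "card {b \<in> boxes f g. T' b = i} = \<alpha> i" if i: "i \<in> {1..Suc n}" for i
    proof (cases "i = Suc n")
      case True
      have "{b \<in> boxes f g. T' b = i} = boxes f h"
      proof (intro equalityI subsetI)
        fix b assume b: "b \<in> {b \<in> boxes f g. T' b = i}"
        then have "b \<notin> boxes h g" using TD(1)[of b] True unfolding T' by auto
        moreover obtain k c where "b = (Suc k, c)" using b by (metis boxes_iff(2) mem_Collect_eq not0_implies_Suc surj_pair)
        ultimately show "b \<in> boxes f h" using b by auto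
      next
        fix b assume b: "b \<in> boxes f h"
        then obtain k c where "b = (Suc k, c)" by (metis boxes_iff(2) not0_implies_Suc surj_pair)
        then show "b \<in> {b \<in> boxes f g. T' b = i}" using b gh[of k] True unfolding T' by auto
      qed
      then show ?thesis using card_boxes(2)[OF f, of h] hf ps True by simp
    next
      case False
      have "{b \<in> boxes f g. T' b = i} = {b \<in> boxes h g. T b = i}" using sub False unfolding T' by auto
      then show ?thesis using T2[of i] i False by simp
    qed
    moreover have "layer n f g T' i = h i" for i
    proof -
      have "{c. g i < c \<and> c \<le> f i \<and> T' (Suc i, c) \<le> n} = {g i<..h i}"
        using hf[of i] TD(1)[of "(Suc i, c)" for c] unfolding T' by auto
      then show ?thesis using gh[of i] unfolding layer_def by simp
    qed
    moreover have "restrict T' (boxes h g) = T" using TD(2) unfolding T' by (auto simp: fun_eq_iff)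
    ultimately show ?thesis unfolding ctabs_def by auto
  qed

  have "\<forall>T\<in>?A. ?G (?F T) = T"
  proof
    fix T assume T: "T \<in> ctabs (Suc n) (boxes f g) \<alpha>"
    then have t: "T \<in> tabs (Suc n) (boxes f g)" unfolding ctabs_def by blast
    show "?G (?F T) = T"
    proof
      fix b
      have "b \<in> boxes f g \<Longrightarrow> b \<in> boxes (layer n f g T) g \<longleftrightarrow> T b \<le> n" "boxes (layer n f g T) g \<subseteq> boxes f g"
        using key[OF T] by blast+
      then show "?G (?F T) b = T b"
        using tabsD(1,2)[OF t, of b] by (cases "b \<in> boxes f g") auto
    qed
  qed
  moreover have "\<forall>p\<in>?B. ?F (?G p) = p" using key2 by force
  moreover have "?F ` ?A \<subseteq> ?B" using key by blast
  moreover have "?G ` ?B \<subseteq> ?A" using key2 by force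
  ultimately show ?thesis by (rule bij_betw_byWitness)
qed

text \<open>\<open>kostka\<close> peels off the largest value first, hence the reversed
  list.\<close>

lemma card_ctabs:
  assumes "ptn f" "ptn g" "\<And>i. g i \<le> f i"
  shows "int (card (ctabs n (boxes f g) \<alpha>)) = kostka f g (map \<alpha> (rev [1..<Suc n]))"
  using assms(1,3)
proof (induction n arbitrary: f)
  case 0
  have "boxes f g = {} \<longleftrightarrow> f = g"
  proof
    assume "boxes f g = {}"
    then have "\<not> (g i < f i \<and> f i \<le> f i)" for i using boxes_iff(1)[of i "f i" f g] by blast
    then show "f = g" using 0(2) by (intro ext antisym) (auto simp: not_less)
  qed (auto simp: boxes_def)
  moreover have "ctabs 0 (boxes f g) \<alpha> = (if boxes f g = {} then {\<lambda>_. undefined} else {})"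
    unfolding ctabs_def tabs_def by (auto simp: PiE_iff extensional_def)
  ultimately show ?case by simp
next
  case (Suc n)
  define H where "H = {h\<in>hstrips f (\<alpha> (Suc n)). \<forall>i. g i \<le> h i}"
  have finH: "finite H" unfolding H_def using finite_hstrips[OF Suc.prems(1)] by simp
  have Hp: "ptn h" "\<And>i. g i \<le> h i" if "h \<in> H" for h using that hstrips_ptn[OF Suc.prems(1)] unfolding H_def by auto
  have "card (ctabs (Suc n) (boxes f g) \<alpha>) = card (SIGMA h:H. ctabs n (boxes h g) \<alpha>)"
    using bij_betw_same_card[OF ctabs_Suc[OF Suc.prems(1) assms(2) Suc.prems(2)]] unfolding H_def by simp
  also have "\<dots> = (\<Sum>h\<in>H. card (ctabs n (boxes h g) \<alpha>))"
    using finH finite_tabs card_boxes(1) Hp by (intro card_SigmaI) (auto simp: ctabs_def)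
  finally have "int (card (ctabs (Suc n) (boxes f g) \<alpha>)) = (\<Sum>h\<in>H. kostka h g (map \<alpha> (rev [1..<Suc n])))"
    using Suc.IH Hp by simp
  also have "\<dots> = (\<Sum>h\<in>hstrips f (\<alpha> (Suc n)). kostka h g (map \<alpha> (rev [1..<Suc n])))"
    using finite_hstrips[OF Suc.prems(1)] kostka_nonzero[OF hstrips_ptn[OF Suc.prems(1)]]
    by (intro sum.mono_neutral_left) (auto simp: H_def simp del: kostka.simps upt_Suc)
  finally show ?case by simp
qed

section \<open>From polynomials and lists to Kostka numbers and shapes\<close>

lemma X_power: "X i ^ k = Poly_Mapping.single (Poly_Mapping.single i k) 1"
proof (induction k)
  case (Suc k)
  then show ?case by (simp add: X_def mult_single single_add[symmetric])
qed simp

lemma prod_X: "finite A \<Longrightarrow> (\<Prod>i\<in>A. X i ^ e i) = Poly_Mapping.single (\<Sum>i\<in>A. Poly_Mapping.single i (e i)) 1"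
  by (induction A rule: finite_induct) (simp_all add: X_power mult_single)

lemma lookup_exponent: "finite A \<Longrightarrow> Poly_Mapping.lookup (\<Sum>i\<in>A. Poly_Mapping.single i (e i)) j = (if j \<in> A then e j else 0)"
  by (simp add: lookup_sum lookup_single when_def)

lemma lookup_of_int_mult: "Poly_Mapping.lookup (of_int c * p) k = c * Poly_Mapping.lookup (p :: int_mpoly) k"
proof (induction c rule: int_induct[where k=0])
  case (step1 i)
  then show ?case by (simp add: distrib_right lookup_add)
next
  case (step2 i)
  then show ?case by (simp add: left_diff_distrib lookup_minus)
qed simp

definition row :: "nat list \<Rightarrow> nat \<Rightarrow> nat" where
  "row lam = (\<lambda>i. part lam (Suc i))"

lemma row_nth: "row lam i = (if i < length lam then lam ! i else 0)"
  by (auto simp: row_def Defs.part_def)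

lemma part_row: "part lam r = (if r = 0 then 0 else row lam (r - 1))"
  by (auto simp: row_def Defs.part_def)

lemma ptn_row: assumes "is_partition lam" shows "ptn (row lam)"
proof (rule ptnI[of _ "length lam"])
  show "row lam (Suc i) \<le> row lam i" for i
    using assms by (auto simp: row_nth is_partition_def sorted_wrt_iff_nth_less)
qed (simp add: row_nth)

lemma row_pos: "is_partition lam \<Longrightarrow> row lam i > 0 \<longleftrightarrow> i < length lam"
  by (auto simp: row_nth is_partition_def) (metis gr0I nth_mem)

lemma row_Nil [simp]: "row [] = emp"
  by (auto simp: row_nth)

lemma row_inj: assumes "is_partition lam" "is_partition mu" "row lam = row mu" shows "lam = mu"
proof -
  have "i < length lam \<longleftrightarrow> i < length mu" for i using row_pos assms by metis
  then have "length lam = length mu" by (meson linorder_neqE_nat less_irrefl)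
  then show ?thesis using assms(3) by (intro nth_equalityI) (auto simp: row_nth fun_eq_iff, metis)
qed

definition parts :: "shape \<Rightarrow> nat list" where
  "parts v = map v [0..<(LEAST n. v n = 0)]"

lemma parts: assumes "ptn v" shows "row (parts v) = v" "is_partition (parts v)"
proof -
  define n where "n = (LEAST n. v n = 0)"
  have "\<exists>n. v n = 0" using assms unfolding ptn_def by blast
  then have n: "v n = 0" unfolding n_def by (rule LeastI_ex)
  have pos: "v i > 0" if "i < n" for i using not_less_Least that unfolding n_def by blast
  show "row (parts v) = v"
    using n ptnD[OF assms, of n] unfolding parts_def n_def[symmetric] by (auto simp: row_nth fun_eq_iff not_less)
  have "0 \<notin> v ` {..<n}" using pos by force
  then show "is_partition (parts v)"
    using ptnD[OF assms] unfolding parts_def n_def[symmetric] is_partition_def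
    by (auto simp: sorted_wrt_iff_nth_less lessThan_atLeast0)
qed

lemma parts_row: "is_partition lam \<Longrightarrow> parts (row lam) = lam"
  using parts ptn_row row_inj by blast

lemma diagram_boxes: "diagram (lam, mu) = boxes (row lam) (row mu)"
  by (auto simp: boxes_def part_row split: if_splits)

lemma skew_partition_row: "skew_partition (lam, mu) \<longleftrightarrow> is_partition lam \<and> is_partition mu \<and> (\<forall>i. row mu i \<le> row lam i)"
proof -
  have "(\<forall>r. part mu r \<le> part lam r) \<longleftrightarrow> (\<forall>i. row mu i \<le> row lam i)"
  proof
    assume a: "\<forall>r. part mu r \<le> part lam r"
    show "\<forall>i. row mu i \<le> row lam i" unfolding row_def using a by blast
  qed (simp add: part_row)
  then show ?thesis by simp
qed

lemma lookup_skew_schur: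
  assumes "skew_partition (lam, mu)"
  shows "Poly_Mapping.lookup (skew_schur n (lam, mu)) m =
    (if Poly_Mapping.keys m \<subseteq> {1..n} then kostka (row lam) (row mu) (map (Poly_Mapping.lookup m) (rev [1..<Suc n])) else 0)"
proof -
  let ?D = "boxes (row lam) (row mu)"
  have p: "ptn (row lam)" "ptn (row mu)" "\<And>i. row mu i \<le> row lam i"
    using assms ptn_row unfolding skew_partition_row by blast+
  have D: "diagram (lam, mu) = ?D" by (rule diagram_boxes)
  have st: "ssyt n (lam, mu) = tabs n ?D" unfolding ssyt_def tabs_def D ..
  have fin: "finite (tabs n ?D)" by (rule finite_tabs[OF card_boxes(1)[OF p(1,3)]])
  have ct: "content (lam, mu) T i = card {b\<in>?D. T b = i}" for T i unfolding content_def D ..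
  let ?e = "\<lambda>T. \<Sum>i\<in>{1..n}. Poly_Mapping.single i (content (lam, mu) T i)"
  have "Poly_Mapping.lookup (skew_schur n (lam, mu)) m = (\<Sum>T\<in>tabs n ?D. of_bool (?e T = m))"
    unfolding skew_schur_def st by (simp add: prod_X lookup_sum lookup_single when_def of_bool_def) (simp add: eq_commute[of m])
  also have "\<dots> = int (card {T \<in> tabs n ?D. ?e T = m})"
    using fin by (simp add: Int_def)
  also have "{T \<in> tabs n ?D. ?e T = m}
    = (if Poly_Mapping.keys m \<subseteq> {1..n} then ctabs n ?D (Poly_Mapping.lookup m) else {})"
  proof -
    have "?e T = m \<longleftrightarrow> Poly_Mapping.keys m \<subseteq> {1..n} \<and> (\<forall>i\<in>{1..n}. content (lam, mu) T i = Poly_Mapping.lookup m i)" for T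
    proof -
      have "?e T = m \<longleftrightarrow>
        (\<forall>j. (if j \<in> {1..n} then content (lam, mu) T j else 0) = Poly_Mapping.lookup m j)"
        by (simp add: poly_mapping_eq_iff fun_eq_iff lookup_exponent)
      also have "\<dots> \<longleftrightarrow> (\<forall>j. j \<notin> {1..n} \<longrightarrow> Poly_Mapping.lookup m j = 0) \<and>
        (\<forall>i\<in>{1..n}. content (lam, mu) T i = Poly_Mapping.lookup m i)" by metis
      also have "(\<forall>j. j \<notin> {1..n} \<longrightarrow> Poly_Mapping.lookup m j = 0) \<longleftrightarrow> Poly_Mapping.keys m \<subseteq> {1..n}"
        by (meson in_keys_iff subsetD subsetI)
      finally show ?thesis .
    qed
    then show ?thesis unfolding ctabs_def ct by auto
  qed
  finally show ?thesis using card_ctabs[OF p] by simp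
qed

text \<open>Every content list is the exponent vector of a monomial in some number of variables. The
  restriction to \<open>length nu\<close> \<le> n disappears, because n strips cannot exhaust a
  first column with more than n boxes.\<close>

lemma schur_expansion_iff:
  assumes "skew_partition (lam, mu)"
  shows "schur_expansion (lam, mu) c \<longleftrightarrow> finite {nu. c nu \<noteq> 0} \<and> (\<forall>nu. c nu \<noteq> 0 \<longrightarrow> is_partition nu) \<and>
    (\<forall>as. kostka (row lam) (row mu) as = (\<Sum>nu | c nu \<noteq> 0. c nu * kostka (row nu) emp as))"
proof (cases "finite {nu. c nu \<noteq> 0} \<and> (\<forall>nu. c nu \<noteq> 0 \<longrightarrow> is_partition nu)")
  case True
  then have fin: "finite {nu. c nu \<noteq> 0}" and ip: "\<And>nu. c nu \<noteq> 0 \<Longrightarrow> is_partition nu" by auto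
  have L: "Poly_Mapping.lookup (\<Sum>nu | c nu \<noteq> 0 \<and> length nu \<le> n. of_int (c nu) * schur n nu) m =
    (if Poly_Mapping.keys m \<subseteq> {1..n} then \<Sum>nu | c nu \<noteq> 0. c nu * kostka (row nu) emp (map (Poly_Mapping.lookup m) (rev [1..<Suc n])) else 0)" for n m
  proof -
    let ?as = "map (Poly_Mapping.lookup m) (rev [1..<Suc n])"
    let ?K = "\<lambda>nu. if Poly_Mapping.keys m \<subseteq> {1..n} then kostka (row nu) emp ?as else 0"
    have "Poly_Mapping.lookup (\<Sum>nu | c nu \<noteq> 0 \<and> length nu \<le> n. of_int (c nu) * schur n nu) m
      = (\<Sum>nu | c nu \<noteq> 0 \<and> length nu \<le> n. c nu * Poly_Mapping.lookup (schur n nu) m)"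
      by (simp add: lookup_sum lookup_of_int_mult)
    also have "\<dots> = (\<Sum>nu | c nu \<noteq> 0 \<and> length nu \<le> n. c nu * ?K nu)"
    proof (intro sum.cong refl)
      fix nu assume "nu \<in> {nu. c nu \<noteq> 0 \<and> length nu \<le> n}"
      then have "skew_partition (nu, [])" using ip by (auto simp: is_partition_def Defs.part_def)
      then show "c nu * Poly_Mapping.lookup (schur n nu) m = c nu * ?K nu"
        unfolding schur_def using lookup_skew_schur[of nu "[]" n m] by simp
    qed
    also have "\<dots> = (\<Sum>nu | c nu \<noteq> 0. c nu * ?K nu)"
    proof (intro sum.mono_neutral_left ballI)
      fix nu assume nu: "nu \<in> {nu. c nu \<noteq> 0} - {nu. c nu \<noteq> 0 \<and> length nu \<le> n}"
      then have "c nu \<noteq> 0" "n < length nu" by auto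
      then have "row nu (0 + n) > 0" using ip[of nu] row_pos[of nu n] by simp
      then have "kostka (row nu) emp ?as = 0"
        using kostka_nonzero[OF ptn_row[OF ip], of nu emp ?as] nu
        by (metis (mono_tags, lifting) DiffD1 diff_Suc_1 leD length_map length_rev length_upt mem_Collect_eq)
      then show "c nu * ?K nu = 0" by simp
    qed (use fin in auto)
    finally show ?thesis by simp
  qed
  let ?E = "\<lambda>as. kostka (row lam) (row mu) as = (\<Sum>nu | c nu \<noteq> 0. c nu * kostka (row nu) emp as)"
  have "schur_expansion (lam, mu) c \<longleftrightarrow>
    (\<forall>n m. Poly_Mapping.keys m \<subseteq> {1..n} \<longrightarrow> ?E (map (Poly_Mapping.lookup m) (rev [1..<Suc n])))"
    unfolding schur_expansion_def poly_mapping_eq_iff fun_eq_iff L lookup_skew_schur[OF assms] using True by auto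
  also have "\<dots> \<longleftrightarrow> (\<forall>as. ?E as)"
  proof (intro iffI allI impI)
    fix as :: "nat list"
    assume a: "\<forall>n m. Poly_Mapping.keys m \<subseteq> {1..n} \<longrightarrow> ?E (map (Poly_Mapping.lookup m) (rev [1..<Suc n]))"
    define n where "n = length as"
    \<comment> \<open>Content lists run through the variables from x_n down to x_1, so x_i gets the
      entry at position n - i.\<close>
    define m where "m = (\<Sum>i\<in>{1..n}. Poly_Mapping.single i (as ! (n - i)))"
    have lm: "Poly_Mapping.lookup m j = (if j \<in> {1..n} then as ! (n - j) else 0)" for j
      unfolding m_def by (rule lookup_exponent) simp
    have k: "Poly_Mapping.keys m \<subseteq> {1..n}" by (auto simp: in_keys_iff lm split: if_splits)
    have "map (Poly_Mapping.lookup m) (rev [1..<Suc n]) = as"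
    proof (rule nth_equalityI)
      fix i assume "i < length (map (Poly_Mapping.lookup m) (rev [1..<Suc n]))"
      then have "i < n" by (simp del: upt_Suc)
      then have "rev [1..<Suc n] ! i = n - i" by (simp add: rev_nth del: upt_Suc)
      then show "map (Poly_Mapping.lookup m) (rev [1..<Suc n]) ! i = as ! i"
        using \<open>i < n\<close> Suc_leI[of 0 "n - i"] by (simp add: lm del: upt_Suc)
    qed (simp add: n_def del: upt_Suc)
    then show "?E as"
      using a[rule_format, OF k] by simp
  qed blast
  finally show ?thesis using True by blast
qed (auto simp: schur_expansion_def)

text \<open>\<open>row\<close> and \<open>parts\<close> are inverse to each other between partition
  lists and shapes. Uniqueness for \<open>THE\<close> comes from moving an arbitrary Schur expansion
  to shapes, where \<open>lr_num_eqI\<close> identifies it.\<close>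

lemma lr_coeff_lr_num:
  assumes "skew_partition (lam, mu)"
  shows "lr_coeff (lam, mu) = (\<lambda>nu. if is_partition nu then lr_num (row lam) (row mu) (row nu) else 0)"
  unfolding lr_coeff_def
proof (rule the_equality)
  let ?f = "row lam" and ?g = "row mu"
  have pf: "ptn ?f" using assms ptn_row by simp
  let ?c = "\<lambda>nu. if is_partition nu then lr_num ?f ?g (row nu) else 0"
  have supp: "{nu. ?c nu \<noteq> 0} = parts ` {v. lr_num ?f ?g v \<noteq> 0}"
  proof (intro equalityI subsetI)
    fix nu assume "nu \<in> {nu. ?c nu \<noteq> 0}"
    then show "nu \<in> parts ` {v. lr_num ?f ?g v \<noteq> 0}"
      by (intro image_eqI[of _ _ "row nu"]) (auto simp: parts_row split: if_splits)
  next
    fix nu assume "nu \<in> parts ` {v. lr_num ?f ?g v \<noteq> 0}"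
    then show "nu \<in> {nu. ?c nu \<noteq> 0}" using parts lr_numD(2)[OF pf] by auto
  qed
  have inj: "inj_on parts {v. lr_num ?f ?g v \<noteq> 0}"
    by (rule inj_on_inverseI[of _ row]) (use parts lr_numD(2)[OF pf] in auto)
  have "?c (parts v) = lr_num ?f ?g v" "row (parts v) = v" if "lr_num ?f ?g v \<noteq> 0" for v
    using parts lr_numD(2)[OF pf that] by auto
  then have "kostka ?f ?g as = (\<Sum>nu | ?c nu \<noteq> 0. ?c nu * kostka (row nu) emp as)" for as
    unfolding supp sum.reindex[OF inj] lr_numD(3)[OF pf, of ?g as] by (intro sum.cong) auto
  then show "schur_expansion (lam, mu) ?c"
    unfolding schur_expansion_iff[OF assms] using lr_numD(1)[OF pf, of ?g] supp by auto
  fix c assume "schur_expansion (lam, mu) c"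
  then have fin: "finite {nu. c nu \<noteq> 0}" and ip: "\<And>nu. c nu \<noteq> 0 \<Longrightarrow> is_partition nu"
    and K: "\<And>as. kostka ?f ?g as = (\<Sum>nu | c nu \<noteq> 0. c nu * kostka (row nu) emp as)"
    unfolding schur_expansion_iff[OF assms] by auto
  define d where "d = (\<lambda>v. if ptn v then c (parts v) else 0)"
  have suppd: "{v. d v \<noteq> 0} = row ` {nu. c nu \<noteq> 0}"
  proof (intro equalityI subsetI)
    fix v assume "v \<in> {v. d v \<noteq> 0}"
    then show "v \<in> row ` {nu. c nu \<noteq> 0}"
      by (intro image_eqI[of _ _ "parts v"]) (auto simp: parts d_def split: if_splits)
  next
    fix v assume "v \<in> row ` {nu. c nu \<noteq> 0}"
    then show "v \<in> {v. d v \<noteq> 0}" using ip ptn_row parts_row by (auto simp: d_def)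
  qed
  have "is_lr ?f ?g d" unfolding is_lr_def
  proof (intro conjI allI impI)
    show "finite {v. d v \<noteq> 0}" unfolding suppd using fin by simp
    show "\<And>v. d v \<noteq> 0 \<Longrightarrow> ptn v" by (auto simp: d_def split: if_splits)
    fix as
    have "inj_on row {nu. c nu \<noteq> 0}" using row_inj ip by (auto intro!: inj_onI)
    then show "kostka ?f ?g as = (\<Sum>v | d v \<noteq> 0. d v * kostka v emp as)"
      unfolding suppd K using ip ptn_row parts_row by (subst sum.reindex) (auto simp: d_def intro!: sum.cong)
  qed
  then have "lr_num ?f ?g = d" by (rule lr_num_eqI)
  then have "?c nu = (if is_partition nu then d (row nu) else 0)" for nu by simp
  also have "(if is_partition nu then d (row nu) else 0) = c nu" for nu
    using ip[of nu] ptn_row[of nu] parts_row[of nu] by (auto simp: d_def)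
  finally show "c = ?c" by auto
qed

lemma multiplicity_free_mfree:
  assumes "skew_partition (lam, mu)"
  shows "multiplicity_free n (lam, mu) \<longleftrightarrow> mfree n (row lam) (row mu)"
proof
  assume m: "multiplicity_free n (lam, mu)"
  show "mfree n (row lam) (row mu)" unfolding mfree_def
  proof (intro allI impI)
    fix v assume v: "ptn v \<and> v n = 0"
    then have "length (parts v) \<le> n" using row_pos[of "parts v" n] parts[of v] by (metis less_irrefl not_le)
    then have "lr_coeff (lam, mu) (parts v) \<in> {0, 1}" using m v parts unfolding multiplicity_free_def by blast
    then show "lr_num (row lam) (row mu) v \<in> {0, 1}" using v parts unfolding lr_coeff_lr_num[OF assms] by simp
  qed
next
  assume m: "mfree n (row lam) (row mu)"
  show "multiplicity_free n (lam, mu)" unfolding multiplicity_free_def lr_coeff_lr_num[OF assms]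
  proof (intro allI impI)
    fix nu assume nu: "is_partition nu \<and> length nu \<le> n"
    then have "row nu n = 0" using row_pos[of nu n] by simp
    then show "(if is_partition nu then lr_num (row lam) (row mu) (row nu) else 0) \<in> {0, 1}"
      using m nu ptn_row unfolding mfree_def by simp
  qed
qed

section \<open>The demolitions\<close>

lemma row_Cons: "row (x # xs) = cons x (row xs)"
  by (auto simp: row_nth fun_eq_iff split: nat.split)

text \<open>The zeros of a weakly decreasing list stand at its end, so dropping them moves no
  row.\<close>

lemma row_filter:
  assumes "sorted_wrt (\<ge>) xs"
  shows "row (filter (\<lambda>x. x > 0) xs) = row xs" "is_partition (filter (\<lambda>x. x > 0) xs)"
proof -
  show "row (filter (\<lambda>x. x > 0) xs) = row xs" using assms
  proof (induction xs)
    case (Cons x xs)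
    show ?case
    proof (cases "x > 0")
      case True
      then show ?thesis using Cons by (simp add: row_Cons)
    next
      case False
      then have z: "\<forall>y\<in>set (x # xs). y = 0" using Cons.prems by auto
      then have "filter (\<lambda>x. x > 0) (x # xs) = []" by (simp add: filter_empty_conv)
      moreover have "row (x # xs) = emp" using z by (metis (no_types, lifting) ext nth_mem row_nth)
      ultimately show ?thesis by simp
    qed
  qed simp
  show "is_partition (filter (\<lambda>x. x > 0) xs)"
    using sorted_wrt_filter[OF assms] by (simp add: is_partition_def)
qed

lemma row_delete_cols:
  assumes "is_partition lam"
  shows "row (delete_cols K lam) = dcols K (row lam)" "is_partition (delete_cols K lam)"
proof -
  let ?g = "\<lambda>x. card ({1..x} - K)"
  have "sorted_wrt (\<ge>) (map ?g lam)"
    using assms unfolding is_partition_def sorted_wrt_map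
    by (auto elim!: sorted_wrt_mono_rel[rotated] intro!: card_mono)
  note * = row_filter[OF this]
  show "is_partition (delete_cols K lam)" using *(2) unfolding delete_cols_def .
  show "row (delete_cols K lam) = dcols K (row lam)"
    using *(1) unfolding delete_cols_def by (auto simp: row_nth dcols_def fun_eq_iff)
qed

lemma row_nths: "strict_mono e \<Longrightarrow> row (nths lam (range e)) = row lam \<circ> e"
proof (induction lam arbitrary: e)
  case (Cons x xs)
  have e: "e i < e j \<longleftrightarrow> i < j" for i j by (rule strict_mono_less[OF Cons.prems])
  show ?case
  proof (cases "0 \<in> range e")
    case True
    then have e0: "e 0 = 0" using strict_mono_imp_increasing[OF Cons.prems] e by (metis gr_zeroI less_nat_zero_code rangeE)
    define e' where "e' = (\<lambda>j. e (Suc j) - 1)"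
    have pos: "e (Suc j) > 0" for j using e[of 0 "Suc j"] by simp
    have e': "e (Suc j) = Suc (e' j)" for j using pos[of j] by (simp add: e'_def)
    have sm: "strict_mono e'" using e e' by (intro strict_monoI) (metis Suc_less_eq)
    have "{j. Suc j \<in> range e} = range e'"
      using e' e0 by (auto simp: image_iff) (metis nat.distinct(1) nat.inject not0_implies_Suc)+
    then have "nths (x # xs) (range e) = x # nths xs (range e')" using True by (simp add: nths_Cons)
    then show ?thesis using Cons.IH[OF sm] e0 e' by (auto simp: row_Cons fun_eq_iff split: nat.split)
  next
    case False
    define e' where "e' = (\<lambda>j. e j - 1)"
    have e': "e j = Suc (e' j)" for j using False by (metis Suc_pred' e'_def gr0I rangeI)
    have sm: "strict_mono e'" using e e' by (intro strict_monoI) (metis Suc_less_eq)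
    have "{j. Suc j \<in> range e} = range e'" using e' by (auto simp: image_iff)
    then have "nths (x # xs) (range e) = nths xs (range e')" using False by (simp add: nths_Cons)
    then show ?thesis using Cons.IH[OF sm] e' by (simp add: row_Cons fun_eq_iff)
  qed
qed (simp add: comp_def)

lemma sorted_wrt_nths: "sorted_wrt P xs \<Longrightarrow> sorted_wrt P (nths xs I)"
proof (induction xs arbitrary: I)
  case (Cons x xs)
  then show ?case using set_nths_subset[of xs "{j. Suc j \<in> I}"] by (auto simp: nths_Cons)
qed simp

lemma is_partition_nths: "is_partition lam \<Longrightarrow> is_partition (nths lam I)"
  unfolding is_partition_def using sorted_wrt_nths[of "(\<ge>)" lam I] set_nths_subset[of lam I] by auto

text \<open>Only finitely many row indices are removed, so the kept ones are infinite in number and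
  have a total increasing enumeration.\<close>

lemma delete_rows_exists:
  assumes "finite R" "0 \<notin> R"
  shows "\<exists>e. strict_mono e \<and> range e = {i. Suc i \<notin> R} \<and> (\<forall>lam. row (delete_rows R lam) = row lam \<circ> e)"
proof -
  define I where "I = {i. Suc i \<notin> R}"
  have "finite (- I)"
  proof (rule finite_subset)
    show "- I \<subseteq> (\<lambda>r. r - 1) ` R" unfolding I_def by force
  qed (use assms in simp)
  then have inf: "infinite I" by (metis Compl_eq_Diff_UNIV Diff_infinite_finite finite_Diff2 infinite_UNIV_nat)
  have r: "range (enumerate I) = I" by (rule range_enumerate[OF inf])
  have s: "strict_mono (enumerate I)" by (rule strict_mono_enumerate[OF inf])
  then show ?thesis using row_nths[OF s] r unfolding delete_rows_def I_def by (intro exI[of _ "enumerate I"]) (simp add: I_def)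
qed

section \<open>Column numbers after deletion; sharp demolition\<close>

text \<open>For a kept column x this is its new number once the columns in A are gone; for a row
  length it is the new length.\<close>

definition pos :: "nat set \<Rightarrow> nat \<Rightarrow> nat" where
  "pos A x = card ({1..x} - A)"

lemma dcols_pos: "dcols A f i = pos A (f i)"
  by (simp add: dcols_def pos_def)

lemma pos_0 [simp]: "pos A 0 = 0"
  by (simp add: pos_def)

lemma pos_mono: "x \<le> y \<Longrightarrow> pos A x \<le> pos A y"
  unfolding pos_def by (intro card_mono) auto

lemma pos_Suc: "pos A (Suc x) = (if Suc x \<in> A then pos A x else Suc (pos A x))"
proof -
  have "{1..Suc x} - A = (if Suc x \<in> A then {1..x} - A else insert (Suc x) ({1..x} - A))"
    by (auto simp: le_Suc_eq)
  then show ?thesis unfolding pos_def by simp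
qed

lemma pos_le_iff: assumes "c \<notin> A" "c > 0" shows "pos A c \<le> pos A x \<longleftrightarrow> c \<le> x"
proof
  assume le: "pos A c \<le> pos A x"
  show "c \<le> x"
  proof (rule ccontr)
    assume "\<not> c \<le> x"
    then have "pos A x \<le> pos A (c - 1)" by (intro pos_mono) simp
    moreover have "pos A c = Suc (pos A (c - 1))" using pos_Suc[of A "c - 1"] assms by simp
    ultimately show False using le by simp
  qed
qed (rule pos_mono)

lemma pos_surj: assumes "c' > 0" "c' \<le> pos A x" shows "\<exists>c. 0 < c \<and> c \<le> x \<and> c \<notin> A \<and> pos A c = c'"
  using assms(2)
proof (induction x)
  case (Suc x)
  show ?case
  proof (cases "c' \<le> pos A x")
    case True
    then show ?thesis using Suc.IH le_SucI by blast
  next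
    case False
    then have "Suc x \<notin> A" "pos A (Suc x) = c'" using Suc.prems pos_Suc[of A x] by (auto split: if_splits)
    then show ?thesis by blast
  qed
qed (use assms(1) in simp)

definition basicf :: "shape \<Rightarrow> shape \<Rightarrow> bool" where
  "basicf f g \<longleftrightarrow> (\<forall>i. f i > 0 \<longrightarrow> g i < f i) \<and> (\<forall>c. 0 < c \<and> c \<le> f 0 \<longrightarrow> (\<exists>i. g i < c \<and> c \<le> f i))"

definition height :: "shape \<Rightarrow> shape \<Rightarrow> nat \<Rightarrow> nat" where
  "height f g c = card {i. g i < c \<and> c \<le> f i}"

lemma CS_height: "CS c (lam, mu) = height (row lam) (row mu) c"
proof -
  have "{r. (r, c) \<in> diagram (lam, mu)} = Suc ` {i. row mu i < c \<and> c \<le> row lam i}"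
    unfolding diagram_boxes by (auto simp: boxes_def image_iff) (metis Suc_pred diff_Suc_1)
  then show ?thesis unfolding CS_def height_def by (simp add: card_image)
qed

lemma cols_row: "cols (lam, mu) = {c. 0 < c \<and> c \<le> row lam 0}"
  by (auto simp: row_def)

lemma sharp_height: "sharp n (lam, mu) \<longleftrightarrow> (\<forall>c. 0 < c \<and> c \<le> row lam 0 \<longrightarrow> height (row lam) (row mu) c < n)"
  unfolding sharp_def cols_row CS_height by blast

lemma empty_rows_row: "empty_rows (lam, mu) = Suc ` {i. i < length lam \<and> row lam i \<le> row mu i}"
  unfolding empty_rows_def diagram_boxes
proof (intro equalityI subsetI)
  fix r assume r: "r \<in> {r \<in> rows (lam, mu). \<forall>c. (r, c) \<notin> boxes (row lam) (row mu)}"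
  then obtain i where i: "r = Suc i" "i < length lam" by (cases r) auto
  then have "(Suc i, row lam i) \<notin> boxes (row lam) (row mu)" using r by blast
  then show "r \<in> Suc ` {i. i < length lam \<and> row lam i \<le> row mu i}" using i by auto
qed auto

lemma empty_cols_row: "empty_cols (lam, mu) =
  {c. 0 < c \<and> c \<le> row lam 0 \<and> (\<forall>i. \<not> (row mu i < c \<and> c \<le> row lam i))}"
  unfolding empty_cols_def diagram_boxes cols_row
proof (intro Collect_cong)
  fix c
  have "(\<forall>r. (r, c) \<notin> boxes (row lam) (row mu)) \<longleftrightarrow> (\<forall>i. (Suc i, c) \<notin> boxes (row lam) (row mu))"
    by (metis boxes_iff(2) not0_implies_Suc)
  then show "c \<in> {c. 0 < c \<and> c \<le> row lam 0} \<and> (\<forall>r. (r, c) \<notin> boxes (row lam) (row mu)) \<longleftrightarrow>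
    0 < c \<and> c \<le> row lam 0 \<and> (\<forall>i. \<not> (row mu i < c \<and> c \<le> row lam i))" by simp
qed

lemma basic_row: assumes "is_partition lam" shows "basic (lam, mu) \<longleftrightarrow> basicf (row lam) (row mu)"
proof -
  have "empty_rows (lam, mu) = {} \<longleftrightarrow> (\<forall>i. row lam i > 0 \<longrightarrow> row mu i < row lam i)"
    unfolding empty_rows_row row_pos[OF assms] by (auto simp: not_le)
  moreover have "empty_cols (lam, mu) = {} \<longleftrightarrow>
    (\<forall>c. 0 < c \<and> c \<le> row lam 0 \<longrightarrow> (\<exists>i. row mu i < c \<and> c \<le> row lam i))"
    unfolding empty_cols_row by blast
  ultimately show ?thesis unfolding basic_def basicf_def by blast
qed

text \<open>\<open>pos K\<close> increases strictly at a kept column, so the column has boxes in the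
  same rows before and after.\<close>

lemma dcols_box:
  assumes "c \<notin> K" "c > 0"
  shows "dcols K g i < pos K c \<and> pos K c \<le> dcols K f i \<longleftrightarrow> g i < c \<and> c \<le> f i"
  using pos_le_iff[OF assms, of "g i"] pos_le_iff[OF assms, of "f i"] unfolding dcols_pos by auto

lemma height_dcols: "c \<notin> K \<Longrightarrow> c > 0 \<Longrightarrow> height (dcols K f) (dcols K g) (pos K c) = height f g c"
  unfolding height_def by (simp add: dcols_box)

text \<open>Kept columns keep their heights, and every new column comes from a kept one, whose
  height is at most n and different from n.\<close>

lemma sharp_demolition:
  assumes S: "skew_partition (lam, mu)" and n: "n > 0"
    and le: "\<And>k. k \<in> cols (lam, mu) \<Longrightarrow> CS k (lam, mu) \<le> n"
  shows "\<exists>lam' mu'. sharp_demolition n (lam, mu) = (lam', mu') \<and> skew_partition (lam', mu') \<and> sharp n (lam', mu')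
    \<and> (multiplicity_free n (lam, mu) \<longleftrightarrow> multiplicity_free n (lam', mu'))"
proof -
  define K where "K = {k \<in> cols (lam, mu). CS k (lam, mu) = n}"
  have P: "is_partition lam" "is_partition mu" "\<And>i. row mu i \<le> row lam i" using S unfolding skew_partition_row by auto
  have eq: "sharp_demolition n (lam, mu) = (delete_cols K lam, delete_cols K mu)"
    using le unfolding K_def by (auto simp: Let_def not_le[symmetric] simp del: cols.simps)
  have S': "skew_partition (delete_cols K lam, delete_cols K mu)"
    unfolding skew_partition_row using row_delete_cols P by (simp add: dcols_pos pos_mono)
  have sh: "sharp n (delete_cols K lam, delete_cols K mu)"
    unfolding sharp_height row_delete_cols[OF P(1)] row_delete_cols[OF P(2)]
  proof (intro allI impI)
    fix c' assume "0 < c' \<and> c' \<le> dcols K (row lam) 0"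
    then obtain c where c: "0 < c" "c \<le> row lam 0" "c \<notin> K" "pos K c = c'"
      using pos_surj unfolding dcols_pos by blast
    have "height (row lam) (row mu) c < n"
    proof -
      have cc: "c \<in> cols (lam, mu)" using c unfolding cols_row by simp
      then have "CS c (lam, mu) \<noteq> n" using c(3) unfolding K_def by blast
      then show ?thesis using le[OF cc] unfolding CS_height by linarith
    qed
    then show "height (dcols K (row lam)) (dcols K (row mu)) c' < n" using height_dcols c by metis
  qed
  have "mfree n (row lam) (row mu) \<longleftrightarrow> mfree n (dcols K (row lam)) (dcols K (row mu))"
  proof (rule mfree_full_columns)
    show "finite K" by (rule finite_subset[of _ "{..row lam 0}"]) (auto simp: K_def cols_row simp del: cols.simps)
    show "\<And>c. c \<in> K \<Longrightarrow> c > 0 \<and> card {i. row mu i < c \<and> c \<le> row lam i} = n"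
      unfolding K_def CS_height height_def cols_row by blast
  qed (use P ptn_row in auto)
  then show ?thesis
    using eq S' sh by (simp add: multiplicity_free_mfree[OF S] multiplicity_free_mfree[OF S'] row_delete_cols P)
qed

section \<open>Basic demolition\<close>

text \<open>Rows beyond \<open>length lam\<close> count as kept, so that e is defined on all
  indices.\<close>

lemma basic_demolition_row:
  assumes S: "skew_partition (lam, mu)"
  shows "\<exists>lam' mu' K e. basic_demolition (lam, mu) = (lam', mu') \<and> is_partition lam' \<and> is_partition mu' \<and>
    row lam' = dcols K (row lam \<circ> e) \<and> row mu' = dcols K (row mu \<circ> e) \<and> strict_mono e \<and>
    range e = {i. \<not> (i < length lam \<and> row lam i \<le> row mu i)} \<and>
    K = {c. 0 < c \<and> c \<le> row lam 0 \<and> (\<forall>i. \<not> (row mu i < c \<and> c \<le> row lam i))}"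
proof -
  define R where "R = empty_rows (lam, mu)"
  define K where "K = empty_cols (lam, mu)"
  have P: "is_partition lam" "is_partition mu" using S by auto
  have "finite R" "0 \<notin> R" unfolding R_def empty_rows_row by auto
  then obtain e where e: "strict_mono e" "range e = {i. Suc i \<notin> R}" "\<And>lam. row (delete_rows R lam) = row lam \<circ> e"
    using delete_rows_exists[of R] by metis
  have "range e = {i. \<not> (i < length lam \<and> row lam i \<le> row mu i)}"
    unfolding e(2) R_def empty_rows_row by auto
  moreover have "is_partition (delete_rows R x)" if "is_partition x" for x
    unfolding delete_rows_def by (rule is_partition_nths[OF that])
  moreover have "basic_demolition (lam, mu) = (delete_cols K (delete_rows R lam), delete_cols K (delete_rows R mu))"
    by (simp add: R_def K_def Let_def)
  moreover have "K = {c. 0 < c \<and> c \<le> row lam 0 \<and> (\<forall>i. \<not> (row mu i < c \<and> c \<le> row lam i))}"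
    unfolding K_def by (rule empty_cols_row)
  ultimately show ?thesis
    by (intro exI[of _ "delete_cols K (delete_rows R lam)"] exI[of _ "delete_cols K (delete_rows R mu)"]
        exI[of _ K] exI[of _ e] conjI) (simp_all only: row_delete_cols P e(1,3))
qed

text \<open>Each row with a box is kept, so a kept column loses no box. The Kostka numbers agree by
  \<open>kostka_comp\<close> for the rows and \<open>kostka_empty_columns\<close> for the
  columns.\<close>

lemma basic_demolition:
  assumes S: "skew_partition (lam, mu)" and B: "basic_demolition (lam, mu) = (lam', mu')"
  shows "skew_partition (lam', mu')" "basic (lam', mu')" "sharp n (lam, mu) \<Longrightarrow> sharp n (lam', mu')"
    "multiplicity_free n (lam, mu) \<longleftrightarrow> multiplicity_free n (lam', mu')"
proof -
  define f where "f = row lam"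
  define g where "g = row mu"
  obtain K e where ke: "is_partition lam'" "is_partition mu'"
    "row lam' = dcols K (f \<circ> e)" "row mu' = dcols K (g \<circ> e)" "strict_mono e"
    "range e = {i. \<not> (i < length lam \<and> f i \<le> g i)}"
    and K: "K = {c. 0 < c \<and> c \<le> f 0 \<and> (\<forall>i. \<not> (g i < c \<and> c \<le> f i))}"
    using basic_demolition_row[OF S] B unfolding f_def g_def by auto
  have P: "is_partition lam" "is_partition mu" and gf: "\<And>i. g i \<le> f i"
    using S unfolding skew_partition_row f_def g_def by auto
  have pf: "ptn f" "ptn g" using ptn_row P unfolding f_def g_def by auto
  have box: "\<exists>j. i = e j" if "g i < f i" for i using ke(6) that by (metis (mono_tags, lifting) mem_Collect_eq not_le rangeE)
  have off: "f i = g i" if "i \<notin> range e" for i using that gf[of i] unfolding ke(6) by simp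
  have inj: "inj e" using ke(5) by (rule strict_mono_imp_inj_on)
  have e0: "f (e j) \<le> f 0" for j by (rule ptnD[OF pf(1)]) simp
  show S': "skew_partition (lam', mu')"
    unfolding skew_partition_row ke(3,4) using ke(1,2) gf by (simp add: dcols_pos pos_mono)
  have col: "\<exists>c. 0 < c \<and> c \<le> f 0 \<and> c \<notin> K \<and> pos K c = c'" if c': "0 < c'" "c' \<le> dcols K (f \<circ> e) 0" for c'
  proof -
    obtain c where c: "0 < c \<and> c \<le> f (e 0) \<and> c \<notin> K \<and> pos K c = c'"
      using pos_surj[OF c'(1), of K "f (e 0)"] c'(2) unfolding dcols_pos by auto
    then show ?thesis using e0[of 0] by (intro exI[of _ c]) auto
  qed
  show "basic (lam', mu')" unfolding basic_row[OF ke(1)] basicf_def ke(3,4)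
  proof (intro conjI allI impI)
    fix j assume p: "0 < dcols K (f \<circ> e) j"
    then have "f (e j) > 0" unfolding dcols_pos by (auto intro: gr0I)
    moreover have "e j < length lam" using \<open>f (e j) > 0\<close> unfolding f_def row_nth by (auto split: if_splits)
    ultimately have "g (e j) < f (e j)" using ke(6) by (metis (mono_tags, lifting) mem_Collect_eq not_le rangeI)
    then have "f (e j) \<notin> K" unfolding K by auto
    then show "dcols K (g \<circ> e) j < dcols K (f \<circ> e) j"
      using dcols_box[of "f (e j)" K "g \<circ> e" j "f \<circ> e"] \<open>g (e j) < f (e j)\<close> \<open>f (e j) > 0\<close> by (simp add: dcols_pos)
  next
    fix c' assume "0 < c' \<and> c' \<le> dcols K (f \<circ> e) 0"
    then obtain c where c: "0 < c" "c \<le> f 0" "c \<notin> K" "pos K c = c'" using col by blast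
    then obtain i where i: "g i < c" "c \<le> f i" unfolding K by auto
    then obtain j where j: "i = e j" using box[of i] by auto
    have "dcols K (g \<circ> e) j < pos K c \<and> pos K c \<le> dcols K (f \<circ> e) j"
      using dcols_box[OF c(3,1), of "g \<circ> e" j "f \<circ> e"] i j by simp
    then show "\<exists>i. dcols K (g \<circ> e) i < c' \<and> c' \<le> dcols K (f \<circ> e) i" using c by auto
  qed
  show "sharp n (lam', mu')" if sh: "sharp n (lam, mu)" unfolding sharp_height ke(3,4)
  proof (intro allI impI)
    fix c' assume "0 < c' \<and> c' \<le> dcols K (f \<circ> e) 0"
    then obtain c where c: "0 < c" "c \<le> f 0" "c \<notin> K" "pos K c = c'" using col by blast
    have "{i. g i < c \<and> c \<le> f i} = e ` {j. g (e j) < c \<and> c \<le> f (e j)}"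
    proof (intro equalityI subsetI)
      fix i assume i: "i \<in> {i. g i < c \<and> c \<le> f i}"
      then obtain j where "i = e j" using box[of i] by auto
      then show "i \<in> e ` {j. g (e j) < c \<and> c \<le> f (e j)}" using i by blast
    qed auto
    then have "height f g c = height (f \<circ> e) (g \<circ> e) c"
      unfolding height_def by (simp add: card_image inj_on_subset[OF inj])
    then show "height (dcols K (f \<circ> e)) (dcols K (g \<circ> e)) c' < n"
      using sh c height_dcols[OF c(3,1), of "f \<circ> e" "g \<circ> e"]
      unfolding sharp_height f_def[symmetric] g_def[symmetric] by metis
  qed
  have "kostka f g as = kostka (dcols K (f \<circ> e)) (dcols K (g \<circ> e)) as" for as
  proof -
    have "kostka f g as = kostka (f \<circ> e) (g \<circ> e) as" by (rule kostka_comp[OF pf ke(5) off])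
    also have "\<dots> = kostka (dcols K (f \<circ> e)) (dcols K (g \<circ> e)) as"
    proof (rule kostka_empty_columns)
      show "finite K" unfolding K by (rule finite_subset[of _ "{..f 0}"]) auto
      show "\<And>c. c \<in> K \<Longrightarrow> 0 < c \<and> (\<forall>i. \<not> ((g \<circ> e) i < c \<and> c \<le> (f \<circ> e) i))" unfolding K by simp
    qed (use ptn_comp pf ke gf in auto)
    finally show ?thesis .
  qed
  then have "lr_num f g = lr_num (dcols K (f \<circ> e)) (dcols K (g \<circ> e))" by (rule lr_num_cong)
  then show "multiplicity_free n (lam, mu) \<longleftrightarrow> multiplicity_free n (lam', mu')"
    unfolding multiplicity_free_mfree[OF S] multiplicity_free_mfree[OF S'] ke(3,4) mfree_def f_def g_def by simp
qed

lemma basic_demolition_basic: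
  assumes "skew_partition (lam, mu)" "basic (lam, mu)"
  shows "basic_demolition (lam, mu) = (lam, mu)"
proof -
  have "delete_cols {} x = x" if "is_partition x" for x
    using that unfolding delete_cols_def is_partition_def by (simp add: filter_id_conv) (metis gr0I)
  moreover have "delete_rows {} x = x" for x unfolding delete_rows_def by (simp add: nths_all)
  ultimately show ?thesis using assms unfolding basic_def by simp
qed

section \<open>Tight demolition\<close>

lemma row_image: "row lam ` {..<length lam} = set lam"
proof -
  have "row lam ` {..<length lam} = (!) lam ` {..<length lam}" by (intro image_cong) (auto simp: row_nth)
  also have "\<dots> = set lam" by (auto simp: set_conv_nth)
  finally show ?thesis .
qed

lemma count_hd:
  assumes "is_partition lam" "lam \<noteq> []"
  shows "row lam i = row lam 0 \<longleftrightarrow> i < count_list lam (hd lam)"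
proof -
  let ?f = "row lam"
  have p: "ptn ?f" by (rule ptn_row[OF assms(1)])
  have f0: "?f 0 = hd lam" "?f 0 > 0" using assms row_pos[OF assms(1), of 0] by (auto simp: row_nth hd_conv_nth)
  obtain q where q: "\<forall>i. ?f 0 \<le> ?f i \<longleftrightarrow> i < q" using ptn_conj[OF p f0(2)] by blast
  have eq: "?f i = ?f 0 \<longleftrightarrow> i < q" for i using q ptnD[OF p, of 0 i] by (metis antisym le0 le_refl)
  have "{i. i < length lam \<and> lam ! i = hd lam} = {..<q}"
  proof (intro equalityI subsetI)
    fix i assume "i \<in> {i. i < length lam \<and> lam ! i = hd lam}"
    then have "?f i = ?f 0" using f0 by (simp add: row_nth)
    then show "i \<in> {..<q}" using eq by simp
  next
    fix i assume "i \<in> {..<q}"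
    then have "?f i = ?f 0" using eq by simp
    then show "i \<in> {i. i < length lam \<and> lam ! i = hd lam}" using f0 by (auto simp: row_nth split: if_splits)
  qed
  moreover have "count_list lam (hd lam) = card {i. i < length lam \<and> lam ! i = hd lam}"
    by (simp add: count_list_eq_length_filter length_filter_conv_card eq_commute)
  ultimately show ?thesis using eq by simp
qed

lemma row_last: "lam \<noteq> [] \<Longrightarrow> row lam (length lam - 1) = last lam"
  by (simp add: row_nth last_conv_nth)

lemma row_hd: "lam \<noteq> [] \<Longrightarrow> row lam 0 = hd lam"
  by (simp add: row_nth hd_conv_nth)

lemma skew_nonempty: assumes "skew_partition (lam, mu)" "mu \<noteq> []" shows "lam \<noteq> []"
proof
  assume "lam = []"
  then have "row mu 0 \<le> 0" using assms(1) unfolding skew_partition_row by (metis row_Nil)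
  then show False using assms row_pos[of mu 0] unfolding skew_partition_row by auto
qed

text \<open>The row with index \<open>length mu\<close> is the first one free of \<open>mu\<close>;
  the condition says that no row of the diagram meets all columns.\<close>

lemma tau_0_iff:
  assumes "skew_partition (lam, mu)" "mu \<noteq> []" "\<not> rectangle lam"
  shows "tau (lam, mu) = 0 \<longleftrightarrow> row lam (length mu) \<noteq> row lam 0"
  using count_hd[of lam "length mu"] skew_nonempty[OF assms(1,2)] assms by auto

text \<open>The column after the first part of \<open>mu\<close> is the first one free of
  \<open>mu\<close>; the condition says that no column of the diagram meets all rows.\<close>

lemma sigma_0_iff:
  assumes "skew_partition (lam, mu)" "mu \<noteq> []" "\<not> rectangle lam"
  shows "sigma (lam, mu) = 0 \<longleftrightarrow> row lam (length lam - 1) \<le> row mu 0"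
  using row_last[OF skew_nonempty[OF assms(1,2)]] row_hd[OF assms(2)] assms by auto

lemma length_le: "is_partition lam \<Longrightarrow> row lam n = 0 \<Longrightarrow> length lam \<le> n"
  using row_pos[of lam n] by simp

lemma row_length [simp]: "row lam (length lam) = 0"
  by (simp add: row_nth)

text \<open>The first and last rows have boxes and survive, and with them column 1 and the last
  column. A row of the result that meets all columns would have met column 1 and the last column
  before; likewise the old last row still exceeds nothing beyond the first part of the new
  \<open>mu\<close>. So deletion creates no full row or column.\<close>

lemma basic_demolition_tight:
  assumes S: "skew_partition (lam, mu)" and B: "basic_demolition (lam, mu) = (lam', mu')"
    and row: "row mu 0 < row lam 0" and col: "lam \<noteq> []" "row mu (length lam - 1) = 0"
    and no_row: "row lam (length mu) < row lam 0"
    and no_col: "row lam (length lam - 1) \<le> row mu 0"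
  shows "tau (lam', mu') = 0" "sigma (lam', mu') = 0"
proof -
  define f where "f = row lam"
  define g where "g = row mu"
  obtain K e where ke: "is_partition lam'" "is_partition mu'"
    "row lam' = dcols K (f \<circ> e)" "row mu' = dcols K (g \<circ> e)" "strict_mono e"
    "range e = {i. \<not> (i < length lam \<and> f i \<le> g i)}"
    and K: "K = {c. 0 < c \<and> c \<le> f 0 \<and> (\<forall>i. \<not> (g i < c \<and> c \<le> f i))}"
    using basic_demolition_row[OF S] B unfolding f_def g_def by auto
  have P: "is_partition lam" "is_partition mu" using S by auto
  have pf: "ptn f" "ptn g" using ptn_row P unfolding f_def g_def by auto
  have S': "skew_partition (lam', mu')" by (rule basic_demolition(1)[OF S B])
  have pf': "ptn (row lam')" "ptn (row mu')" using S' ptn_row by auto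
  let ?b = "length lam - 1"
  have fb: "f ?b > 0" "g ?b = 0" using row_pos[OF P(1), of ?b] col unfolding f_def g_def by auto
  have rows: "0 \<in> range e" "?b \<in> range e" using row fb unfolding ke(6) f_def g_def by auto
  have "e 0 \<le> 0"
  proof -
    obtain j where "e j = 0" using rows(1) by (metis rangeE)
    then show ?thesis using strict_mono_less_eq[OF ke(5), of 0 j] by simp
  qed
  then have e0: "e 0 = 0" by simp
  obtain j where j: "e j = ?b" using rows(2) by (metis rangeE)
  have K1: "1 \<notin> K" "f 0 \<notin> K" using fb row unfolding K f_def g_def by (auto intro: exI[of _ "?b"])
  have p1: "pos K 1 = 1" using pos_Suc[of K 0] K1 by simp
  have f0: "f 0 > 0" using row unfolding f_def by simp
  show "tau (lam', mu') = 0"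
  proof (cases "mu' = [] \<or> rectangle lam'")
    case False
    have "row lam' (length mu') \<noteq> row lam' 0"
    proof
      let ?j = "length mu'"
      assume eq: "row lam' ?j = row lam' 0"
      have "pos K (g (e ?j)) = 0" using ke(4) row_length[of mu'] by (simp add: dcols_pos)
      then have "\<not> 1 \<le> g (e ?j)" using pos_le_iff[OF K1(1), of "g (e ?j)"] p1 by simp
      then have "length mu \<le> e ?j" using length_le[OF P(2)] unfolding g_def by simp
      moreover have "pos K (f 0) \<le> pos K (f (e ?j))" using eq unfolding ke(3) by (simp add: dcols_pos e0)
      then have "f 0 \<le> f (e ?j)" using pos_le_iff[OF K1(2) f0] by blast
      ultimately show False using no_row ptnD[OF pf(1), of "length mu" "e ?j"] unfolding f_def by simp
    qed
    then show ?thesis using tau_0_iff[OF S'] False by blast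
  qed auto
  show "sigma (lam', mu') = 0"
  proof (cases "mu' = [] \<or> rectangle lam'")
    case False
    have "row lam' j = pos K (f ?b)" unfolding ke(3) using j by (simp add: dcols_pos)
    moreover have "pos K 1 \<le> pos K (f ?b)" using fb by (intro pos_mono) simp
    ultimately have "row lam' j > 0" using p1 by simp
    then have "j \<le> length lam' - 1" using row_pos[OF ke(1), of j] by simp
    then have "row lam' (length lam' - 1) \<le> row lam' j" by (rule ptnD[OF pf'(1)])
    also have "\<dots> \<le> pos K (g 0)"
      using \<open>row lam' j = pos K (f ?b)\<close> no_col unfolding f_def g_def by (simp add: pos_mono)
    also have "\<dots> = row mu' 0" unfolding ke(4) by (simp add: dcols_pos e0)
    finally show ?thesis using sigma_0_iff[OF S'] False by blast
  qed auto
qed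

text \<open>With l the multiplicity of the largest part and m the length of \<open>mu\<close>, rows
  m to l - 1 are full rows, and columns \<open>g 0 + 1\<close> to \<open>f (b - 1)\<close> meet all
  rows. They are removed one at a time by \<open>mfree_shift\<close> and \<open>mfree_dec\<close>;
  the final basic demolition is harmless.\<close>

lemma tight_demolition:
  assumes S: "skew_partition (lam, mu)" and B: "basic (lam, mu)" and sh: "sharp n (lam, mu)" and n: "n > 0"
  shows "\<exists>lam' mu'. tight_demolition (lam, mu) = (lam', mu') \<and> skew_partition (lam', mu') \<and> tight (lam', mu') \<and>
    sharp (n - tau (lam, mu)) (lam', mu') \<and>
    (multiplicity_free n (lam, mu) \<longleftrightarrow> multiplicity_free (n - tau (lam, mu)) (lam', mu'))"
proof (cases "mu = [] \<or> rectangle lam")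
  case True
  then have "tau (lam, mu) = 0" "sigma (lam, mu) = 0" by auto
  moreover from this have "tight_demolition (lam, mu) = (lam, mu)"
    using basic_demolition_basic[OF S B] by (simp del: basic_demolition.simps tau.simps sigma.simps)
  ultimately show ?thesis using S B sh unfolding tight_def by auto
next
  case False
  define f where "f = row lam"
  define g where "g = row mu"
  define t where "t = tau (lam, mu)"
  define s where "s = sigma (lam, mu)"
  define b where "b = length lam"
  define m where "m = length mu"
  define l where "l = count_list lam (hd lam)"
  have P: "is_partition lam" "is_partition mu" and gf: "\<And>i. g i \<le> f i"
    using S unfolding skew_partition_row f_def g_def by auto
  have pf: "ptn f" "ptn g" using ptn_row P unfolding f_def g_def by auto
  have ne: "lam \<noteq> []" using skew_nonempty[OF S] False by blast
  have bf: "\<And>i. f i > 0 \<Longrightarrow> g i < f i" "\<And>c. 0 < c \<Longrightarrow> c \<le> f 0 \<Longrightarrow> \<exists>i. g i < c \<and> c \<le> f i"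
    using B unfolding basic_row[OF P(1)] basicf_def f_def g_def by auto
  have fpos: "f i > 0 \<longleftrightarrow> i < b" for i unfolding f_def b_def by (rule row_pos[OF P(1)])
  have gpos: "g i > 0 \<longleftrightarrow> i < m" for i unfolding g_def m_def by (rule row_pos[OF P(2)])
  have b0: "b > 0" and m0: "m > 0" using ne False unfolding b_def m_def by auto
  have l: "f i = f 0 \<longleftrightarrow> i < l" for i unfolding f_def l_def by (rule count_hd[OF P(1) ne])
  have l0: "l > 0" using l[of 0] by simp
  \<comment> \<open>Column 1 is not empty, so some row has no box of \<open>mu\<close>.\<close>
  have mb: "m < b"
  proof -
    obtain i where "g i < 1" "1 \<le> f i" using bf(2)[of 1] fpos[of 0] b0 by auto
    then show ?thesis using gpos[of i] fpos[of i] by simp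
  qed
  have lb: "l < b"
  proof (rule ccontr)
    assume "\<not> l < b"
    then have "f i = f 0" if "i < b" for i using l[of i] that by simp
    then have "f ` {..<b} \<subseteq> {f 0}" by blast
    moreover have "f 0 \<in> f ` {..<b}" using b0 by blast
    ultimately have "f ` {..<b} = {f 0}" by blast
    then have "set lam = {f 0}" unfolding f_def b_def row_image .
    then show False using False by (simp add: rectangle_def np_def)
  qed
  have t: "t = l - min l m" unfolding t_def l_def m_def using False by simp
  have s: "s = f (b - 1) - min (g 0) (f (b - 1))"
    unfolding s_def f_def b_def g_def row_last[OF ne] using False row_hd[of mu] by auto
  have tl: "t < l" using t l0 m0 by auto
  have sf: "s < f (b - 1)" using s fpos[of "b - 1"] gpos[of 0] b0 m0 by auto
  have fl: "f (b - 1) < f 0"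
  proof -
    have "\<not> b - 1 < l" using lb by linarith
    then show ?thesis using l[of "b - 1"] ptnD[OF pf(1), of 0 "b - 1"] by simp
  qed
  define lam1 where "lam1 = map (\<lambda>x. x - s) (drop t lam)"
  define f1 where "f1 = (\<lambda>i. f (i + t) - s)"
  have f1: "row lam1 = f1"
    by (auto simp: lam1_def f1_def f_def row_nth fun_eq_iff add.commute)
  have lower: "f (b - 1) \<le> f i" if "i < b" for i using ptnD[OF pf(1), of i "b - 1"] that by simp
  have P1: "is_partition lam1"
  proof -
    have "sorted_wrt (\<ge>) lam" using P(1) unfolding is_partition_def by blast
    then have "sorted_wrt (\<ge>) (drop t lam)" by (rule sorted_wrt_drop)
    then have "sorted_wrt (\<ge>) lam1" unfolding lam1_def sorted_wrt_map
      by (rule sorted_wrt_mono_rel[rotated]) (simp add: diff_le_mono)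
    moreover have "x \<noteq> 0" if x: "x \<in> set lam1" for x
    proof -
      obtain y where y: "y \<in> set lam" "x = y - s"
        using x set_drop_subset[of t lam] unfolding lam1_def by auto
      obtain i where "i < b" "y = f i" using y(1) unfolding b_def f_def by (auto simp: in_set_conv_nth row_nth)
      then show ?thesis using lower[of i] sf y by simp
    qed
    ultimately show ?thesis unfolding is_partition_def by blast
  qed
  have b1: "length lam1 = b - t" by (simp add: lam1_def b_def)
  \<comment> \<open>If t > 0, the t full rows are those from m to l - 1.\<close>
  have tm: "t = 0 \<or> t + m = l" using t by auto
  have mbt: "m < b - t" using tm mb lb tl by auto
  have full: "f (i + t) = f 0 \<or> t = 0" if "i < m" for i using tm l[of "i + t"] that by auto
  have gf1: "g i \<le> f1 i" for i
  proof (cases "i < m")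
    case True
    have "g i \<le> f (i + t)" using full[OF True] gf[of i] ptnD[OF pf(1), of 0 i] by (metis add.right_neutral le_trans le0)
    moreover have "g i \<le> f (i + t) - s" if "s > 0"
    proof -
      have "i + t < b" using True mbt by simp
      then have "f (b - 1) - s \<le> f (i + t) - s" using lower by (intro diff_le_mono)
      moreover have "f (b - 1) - s = g 0" using s that by auto
      ultimately show ?thesis using ptnD[OF pf(2), of 0 i] by simp
    qed
    ultimately show ?thesis unfolding f1_def by (cases "s > 0") auto
  next
    case False
    then show ?thesis using gpos[of i] by simp
  qed
  have S1: "skew_partition (lam1, mu)"
    unfolding skew_partition_row f1 g_def[symmetric] using P1 P(2) gf1 by blast
  have ft: "f t = f 0" using l[of t] tl by simp
  obtain lam' mu' where L': "basic_demolition (lam1, mu) = (lam', mu')" by fastforce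
  have TD: "tight_demolition (lam, mu) = (lam', mu')"
    using L' unfolding tight_demolition.simps lam1_def t_def s_def .
  have f1b: "f1 (length lam1 - 1) = f (b - 1) - s"
    using b1 mbt unfolding f1_def by simp
  \<comment> \<open>If s > 0, the last row shrinks to \<open>g 0\<close> and the first row is still
    longer, since \<open>lam\<close> is no rectangle.\<close>
  have r1: "row mu 0 < row lam1 0"
    using s bf(1)[of 0] fpos[of 0] b0 fl unfolding f1 g_def[symmetric] f1_def by (auto simp: ft min_def)
  have r2: "lam1 \<noteq> []" using b1 mbt by auto
  have "\<not> b - t - 1 < m" using mbt by linarith
  then have r3: "row mu (length lam1 - 1) = 0" using gpos[of "b - t - 1"] b1 unfolding g_def by simp
  have r5: "row lam1 (length lam1 - 1) \<le> row mu 0"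
    unfolding f1 f1b g_def[symmetric] using s by auto
  have "\<not> m + t < l" using t by auto
  then have "f (m + t) < f 0" using l[of "m + t"] ptnD[OF pf(1), of 0 "m + t"] by simp
  then have r4: "row lam1 (length mu) < row lam1 0"
    using sf fl unfolding f1 m_def[symmetric] f1_def by (simp add: ft diff_less_mono2)
  note basic_demolition_tight[OF S1 L' r1 r2 r3 r4 r5]
  then have tight': "tight (lam', mu')" unfolding tight_def using basic_demolition(2)[OF S1 L'] by blast
  have heights: "t + height f1 g c < n" if c: "0 < c" "c \<le> f1 0" for c
  proof -
    define A1 where "A1 = {i. g i < c \<and> c \<le> f1 i}"
    define A0 where "A0 = {i. g i < c + s \<and> c + s \<le> f i}"
    \<comment> \<open>Column c of the new diagram comes from column c + s of the old one. The map h
      leaves out the t full rows m to m + t - 1, so the old column has at least t boxes more than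
      the new one.\<close>
    define h where "h = (\<lambda>i. if i < m then i else i + t)"
    have c0: "c + s \<le> f 0" using c unfolding f1_def by (simp add: ft)
    have finA: "finite A0"
    proof (rule finite_subset)
      show "A0 \<subseteq> {..<b}"
      proof
        fix i assume "i \<in> A0"
        then have "f i > 0" using c unfolding A0_def by simp
        then show "i \<in> {..<b}" using fpos by blast
      qed
    qed simp
    have "h ` A1 \<union> {m..<m + t} \<subseteq> A0"
    proof
      fix x assume "x \<in> h ` A1 \<union> {m..<m + t}"
      then consider i where "i \<in> A1" "i < m" "x = i" | i where "i \<in> A1" "i \<ge> m" "x = i + t" | "m \<le> x" "x < m + t"
        unfolding h_def by (auto split: if_splits)
      then show "x \<in> A0"
      proof cases
        case 1
        have "c + s \<le> f i"
        proof (cases "t = 0")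
          case True
          then show ?thesis using 1 c unfolding A1_def f1_def by auto
        next
          case False
          then have "f i = f 0" using l[of i] 1 tm by simp
          then show ?thesis using c0 by simp
        qed
        then show ?thesis using 1 unfolding A0_def A1_def by auto
      next
        case 2
        then show ?thesis using c gpos[of "i + t"] unfolding A0_def A1_def f1_def by auto
      next
        case 3
        then have "f x = f 0" using l[of x] tm by auto
        then show ?thesis using 3 c0 c gpos[of x] unfolding A0_def by auto
      qed
    qed
    then have "card (h ` A1 \<union> {m..<m + t}) \<le> card A0" by (rule card_mono[OF finA])
    moreover have "card (h ` A1 \<union> {m..<m + t}) = card (h ` A1) + card {m..<m + t}"
    proof (rule card_Un_disjoint)
      show "finite (h ` A1)" using finite_subset[OF _ finA] \<open>h ` A1 \<union> {m..<m + t} \<subseteq> A0\<close> by blast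
      show "h ` A1 \<inter> {m..<m + t} = {}" unfolding h_def by auto
    qed simp
    moreover have "inj_on h A1" by (rule inj_onI) (auto simp: h_def split: if_splits)
    then have "card (h ` A1) = height f1 g c" by (simp add: card_image height_def A1_def)
    moreover have "card A0 < n"
      using sh c c0 unfolding sharp_height height_def A0_def f_def g_def by simp
    ultimately show ?thesis by simp
  qed
  have "f1 0 > 0" using sf fl unfolding f1_def by (simp add: ft)
  then have tn: "t < n" using heights[of 1] by simp
  have sh1: "sharp (n - t) (lam1, mu)"
    unfolding sharp_height f1 g_def[symmetric]
  proof (intro allI impI)
    fix c assume "0 < c \<and> c \<le> f1 0"
    then show "height f1 g c < n - t" using heights[of c] by linarith
  qed
  \<comment> \<open>This is the bound that \<open>mfree_dec\<close> requires: column
    \<open>g 0 + 1\<close> has b boxes, and sharpness makes b smaller than n.\<close>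
  have bn: "b - t \<le> n - t" if "s > 0"
  proof -
    have gs: "g 0 < f (b - 1)" using s that by auto
    have "Suc (g 0) \<le> f i \<longleftrightarrow> i < b" for i
      using gs lower[of i] fpos[of i] by (cases "i < b") auto
    moreover have "g i < Suc (g 0)" for i using ptnD[OF pf(2), of 0 i] by simp
    ultimately have "{i. g i < Suc (g 0) \<and> Suc (g 0) \<le> f i} = {..<b}" by auto
    then have "b = height f g (Suc (g 0))" unfolding height_def by simp
    also have "\<dots> < n" using sh gs fl unfolding sharp_height f_def g_def by auto
    finally show ?thesis by simp
  qed
  \<comment> \<open>Row m stays full through all t steps, as m + j is below l for j < t.\<close>
  have M1: "j \<le> t \<Longrightarrow> mfree n f g \<longleftrightarrow> mfree (n - j) (\<lambda>i. f (i + j)) g" for j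
  proof (induction j)
    case (Suc j)
    have "ptn (\<lambda>i. f (i + j))"
      using ptn_comp[OF pf(1), of "\<lambda>i. i + j"] by (simp add: comp_def strict_mono_def)
    moreover have "f (m + j) = f (0 + j)" using l[of "m + j"] l[of j] tm Suc.prems by auto
    ultimately have "mfree (n - j) (\<lambda>i. f (i + j)) g \<longleftrightarrow> mfree (n - j - 1) (shift (\<lambda>i. f (i + j))) g"
      using gpos[of m] tn Suc.prems by (intro mfree_shift[where i=m]) auto
    then show ?case using Suc by (simp add: shift_def)
  qed simp
  \<comment> \<open>For k < s the last row is still longer than \<open>g 0\<close>, so a column that
    meets all b - t rows is left.\<close>
  have M2: "k \<le> s \<Longrightarrow> mfree (n - t) (\<lambda>i. f (i + t)) g \<longleftrightarrow> mfree (n - t) (\<lambda>i. f (i + t) - k) g" for k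
  proof (induction k)
    case (Suc k)
    have p: "ptn (\<lambda>i. f (i + t))"
      using ptn_comp[OF pf(1), of "\<lambda>i. i + t"] by (simp add: comp_def strict_mono_def)
    have fb: "f (b - t + t) = 0"
    proof (rule ccontr)
      assume "f (b - t + t) \<noteq> 0"
      then show False using fpos[of "b - t + t"] by simp
    qed
    have "ptn (\<lambda>i. f (i + t) - k)" by (rule ptn_map[OF p]) auto
    moreover have "g 0 < f (b - t - 1 + t) - k" using s Suc.prems mbt by auto
    ultimately have "mfree (n - t) (\<lambda>i. f (i + t) - k) g \<longleftrightarrow> mfree (n - t) (dec (\<lambda>i. f (i + t) - k)) g"
      using fb bn Suc.prems mbt by (intro mfree_dec[where b="b - t"]) auto
    then show ?case using Suc by (simp add: dec_def)
  qed simp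
  have "multiplicity_free n (lam, mu) \<longleftrightarrow> multiplicity_free (n - t) (lam1, mu)"
    unfolding multiplicity_free_mfree[OF S] multiplicity_free_mfree[OF S1] f1 f_def[symmetric] g_def[symmetric] f1_def
    using M1[of t] M2[of s] by simp
  then show ?thesis
    using TD basic_demolition[OF S1 L'] tight' sh1 unfolding t_def by blast
qed

section \<open>Ordinary reduction\<close>

lemma complement_row:
  assumes "is_partition lam"
  shows "row (complement a b lam) = rot a b (row lam)" "is_partition (complement a b lam)"
    "set (complement a b lam) = (\<lambda>i. a - row lam i) ` {..<b} - {0}"
proof -
  define xs where "xs = map (\<lambda>i. a - part lam i) (rev [1..<Suc b])"
  have nth: "xs ! i = a - row lam (b - 1 - i)" if "i < b" for i
  proof -
    have "rev [1..<Suc b] ! i = Suc (b - 1 - i)" using that by (simp add: rev_nth del: upt_Suc)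
    then show ?thesis using that unfolding xs_def row_def by (simp del: upt_Suc)
  qed
  have len: "length xs = b" unfolding xs_def by (simp del: upt_Suc)
  have "row xs = rot a b (row lam)" using nth len by (auto simp: row_nth[of xs] rot_def fun_eq_iff)
  moreover have "sorted_wrt (\<ge>) xs"
    unfolding sorted_wrt_iff_nth_less len
    using nth ptnD[OF ptn_row[OF assms]] by (auto intro!: diff_le_mono2)
  note * = row_filter[OF this]
  moreover have c: "complement a b lam = filter (\<lambda>x. x > 0) xs" unfolding complement_def xs_def ..
  ultimately show "row (complement a b lam) = rot a b (row lam)" "is_partition (complement a b lam)" by auto
  have "set xs = (\<lambda>i. a - part lam i) ` Suc ` {..<b}"
    unfolding xs_def by (simp add: image_Suc_lessThan atLeastLessThanSuc_atLeastAtMost del: upt_Suc)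
  also have "\<dots> = (\<lambda>i. a - row lam i) ` {..<b}" by (simp add: image_image row_def)
  finally show "set (complement a b lam) = (\<lambda>i. a - row lam i) ` {..<b} - {0}" unfolding c by auto
qed

text \<open>Rotation preserves boxes in rows and columns, hence basic, sharp and tight. It turns the
  numbers p and q of distinct parts of \<open>lam\<close> and \<open>mu\<close> into q + 1 and p -
  1, so the failing inequality p - 1 \<le> q becomes q \<le> p - 1.\<close>

lemma ordinary_reduction:
  assumes S: "skew_partition (lam, mu)" and T: "tight (lam, mu)" and sh: "sharp n (lam, mu)"
  shows "\<exists>lam' mu'. ordinary_reduction (lam, mu) = (lam', mu') \<and> skew_partition (lam', mu') \<and> tight (lam', mu') \<and>
    sharp n (lam', mu') \<and> ordinary (lam', mu') \<and>
    (multiplicity_free n (lam, mu) \<longleftrightarrow> multiplicity_free n (lam', mu'))"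
proof (cases "np lam - 1 > np mu \<and> mu \<noteq> []")
  case False
  then show ?thesis using assms unfolding tight_def by auto
next
  case True
  define f where "f = row lam"
  define g where "g = row mu"
  define a where "a = f 0"
  define b where "b = length lam"
  define lam' where "lam' = complement a b mu"
  define mu' where "mu' = complement a b lam"
  have P: "is_partition lam" "is_partition mu" and gf: "\<And>i. g i \<le> f i"
    using S unfolding skew_partition_row f_def g_def by auto
  have pf: "ptn f" "ptn g" using ptn_row P unfolding f_def g_def by auto
  have ne: "lam \<noteq> []" using skew_nonempty[OF S] True by blast
  have bf: "\<And>i. f i > 0 \<Longrightarrow> g i < f i" "\<And>c. 0 < c \<Longrightarrow> c \<le> f 0 \<Longrightarrow> \<exists>i. g i < c \<and> c \<le> f i"
    using T unfolding tight_def basic_row[OF P(1)] basicf_def f_def g_def by auto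
  have fpos: "f i > 0 \<longleftrightarrow> i < b" for i unfolding f_def b_def by (rule row_pos[OF P(1)])
  have gpos: "g i > 0 \<longleftrightarrow> i < length mu" for i unfolding g_def by (rule row_pos[OF P(2)])
  have b0: "b > 0" using ne unfolding b_def by auto
  have fa: "f i \<le> a" "g i \<le> a" for i using ptnD[OF pf(1), of 0 i] gf[of i] unfolding a_def by auto
  have fb: "f i = 0" "g i = 0" if "i \<ge> b" for i using fpos[of i] gf[of i] that by auto
  have a0: "a > 0" using fpos[of 0] b0 unfolding a_def by simp
  have mb: "length mu < b"
  proof -
    obtain i where "g i < 1" "1 \<le> f i" using bf(2)[of 1] a0 unfolding a_def by auto
    then show ?thesis using gpos[of i] fpos[of i] by simp
  qed
  have gb: "g (b - 1) = 0"
  proof -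
    have "\<not> b - 1 < length mu" using mb by linarith
    then show ?thesis using gpos[of "b - 1"] by simp
  qed
  have eq: "ordinary_reduction (lam, mu) = (lam', mu')"
    using True unfolding lam'_def mu'_def a_def b_def f_def by (simp add: row_def)
  have L: "row lam' = rot a b g" "row mu' = rot a b f" and P': "is_partition lam'" "is_partition mu'"
    using complement_row P unfolding lam'_def mu'_def f_def g_def by auto
  have "rot a b f i \<le> rot a b g i" for i using gf by (simp add: rot_def diff_le_mono2)
  then have S': "skew_partition (lam', mu')" unfolding skew_partition_row L using P' by blast
  \<comment> \<open>Row i is exchanged with row b - 1 - i, and column c with column a + 1 -
    c.\<close>
  have box: "rot a b f i < c \<and> c \<le> rot a b g i \<longleftrightarrow> i < b \<and> g (b - 1 - i) < a + 1 - c \<and> a + 1 - c \<le> f (b - 1 - i)"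
    if "0 < c" "c \<le> a" for i c
    using that fa(1)[of "b - 1 - i"] fa(2)[of "b - 1 - i"] by (auto simp: rot_def)
  have r0: "rot a b g 0 = a" using b0 gb by (simp add: rot_def)
  have rpos: "rot a b g i > 0 \<longleftrightarrow> i < b" for i
  proof -
    have "g (b - 1 - i) < a" if "i < b"
      using bf(1)[of "b - 1 - i"] fpos[of "b - 1 - i"] fa(1)[of "b - 1 - i"] that by simp
    then show ?thesis by (auto simp: rot_def)
  qed
  have len: "length lam' = b"
    using row_pos[OF P'(1)] rpos unfolding L by (meson linorder_neqE_nat less_irrefl)
  have basic': "basic (lam', mu')" unfolding basic_row[OF P'(1)] L basicf_def
  proof (intro conjI allI impI)
    fix i assume "rot a b g i > 0"
    then have "i < b" using rpos by blast
    then show "rot a b f i < rot a b g i"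
      using bf(1)[of "b - 1 - i"] fpos[of "b - 1 - i"] fa[of "b - 1 - i"] by (simp add: rot_def)
  next
    fix c assume c: "0 < c \<and> c \<le> rot a b g 0"
    then have "0 < a + 1 - c" "a + 1 - c \<le> f 0" using r0 unfolding a_def by auto
    then obtain i where i: "g i < a + 1 - c" "a + 1 - c \<le> f i" using bf(2) by blast
    then have "f i > 0" using \<open>0 < a + 1 - c\<close> by simp
    then have "i < b" using fpos by blast
    then have "rot a b f (b - 1 - i) < c \<and> c \<le> rot a b g (b - 1 - i)"
      using box[of c "b - 1 - i"] c r0 i by simp
    then show "\<exists>i. rot a b f i < c \<and> c \<le> rot a b g i" by blast
  qed
  have sharp': "sharp n (lam', mu')" unfolding sharp_height L r0
  proof (intro allI impI)
    fix c assume c: "0 < c \<and> c \<le> a"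
    let ?A = "{i. i < b \<and> g (b - 1 - i) < a + 1 - c \<and> a + 1 - c \<le> f (b - 1 - i)}"
    let ?B = "{i. g i < a + 1 - c \<and> a + 1 - c \<le> f i}"
    have "{i. rot a b f i < c \<and> c \<le> rot a b g i} = ?A" using box c by blast
    moreover have "card ?A = card ?B"
    proof (rule bij_betw_same_card[of "\<lambda>i. b - 1 - i"], rule bij_betw_byWitness[where f'="\<lambda>i. b - 1 - i"])
      have lt: "i < b" if "a + 1 - c \<le> f i" for i
      proof -
        have "f i > 0" using that c by (intro gr0I) simp
        then show ?thesis using fpos by blast
      qed
      show "\<forall>i\<in>?B. b - 1 - (b - 1 - i) = i" "(\<lambda>i. b - 1 - i) ` ?B \<subseteq> ?A"
        using lt by fastforce+
    qed auto
    moreover have "height f g (a + 1 - c) < n"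
      using sh c unfolding sharp_height f_def[symmetric] g_def[symmetric] a_def by auto
    ultimately show "height (rot a b g) (rot a b f) c < n" unfolding height_def by simp
  qed
  have nr: "\<not> rectangle lam" using True unfolding rectangle_def by auto
  have t0: "f (length mu) \<noteq> f 0" using tau_0_iff[OF S _ nr] True T unfolding tight_def f_def by metis
  have s0: "f (b - 1) \<le> g 0" using sigma_0_iff[OF S _ nr] True T unfolding tight_def f_def g_def b_def by metis
  \<comment> \<open>A full row of the rotated diagram would be a full row of the original
    one.\<close>
  have "tau (lam', mu') = 0"
  proof (cases "mu' = [] \<or> rectangle lam'")
    case False
    have "row lam' (length mu') \<noteq> row lam' 0"
    proof
      let ?j = "length mu'"
      assume e: "row lam' ?j = row lam' 0"
      have ga: "rot a b g ?j = a" using e r0 unfolding L by simp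
      have fz: "rot a b f ?j = 0" using row_length[of mu'] unfolding L .
      have jb: "?j < b" using ga a0 unfolding rot_def by (auto split: if_splits)
      have "g (b - 1 - ?j) = 0" "f (b - 1 - ?j) = f 0"
        using ga fz jb a0 fa[of "b - 1 - ?j"] unfolding rot_def a_def by auto
      then show False using t0 gpos[of "b - 1 - ?j"] ptnD[OF pf(1), of "length mu" "b - 1 - ?j"] fa(1)[of "length mu"]
        unfolding a_def by simp
    qed
    then show ?thesis using tau_0_iff[OF S'] False by blast
  qed auto
  moreover have "sigma (lam', mu') = 0"
  proof (cases "mu' = [] \<or> rectangle lam'")
    case False
    have "row lam' (length lam' - 1) \<le> row mu' 0"
      unfolding L len using b0 s0 by (simp add: rot_def diff_le_mono2)
    then show ?thesis using sigma_0_iff[OF S'] False by blast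
  qed auto
  ultimately have tight': "tight (lam', mu')" unfolding tight_def using basic' by blast
  have inj: "inj_on (\<lambda>x. a - x) {..a}" by (auto intro!: inj_onI)
  have fset: "f ` {..<b} = set lam" unfolding f_def b_def by (rule row_image)
  \<comment> \<open>The value 0 occurs because \<open>mu\<close> has fewer than b rows; in the
    complement it becomes the part a.\<close>
  have gset: "g ` {..<b} = insert 0 (set mu)"
  proof (intro equalityI subsetI)
    fix x assume "x \<in> g ` {..<b}"
    then show "x \<in> insert 0 (set mu)" unfolding g_def by (auto simp: row_nth)
  next
    fix x assume "x \<in> insert 0 (set mu)"
    then consider "x = 0" | i where "i < length mu" "x = g i"
      unfolding g_def by (auto simp: row_nth in_set_conv_nth)
    then show "x \<in> g ` {..<b}"
    proof cases
      case 1
      then show ?thesis using gb b0 by (intro image_eqI[of _ _ "b - 1"]) auto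
    qed (use mb in auto)
  qed
  have lta: "x < a" if x: "x \<in> insert 0 (set mu)" for x
  proof -
    obtain i where "i < b" "x = g i" using x unfolding gset[symmetric] by auto
    then show ?thesis using bf(1)[of i] fpos[of i] fa(1)[of i] by simp
  qed
  have "set lam' = (\<lambda>x. a - x) ` g ` {..<b} - {0}"
    unfolding lam'_def complement_row(3)[OF P(2)] g_def by (simp add: image_image)
  then have "set lam' = (\<lambda>x. a - x) ` insert 0 (set mu)"
    using lta unfolding gset by fastforce
  moreover have "card ((\<lambda>x. a - x) ` insert 0 (set mu)) = card (insert 0 (set mu))"
    by (rule card_image, rule inj_on_subset[OF inj]) (use lta in fastforce)
  moreover have "0 \<notin> set mu" using P(2) unfolding is_partition_def by blast
  ultimately have nl: "np lam' = Suc (np mu)" unfolding np_def by simp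
  have le: "x \<le> a" if "x \<in> set lam" for x using that fa(1) unfolding fset[symmetric] by auto
  have "set mu' = (\<lambda>x. a - x) ` f ` {..<b} - {0}"
    unfolding mu'_def complement_row(3)[OF P(1)] f_def by (simp add: image_image)
  then have "set mu' = (\<lambda>x. a - x) ` (set lam - {a})"
    using le unfolding fset by fastforce
  moreover have "card ((\<lambda>x. a - x) ` (set lam - {a})) = card (set lam - {a})"
    by (rule card_image, rule inj_on_subset[OF inj]) (use le in auto)
  moreover have "a \<in> set lam" using b0 unfolding fset[symmetric] a_def by blast
  \<comment> \<open>The part a of \<open>lam\<close> becomes 0 in the complement and drops
    out.\<close>
  ultimately have nm: "np mu' = np lam - 1" unfolding np_def by simp
  have "ordinary (lam', mu')" using basic' nl nm True by simp
  moreover have "lr_num (rot a b g) (rot a b f) = lr_num f g" by (rule lr_num_rot) (use pf fa fb in auto)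
  then have "multiplicity_free n (lam, mu) \<longleftrightarrow> multiplicity_free n (lam', mu')"
    unfolding multiplicity_free_mfree[OF S] multiplicity_free_mfree[OF S'] L mfree_def f_def g_def by simp
  ultimately show ?thesis using eq S' tight' sharp' by blast
qed

section \<open>The reduction as a whole\<close>

text \<open>In this case the polynomial in n variables is 0 and the sharp demolition is empty, with
  polynomial 1. With \<open>multiplicity_free_empty\<close> both sides of the equivalence are
  true.\<close>

lemma tall_column:
  assumes S: "skew_partition (lam, mu)" and k: "k \<in> cols (lam, mu)" "CS k (lam, mu) > n"
  shows "multiplicity_free n (lam, mu)"
proof -
  have P: "ptn (row lam)" "ptn (row mu)" "\<And>i. row mu i \<le> row lam i"
    using S ptn_row unfolding skew_partition_row by auto
  have "k > 0" using k(1) unfolding cols_row by simp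
  then obtain p where p: "\<forall>i. k \<le> row mu i \<longleftrightarrow> i < p"
      "\<forall>i. k \<le> row lam i \<longleftrightarrow> i < p + card {i. row mu i < k \<and> k \<le> row lam i}"
    using column_height[OF P, of k] by blast
  have "\<not> k \<le> row mu p" using p(1) by (metis less_irrefl)
  moreover have "k \<le> row lam (p + n)" using p(2)[rule_format, of "p + n"] k(2) unfolding CS_height height_def by simp
  ultimately have "row mu p < row lam (p + n)" by linarith
  then show ?thesis unfolding multiplicity_free_mfree[OF S] by (rule mfree_tall[OF P(1)])
qed

lemma multiplicity_free_empty: "multiplicity_free n ([], [])"
proof -
  have "skew_partition ([], [])" by (simp add: is_partition_def)
  moreover have "is_lr emp emp (\<lambda>v. of_bool (v = emp))"
    unfolding is_lr_def using ptn_emp by simp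
  then have "mfree n emp emp" unfolding mfree_def by (simp add: lr_num_eqI)
  ultimately show ?thesis using multiplicity_free_mfree[of "[]" "[]" n] by simp
qed

text \<open>Sharpness is stated for n and for n'. The tight demolition yields it for n', which is
  the stronger form because n' \<le> n.\<close>

theorem theorem1p8:
  fixes lam mu :: "nat list" and n :: nat
  assumes "skew_partition (lam, mu)" and "n > 0"
  shows "let S = basic_demolition (sharp_demolition n (lam, mu));
             n' = n - tau S;
             red = ordinary_reduction (tight_demolition S)
         in skew_partition red \<and> basic red \<and> sharp n red \<and> sharp n' red \<and>
            tight red \<and> ordinary red \<and>
            (multiplicity_free n (lam, mu) \<longleftrightarrow> multiplicity_free n' red)"
proof -
  obtain lam1 mu1 where 1: "sharp_demolition n (lam, mu) = (lam1, mu1)" "skew_partition (lam1, mu1)"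
    "sharp n (lam1, mu1)" "multiplicity_free n (lam, mu) \<longleftrightarrow> multiplicity_free n (lam1, mu1)"
  proof (cases "\<exists>k\<in>cols (lam, mu). CS k (lam, mu) > n")
    case True
    then have "sharp_demolition n (lam, mu) = ([], [])" by simp
    moreover have "multiplicity_free n (lam, mu)" using True tall_column[OF assms(1)] by blast
    moreover have "skew_partition ([], [])" by (simp add: is_partition_def)
    moreover have "sharp n ([], [])" by (simp add: sharp_height)
    ultimately show ?thesis using that multiplicity_free_empty by blast
  next
    case False
    then show ?thesis using that sharp_demolition[OF assms] by (metis not_le)
  qed
  obtain lam2 mu2 where 2: "basic_demolition (lam1, mu1) = (lam2, mu2)" by fastforce
  note b = basic_demolition[OF 1(2) 2]
  obtain lam3 mu3 where 3: "tight_demolition (lam2, mu2) = (lam3, mu3)" "skew_partition (lam3, mu3)"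
    "tight (lam3, mu3)" "sharp (n - tau (lam2, mu2)) (lam3, mu3)"
    "multiplicity_free n (lam2, mu2) \<longleftrightarrow> multiplicity_free (n - tau (lam2, mu2)) (lam3, mu3)"
    using tight_demolition[OF b(1,2) b(3)[OF 1(3)] assms(2)] by blast
  obtain lam4 mu4 where 4: "ordinary_reduction (lam3, mu3) = (lam4, mu4)" "skew_partition (lam4, mu4)"
    "tight (lam4, mu4)" "sharp (n - tau (lam2, mu2)) (lam4, mu4)" "ordinary (lam4, mu4)"
    "multiplicity_free (n - tau (lam2, mu2)) (lam3, mu3) \<longleftrightarrow> multiplicity_free (n - tau (lam2, mu2)) (lam4, mu4)"
    using ordinary_reduction[OF 3(2-4)] by blast
  have "sharp n (lam4, mu4)" using 4(4) unfolding sharp_def by (meson diff_le_self less_le_trans)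
  moreover have "basic (lam4, mu4)" using 4(3) unfolding tight_def by blast
  moreover have "multiplicity_free n (lam, mu) \<longleftrightarrow> multiplicity_free (n - tau (lam2, mu2)) (lam4, mu4)"
    using 1(4) b(4)[of n] 3(5) 4(6) by blast
  ultimately show ?thesis unfolding Let_def 1(1) 2 3(1) 4(1) using 4(2-5) by blast
qed

end
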